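(* Let $n\ge1$ and let $\eta\in\mathcal S(\mathbb R^n)$ with $\|\eta\|_2=1$. The linear mapping $\nu:C^*(\mathbb R^{2n})\to\mathcal F_n$ defined by $\nu(h)(\lambda)=\nu_\lambda(h)$ for $\lambda\in\mathbb R^*$ and $\nu(h)(0)=h$ has the following properties: 1. $\|\nu\|=1$. 2. For every $h,h'\in C^*(\mathbb R^{2n})$, $\lim_{\lambda\to0}\|\nu_\lambda(h\cdot h')-\nu_\lambda(h)\circ\nu_\lambda(h')\|_{\rm op}=0$ and $\lim_{\lambda\to0}\|\nu_\lambda(h^* )-\nu_\lambda(h)^*\|_{\rm op}=0$. 3. For $(a,b)\in\mathbb R^n\times\mathbb R^n$ and $h\in C^*(\mathbb R^{2n})$, $\lim_{\lambda\to0}\|\nu(h)(\lambda)\eta(\lambda,a,b)-\hat h(a,b)\eta(\lambda,a,b)\|_2=0$. 4. For every $h\in C^*(\mathbb R^{2n})$, $\lim_{\lambda\to0}\|\nu(h)(\lambda)\|_{\rm op}=\|\hat h\|_\infty$.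
   Context: $\mathbb R^*=\mathbb R\setminus\{0\}$. $C^*(\mathbb R^{2n})$ is the group $C^*$-algebra of $\mathbb R^{2n}$, $h\cdot h'$ its product (convolution) and $h^*$ its involution. For $h\in C^*(\mathbb R^{2n})$, $\hat h\in C_0(\mathbb R^{2n})$ denotes its Fourier (Gelfand) transform, given for $h\in L^1(\mathbb R^{2n})$ by $\hat h(a,b)=\int h(x,y)e^{-2\pi i(x\cdot a+y\cdot b)}\,dx\,dy$; $\|h\|_{C^*(\mathbb R^{2n})}=\|\hat h\|_\infty$. $\mathcal F_n$ is the algebra (with pointwise operations) of all operator fields $F=(F(\lambda))_{\lambda\in\mathbb R}$ such that: $F(\lambda)$ is a compact operator on $L^2(\mathbb R^n)$ for every $\lambda\in\mathbb R^*$; $F(0)\in C^*(\mathbb R^{2n})$; $\lambda\mapsto F(\lambda)$ is norm continuous on $\mathbb R^*$; $\lim_{|\lambda|\to\infty}\|F(\lambda)\|_{\rm op}=0$; and $\|F\|:=\max\{\sup_{\lambda\in\mathbb R^*}\|F(\lambda)\|_{\rm op},\|F(0)\|_{C^*(\mathbb R^{2n})}\}<\infty$. For $\lambda\in\mathbb R^*$ and $u=(a,b)\in\mathbb R^n\times\mathbb R^n$ put $\eta(\lambda,u)(s)=\eta(\lambda,a,b)(s)=|\lambda|^{n/4}e^{2\pi i a\cdot s}\,\eta\big(|\lambda|^{1/2}(s+\tfrac{b}{\lambda})\big)$, $s\in\mathbb R^n$, and let $P_{\eta(\lambda,u)}$ be the orthogonal projection of $L^2(\mathbb R^n)$ onto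 $\mathbb C\,\eta(\lambda,u)$. For $h\in\mathcal S(\mathbb R^{2n})$ set $\nu_\lambda(h)=\int_{\mathbb R^{2n}}\hat h(u)P_{\eta(\lambda,u)}\frac{du}{|\lambda|^n}$; since $\|\nu_\lambda(h)\|_{\rm op}\le\|h\|_{C^*(\mathbb R^{2n})}$, $\nu_\lambda$ extends by continuity to a linear map $C^*(\mathbb R^{2n})\to B(L^2(\mathbb R^n))$, still denoted $\nu_\lambda$. *)

theory Defs
  imports "HOL-Analysis.Analysis"
begin

class complex_normed_vector = real_normed_vector +
  fixes scaleC :: "complex \<Rightarrow> 'a \<Rightarrow> 'a" (infixr "*\<^sub>C" 75)
  assumes scaleC_of_real: "of_real r *\<^sub>C x = r *\<^sub>R x"
    and scaleC_add_right: "c *\<^sub>C (x + y) = c *\<^sub>C x + c *\<^sub>C y"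
    and scaleC_add_left: "(c + d) *\<^sub>C x = c *\<^sub>C x + d *\<^sub>C x"
    and scaleC_scaleC: "c *\<^sub>C (d *\<^sub>C x) = (c * d) *\<^sub>C x"
    and norm_scaleC: "norm (c *\<^sub>C x) = cmod c * norm x"

lemma bounded_linear_scaleC:
  "bounded_linear (\<lambda>x :: 'a::complex_normed_vector. c *\<^sub>C x)"
proof (rule bounded_linear_intro[where K = "cmod c"])
  fix x y :: 'a and r :: real
  show "c *\<^sub>C (x + y) = c *\<^sub>C x + c *\<^sub>C y"
    by (rule scaleC_add_right)
  show "c *\<^sub>C (r *\<^sub>R x) = r *\<^sub>R (c *\<^sub>C x)"
    by (simp add: scaleC_of_real[symmetric] scaleC_scaleC mult.commute)
  show "norm (c *\<^sub>C x) \<le> norm x * cmod c"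
    by (simp add: norm_scaleC mult.commute)
qed

instantiation blinfun :: (real_normed_vector, complex_normed_vector) complex_normed_vector
begin

lift_definition scaleC_blinfun :: "complex \<Rightarrow> 'a \<Rightarrow>\<^sub>L 'b \<Rightarrow> 'a \<Rightarrow>\<^sub>L 'b"
  is "\<lambda>c f x. c *\<^sub>C f x"
  using bounded_linear_compose[OF bounded_linear_scaleC] by blast

instance
proof
  fix r :: real and c d :: complex and f g :: "'a \<Rightarrow>\<^sub>L 'b"
  show "of_real r *\<^sub>C f = r *\<^sub>R f"
    by transfer (simp add: scaleC_of_real)
  show "c *\<^sub>C (f + g) = c *\<^sub>C f + c *\<^sub>C g"
    by transfer (simp add: scaleC_add_right)
  show "(c + d) *\<^sub>C f = c *\<^sub>C f + d *\<^sub>C f"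
    by transfer (simp add: scaleC_add_left)
  show "c *\<^sub>C (d *\<^sub>C f) = (c * d) *\<^sub>C f"
    by transfer (simp add: scaleC_scaleC)
  have le: "norm (c *\<^sub>C f) \<le> cmod c * norm f" for c and f :: "'a \<Rightarrow>\<^sub>L 'b"
  proof (rule norm_blinfun_bound)
    fix x
    have "norm (blinfun_apply (c *\<^sub>C f) x) = cmod c * norm (blinfun_apply f x)"
      by (simp add: scaleC_blinfun.rep_eq norm_scaleC)
    also have "\<dots> \<le> cmod c * (norm f * norm x)"
      by (intro mult_left_mono norm_blinfun) simp
    finally show "norm (blinfun_apply (c *\<^sub>C f) x) \<le> cmod c * norm f * norm x"
      by (simp add: mult.assoc)
  qed simp
  show "norm (c *\<^sub>C f) = cmod c * norm f"
  proof (cases "c = 0")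
    case True
    have "0 \<le> norm (c *\<^sub>C f)" by (rule norm_ge_zero)
    with True le[of c f] show ?thesis by simp
  next
    case False
    have "(inverse c * c) *\<^sub>C f = of_real 1 *\<^sub>C f"
      using False by simp
    also have "\<dots> = f"
      by transfer (simp only: scaleC_of_real scaleR_one)
    finally have "f = inverse c *\<^sub>C (c *\<^sub>C f)"
      by (transfer, simp add: scaleC_scaleC)
    then have "norm f \<le> cmod (inverse c) * norm (c *\<^sub>C f)"
      by (metis le)
    then have "cmod c * norm f \<le> cmod c * (cmod (inverse c) * norm (c *\<^sub>C f))"
      by (rule mult_left_mono) simp
    also have "\<dots> = cmod (c * inverse c) * norm (c *\<^sub>C f)"
      by (simp only: norm_mult mult.assoc)
    also have "\<dots> = norm (c *\<^sub>C f)"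
      using False by simp
    finally have "cmod c * norm f \<le> norm (c *\<^sub>C f)" .
    with le[of c f] show ?thesis by simp
  qed
qed

end

definition complex_linear ::
    "('a::complex_normed_vector \<Rightarrow> 'b::complex_normed_vector) \<Rightarrow> bool" where
  "complex_linear f \<longleftrightarrow> (\<forall>x y. f (x + y) = f x + f y) \<and> (\<forall>c x. f (c *\<^sub>C x) = c *\<^sub>C f x)"


definition square_integrable :: "('a::euclidean_space \<Rightarrow> complex) \<Rightarrow> bool" where
  "square_integrable f \<longleftrightarrow>
    f \<in> borel_measurable lborel \<and> integrable lborel (\<lambda>x. (cmod (f x))\<^sup>2)"

definition l2_rel :: "('a::euclidean_space \<Rightarrow> complex) \<Rightarrow> ('a \<Rightarrow> complex) \<Rightarrow> bool" where
  "l2_rel f g \<longleftrightarrow> square_integrable f \<and> square_integrable g \<and> (AE x in lborel. f x = g x)"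

lemma square_integrable_add:
  assumes "square_integrable f" "square_integrable g"
  shows "square_integrable (\<lambda>x. f x + g x)"
proof -
  have [measurable]: "f \<in> borel_measurable lborel" "g \<in> borel_measurable lborel"
    using assms by (auto simp: square_integrable_def)
  have "integrable lborel (\<lambda>x. 2 * (cmod (f x))\<^sup>2 + 2 * (cmod (g x))\<^sup>2)"
    using assms by (auto simp: square_integrable_def)
  then have "integrable lborel (\<lambda>x. (cmod (f x + g x))\<^sup>2)"
  proof (rule Bochner_Integration.integrable_bound)
    show "AE x in lborel. norm ((cmod (f x + g x))\<^sup>2)
        \<le> norm (2 * (cmod (f x))\<^sup>2 + 2 * (cmod (g x))\<^sup>2)"
    proof (rule AE_I2)
      fix x
      have "(cmod (f x + g x))\<^sup>2 \<le> (cmod (f x) + cmod (g x))\<^sup>2"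
        by (intro power_mono norm_triangle_ineq) simp
      also have "\<dots> \<le> 2 * (cmod (f x))\<^sup>2 + 2 * (cmod (g x))\<^sup>2"
        using sum_squares_bound[of "cmod (f x)" "cmod (g x)"] by (simp add: power2_sum)
      finally show "norm ((cmod (f x + g x))\<^sup>2)
        \<le> norm (2 * (cmod (f x))\<^sup>2 + 2 * (cmod (g x))\<^sup>2)" by simp
    qed
  qed measurable
  then show ?thesis by (simp add: square_integrable_def)
qed

lemma square_integrable_scale:
  assumes "square_integrable f"
  shows "square_integrable (\<lambda>x. c * f x)"
  using assms by (auto simp: square_integrable_def norm_mult power_mult_distrib)

lemma borel_measurable_cnj [measurable (raw)]:
  "f \<in> borel_measurable M \<Longrightarrow> (\<lambda>x. cnj (f x)) \<in> borel_measurable M"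
  by (rule borel_measurable_continuous_on[OF continuous_on_cnj[OF continuous_on_id]])

lemma square_integrable_inner:
  assumes "square_integrable f" "square_integrable g"
  shows "integrable lborel (\<lambda>x. f x * cnj (g x))"
proof -
  have [measurable]: "f \<in> borel_measurable lborel" "g \<in> borel_measurable lborel"
    using assms by (auto simp: square_integrable_def)
  have "integrable lborel (\<lambda>x. (cmod (f x))\<^sup>2 + (cmod (g x))\<^sup>2)"
    using assms by (auto simp: square_integrable_def)
  then show ?thesis
  proof (rule Bochner_Integration.integrable_bound)
    show "AE x in lborel. norm (f x * cnj (g x))
        \<le> norm ((cmod (f x))\<^sup>2 + (cmod (g x))\<^sup>2)"
    proof (rule AE_I2)
      fix x
      have "0 \<le> cmod (f x) * cmod (g x)" by simp
      then show "norm (f x * cnj (g x)) \<le> norm ((cmod (f x))\<^sup>2 + (cmod (g x))\<^sup>2)"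
        using sum_squares_bound[of "cmod (f x)" "cmod (g x)"]
        by (simp add: norm_mult del: mult_nonneg_nonneg)
    qed
  qed measurable
qed

quotient_type (overloaded) 'a l2 = "'a::euclidean_space \<Rightarrow> complex" / partial: l2_rel
  morphisms rep_l2 l2_of
proof (rule part_equivpI)
  show "\<exists>f :: 'a \<Rightarrow> complex. l2_rel f f"
    by (rule exI[of _ "\<lambda>_. 0"]) (simp add: l2_rel_def square_integrable_def)
  show "symp (l2_rel :: ('a \<Rightarrow> complex) \<Rightarrow> _)"
    by (rule sympI) (auto simp: l2_rel_def)
  show "transp (l2_rel :: ('a \<Rightarrow> complex) \<Rightarrow> _)"
    by (rule transpI) (auto simp: l2_rel_def elim: eventually_elim2)
qed

text \<open>The complex inner product is linear in the first argument.\<close>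

lift_definition l2_inner :: "'a::euclidean_space l2 \<Rightarrow> 'a l2 \<Rightarrow> complex"
  is "\<lambda>f g. \<integral>x. f x * cnj (g x) \<partial>lborel"
  by (rule integral_cong_AE)
     (auto simp: l2_rel_def square_integrable_def intro!: borel_measurable_times borel_measurable_cnj
       elim: eventually_elim2)

instantiation l2 :: (euclidean_space) real_inner
begin

lift_definition zero_l2 :: "'a l2" is "\<lambda>_. 0"
  by (simp add: l2_rel_def square_integrable_def)

lift_definition plus_l2 :: "'a l2 \<Rightarrow> 'a l2 \<Rightarrow> 'a l2" is "\<lambda>f g x. f x + g x"
  by (auto simp: l2_rel_def square_integrable_add)

lift_definition uminus_l2 :: "'a l2 \<Rightarrow> 'a l2" is "\<lambda>f x. - f x"
  by (auto simp: l2_rel_def square_integrable_def)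

lift_definition scaleR_l2 :: "real \<Rightarrow> 'a l2 \<Rightarrow> 'a l2" is "\<lambda>r f x. of_real r * f x"
  by (auto simp: l2_rel_def square_integrable_scale)

definition minus_l2 :: "'a l2 \<Rightarrow> 'a l2 \<Rightarrow> 'a l2" where
  "minus_l2 x y = x + - y"

definition inner_l2 :: "'a l2 \<Rightarrow> 'a l2 \<Rightarrow> real" where
  "inner_l2 x y = Re (l2_inner x y)"

definition norm_l2 :: "'a l2 \<Rightarrow> real" where
  "norm_l2 x = sqrt (inner x x)"

definition sgn_l2 :: "'a l2 \<Rightarrow> 'a l2" where
  "sgn_l2 x = inverse (norm x) *\<^sub>R x"

definition dist_l2 :: "'a l2 \<Rightarrow> 'a l2 \<Rightarrow> real" where
  "dist_l2 x y = norm (x - y)"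

definition uniformity_l2 :: "('a l2 \<times> 'a l2) filter" where
  "uniformity_l2 = (INF e\<in>{0<..}. principal {(x, y). dist x y < e})"

definition open_l2 :: "'a l2 set \<Rightarrow> bool" where
  "open_l2 S = (\<forall>x\<in>S. \<forall>\<^sub>F (x', y) in uniformity. x' = x \<longrightarrow> y \<in> S)"

instance
proof
  fix x y z :: "'a l2" and r s :: real and S :: "'a l2 set"
  show "x + y + z = x + (y + z)"
    by transfer (simp add: l2_rel_def square_integrable_add add.assoc)
  show "x + y = y + x"
    by transfer (simp add: l2_rel_def square_integrable_add add.commute)
  show "0 + x = x"
    by transfer (simp add: l2_rel_def)
  show "- x + x = 0"
    by transfer (simp add: l2_rel_def square_integrable_def)
  show "x - y = x + - y"
    by (rule minus_l2_def)
  show "r *\<^sub>R (x + y) = r *\<^sub>R x + r *\<^sub>R y"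
    by transfer (simp add: l2_rel_def square_integrable_add square_integrable_scale distrib_left)
  show "(r + s) *\<^sub>R x = r *\<^sub>R x + s *\<^sub>R x"
    by transfer
      (use square_integrable_scale[of _ "of_real (r + s)" for r s] in
        \<open>simp add: l2_rel_def square_integrable_add square_integrable_scale distrib_right\<close>)
  show "r *\<^sub>R s *\<^sub>R x = (r * s) *\<^sub>R x"
    by transfer
      (use square_integrable_scale[of _ "of_real (r * s)" for r s] in
        \<open>simp add: l2_rel_def square_integrable_scale mult.assoc\<close>)
  show "1 *\<^sub>R x = x"
    by transfer (simp add: l2_rel_def)
  show "sgn x = inverse (norm x) *\<^sub>R x"
    by (rule sgn_l2_def)
  show "dist x y = norm (x - y)"
    by (rule dist_l2_def)
  show "uniformity = (INF e\<in>{0<..}. principal {(x :: 'a l2, y). dist x y < e})"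
    by (rule uniformity_l2_def)
  show "open S = (\<forall>x\<in>S. \<forall>\<^sub>F (x', y) in uniformity. x' = x \<longrightarrow> y \<in> S)"
    by (rule open_l2_def)
  show "inner x y = inner y x"
    unfolding inner_l2_def
  proof transfer
    fix f g :: "'a \<Rightarrow> complex"
    have "(\<integral>x. g x * cnj (f x) \<partial>lborel) = (\<integral>x. cnj (f x * cnj (g x)) \<partial>lborel)"
      by (simp add: mult.commute)
    also have "\<dots> = cnj (\<integral>x. f x * cnj (g x) \<partial>lborel)"
      by (rule Bochner_Integration.integral_cnj)
    finally show "Re (\<integral>x. f x * cnj (g x) \<partial>lborel) = Re (\<integral>x. g x * cnj (f x) \<partial>lborel)"
      by simp
  qed
  show "inner (x + y) z = inner x z + inner y z"
    unfolding inner_l2_def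
    by transfer (simp add: l2_rel_def distrib_right square_integrable_inner)
  show "inner (r *\<^sub>R x) y = r * inner x y"
    unfolding inner_l2_def
    by transfer (simp add: mult.assoc)
  have sq: "inner x x = (\<integral>t. (cmod (rep_l2 x t))\<^sup>2 \<partial>lborel)" and
       si: "square_integrable (rep_l2 x)"
    if "x = x" for x :: "'a l2"
  proof -
    have r: "l2_rel (rep_l2 x) (rep_l2 x)"
      by (rule Quotient_rep_reflp[OF Quotient_l2])
    then show si: "square_integrable (rep_l2 x)"
      by (simp add: l2_rel_def)
    have "inner x x = Re (\<integral>t. of_real ((cmod (rep_l2 x t))\<^sup>2) \<partial>lborel)"
      unfolding inner_l2_def l2_inner.rep_eq by (simp add: complex_mult_cnj cmod_power2)
    also have "\<dots> = (\<integral>t. (cmod (rep_l2 x t))\<^sup>2 \<partial>lborel)"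
      by (simp only: integral_complex_of_real Re_complex_of_real)
    finally show "inner x x = (\<integral>t. (cmod (rep_l2 x t))\<^sup>2 \<partial>lborel)" .
  qed
  show "0 \<le> inner x x"
    by (simp add: sq)
  have "inner x x = 0 \<longleftrightarrow> (AE t in lborel. rep_l2 x t = 0)"
    using si[of x] by (simp add: sq square_integrable_def integral_nonneg_eq_0_iff_AE)
  also have "\<dots> \<longleftrightarrow> l2_rel (rep_l2 x) (\<lambda>_. 0)"
    using si[of x] by (simp add: l2_rel_def square_integrable_def)
  also have "\<dots> \<longleftrightarrow> x = 0"
    by (metis Quotient_abs_rep[OF Quotient_l2] Quotient_rel_abs[OF Quotient_l2]
        Quotient_rel_abs2[OF Quotient_l2] zero_l2.abs_eq zero_l2.rsp
        Quotient_rep_reflp[OF Quotient_l2] Quotient_rel[OF Quotient_l2])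
  finally show "inner x x = 0 \<longleftrightarrow> x = 0" .
  show "norm x = sqrt (inner x x)"
    by (rule norm_l2_def)
qed

end

instantiation l2 :: (euclidean_space) complex_normed_vector
begin

lift_definition scaleC_l2 :: "complex \<Rightarrow> 'a l2 \<Rightarrow> 'a l2" is "\<lambda>c f x. c * f x"
  by (auto simp: l2_rel_def square_integrable_scale)

instance
proof
  fix x y :: "'a l2" and c d :: complex and r :: real
  show "of_real r *\<^sub>C x = r *\<^sub>R x"
    by transfer (simp add: l2_rel_def square_integrable_scale)
  show "c *\<^sub>C (x + y) = c *\<^sub>C x + c *\<^sub>C y"
    by transfer (simp add: l2_rel_def square_integrable_add square_integrable_scale distrib_left)
  show "(c + d) *\<^sub>C x = c *\<^sub>C x + d *\<^sub>C x"
    by transfer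
      (use square_integrable_scale[of _ "c + d" for c d] in
        \<open>simp add: l2_rel_def square_integrable_add square_integrable_scale distrib_right\<close>)
  show "c *\<^sub>C d *\<^sub>C x = (c * d) *\<^sub>C x"
    by transfer
      (use square_integrable_scale[of _ "c * d" for c d] in
        \<open>simp add: l2_rel_def square_integrable_scale mult.assoc\<close>)
  have "inner (c *\<^sub>C x) (c *\<^sub>C x) = (cmod c)\<^sup>2 * inner x x"
    unfolding inner_l2_def
  proof transfer
    fix c :: complex and f :: "'a \<Rightarrow> complex"
    have "(\<integral>x. c * f x * cnj (c * f x) \<partial>lborel)
        = (\<integral>x. of_real ((cmod c)\<^sup>2) * (f x * cnj (f x)) \<partial>lborel)"
      by (rule Bochner_Integration.integral_cong)
         (auto simp: complex_norm_square algebra_simps simp del: of_real_power)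
    then show "Re (\<integral>x. c * f x * cnj (c * f x) \<partial>lborel)
        = (cmod c)\<^sup>2 * Re (\<integral>x. f x * cnj (f x) \<partial>lborel)"
      by (simp del: of_real_power)
  qed
  then show "norm (c *\<^sub>C x) = cmod c * norm x"
    by (simp add: norm_l2_def real_sqrt_mult)
qed

end

definition fourier :: "('a::euclidean_space \<Rightarrow> complex) \<Rightarrow> 'a \<Rightarrow> complex" where
  "fourier f \<xi> = (\<integral>x. f x * cis (- 2 * pi * (x \<bullet> \<xi>)) \<partial>lborel)"

definition convolution ::
    "('a::euclidean_space \<Rightarrow> complex) \<Rightarrow> ('a \<Rightarrow> complex) \<Rightarrow> 'a \<Rightarrow> complex" where
  "convolution f g x = (\<integral>y. f y * g (x - y) \<partial>lborel)"

definition l1_involution :: "('a::euclidean_space \<Rightarrow> complex) \<Rightarrow> 'a \<Rightarrow> complex" where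
  "l1_involution f x = cnj (f (- x))"

lemma integrable_fourier_kernel:
  fixes f :: "'a::euclidean_space \<Rightarrow> complex"
  assumes f: "integrable lborel f"
  shows "integrable lborel (\<lambda>x. f x * cis (- 2 * pi * (x \<bullet> \<xi>)))"
proof (rule Bochner_Integration.integrable_bound[OF f])
  have [measurable]: "f \<in> borel_measurable lborel"
    using f by simp
  have "(\<lambda>x. cis (- 2 * pi * (x \<bullet> \<xi>))) \<in> borel_measurable borel"
    by (intro borel_measurable_continuous_onI continuous_intros)
  then show "(\<lambda>x. f x * cis (- 2 * pi * (x \<bullet> \<xi>))) \<in> borel_measurable lborel"
    by simp
qed (simp add: norm_mult)

lemma norm_fourier_le:
  assumes "integrable lborel f"
  shows "cmod (fourier f \<xi>) \<le> (\<integral>x. cmod (f x) \<partial>lborel)"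
proof -
  have "cmod (fourier f \<xi>) \<le> (\<integral>x. norm (f x * cis (- 2 * pi * (x \<bullet> \<xi>))) \<partial>lborel)"
    unfolding fourier_def by (rule integral_norm_bound)
  then show ?thesis by (simp add: norm_mult)
qed

lemma fourier_add:
  assumes "integrable lborel f" "integrable lborel g"
  shows "fourier (\<lambda>x. f x + g x) \<xi> = fourier f \<xi> + fourier g \<xi>"
  using integrable_fourier_kernel[OF assms(1), of \<xi>] integrable_fourier_kernel[OF assms(2), of \<xi>]
  by (simp add: fourier_def distrib_right)

lemma fourier_diff:
  assumes "integrable lborel f" "integrable lborel g"
  shows "fourier (\<lambda>x. f x - g x) \<xi> = fourier f \<xi> - fourier g \<xi>"
  using integrable_fourier_kernel[OF assms(1), of \<xi>] integrable_fourier_kernel[OF assms(2), of \<xi>]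
  by (simp add: fourier_def left_diff_distrib)

lemma fourier_scale: "fourier (\<lambda>x. c * f x) \<xi> = c * fourier f \<xi>"
  by (simp add: fourier_def mult.assoc)

lemma lborel_distr_reflect:
  "distr lborel borel uminus = (lborel :: 'a::euclidean_space measure)"
proof -
  have "(lborel :: 'a measure) = density (distr lborel borel (\<lambda>x. 0 + (- 1) *\<^sub>R x)) (\<lambda>_. \<bar>- 1 :: real\<bar> ^ DIM('a))"
    by (rule lborel_affine) simp
  then show ?thesis by (simp add: density_1)
qed

lemma integrable_l1_involution:
  fixes f :: "'a::euclidean_space \<Rightarrow> complex"
  assumes f: "integrable lborel f"
  shows "integrable lborel (l1_involution f)"
proof -
  have "integrable (distr lborel borel uminus) f"
    using f by (simp add: lborel_distr_reflect)
  then have "integrable lborel (\<lambda>x. f (- x))"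
    by (rule integrable_distr[rotated]) simp
  then show ?thesis
    by (simp add: l1_involution_def[abs_def])
qed

lemma fourier_l1_involution:
  fixes f :: "'a::euclidean_space \<Rightarrow> complex"
  assumes f: "integrable lborel f"
  shows "fourier (l1_involution f) \<xi> = cnj (fourier f \<xi>)"
proof -
  have "cnj (fourier f \<xi>) = (\<integral>x. cnj (f x * cis (- 2 * pi * (x \<bullet> \<xi>))) \<partial>lborel)"
    unfolding fourier_def by (rule Bochner_Integration.integral_cnj[symmetric])
  also have "\<dots> = (\<integral>x. cnj (f x * cis (- 2 * pi * (x \<bullet> \<xi>))) \<partial>distr lborel borel uminus)"
    by (simp add: lborel_distr_reflect)
  also have "\<dots> = (\<integral>x. cnj (f (- x) * cis (- 2 * pi * ((- x) \<bullet> \<xi>))) \<partial>lborel)"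
    using borel_measurable_integrable[OF integrable_fourier_kernel[OF f, of \<xi>]]
    by (intro integral_distr borel_measurable_cnj) simp_all
  also have "\<dots> = fourier (l1_involution f) \<xi>"
    by (simp add: fourier_def l1_involution_def cis_cnj)
  finally show ?thesis by simp
qed

lemma integrable_convolution_kernel:
  fixes f g :: "'a::euclidean_space \<Rightarrow> complex"
  assumes f: "integrable lborel f" and g: "integrable lborel g"
  shows "integrable (lborel \<Otimes>\<^sub>M lborel) (\<lambda>(y, x). f y * g (x - y))"
proof -
  have [measurable]: "f \<in> borel_measurable borel" "g \<in> borel_measurable borel"
    using f g by auto
  have shift: "integrable lborel (\<lambda>x. g (x - y))"
    and shift_norm: "(\<integral>x. cmod (g (x - y)) \<partial>lborel) = (\<integral>x. cmod (g x) \<partial>lborel)" for y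
  proof -
    have "integrable (distr lborel borel ((+) (- y))) g"
      using g by (simp only: lborel_distr_plus)
    then have "integrable lborel (\<lambda>x. g (- y + x))"
      by (rule integrable_distr[rotated]) simp
    then show "integrable lborel (\<lambda>x. g (x - y))" by simp
    have "(\<integral>x. cmod (g x) \<partial>lborel) = (\<integral>x. cmod (g x) \<partial>distr lborel borel ((+) (- y)))"
      by (simp only: lborel_distr_plus)
    also have "\<dots> = (\<integral>x. cmod (g (- y + x)) \<partial>lborel)"
      by (rule integral_distr) simp_all
    finally show "(\<integral>x. cmod (g (x - y)) \<partial>lborel) = (\<integral>x. cmod (g x) \<partial>lborel)" by simp
  qed
  show ?thesis
  proof (rule lborel_pair.Fubini_integrable)
    show "(\<lambda>(y, x). f y * g (x - y)) \<in> borel_measurable (lborel \<Otimes>\<^sub>M lborel)"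
      by measurable
    show "integrable lborel (\<lambda>y. \<integral>x. norm (case (y, x) of (y, x) \<Rightarrow> f y * g (x - y)) \<partial>lborel)"
      using f by (simp add: norm_mult shift_norm)
    show "AE y in lborel. integrable lborel (\<lambda>x. case (y, x) of (y, x) \<Rightarrow> f y * g (x - y))"
      using shift by simp
  qed
qed

lemma integrable_convolution:
  fixes f g :: "'a::euclidean_space \<Rightarrow> complex"
  assumes "integrable lborel f" "integrable lborel g"
  shows "integrable lborel (convolution f g)"
  using lborel_pair.integrable_snd[OF integrable_convolution_kernel[OF assms]]
  by (simp add: convolution_def[abs_def])

lemma fourier_convolution:
  fixes f g :: "'a::euclidean_space \<Rightarrow> complex"
  assumes f: "integrable lborel f" and g: "integrable lborel g"
  shows "fourier (convolution f g) \<xi> = fourier f \<xi> * fourier g \<xi>"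
proof -
  let ?e = "\<lambda>x. cis (- 2 * pi * (x \<bullet> \<xi>))"
  let ?f = "\<lambda>x. f x * ?e x" and ?g = "\<lambda>x. g x * ?e x"
  have fi: "integrable lborel ?f" and gi: "integrable lborel ?g"
    by (rule integrable_fourier_kernel[OF f] integrable_fourier_kernel[OF g])+
  have [measurable]: "?g \<in> borel_measurable borel"
    using gi by auto
  have e: "?e y * ?e (x - y) = ?e x" for x y
    by (simp add: cis_mult inner_diff_left algebra_simps)
  have "fourier (convolution f g) \<xi> = (\<integral>x. (\<integral>y. f y * g (x - y) * ?e x \<partial>lborel) \<partial>lborel)"
    by (simp only: fourier_def convolution_def integral_mult_left_zero)
  also have "\<dots> = (\<integral>x. (\<integral>y. ?f y * ?g (x - y) \<partial>lborel) \<partial>lborel)"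
  proof -
    have "f y * g (x - y) * ?e x = ?f y * ?g (x - y)" for x y
      unfolding e[of y x, symmetric] by (simp only: ac_simps)
    then show ?thesis by (simp only:)
  qed
  also have "\<dots> = (\<integral>y. (\<integral>x. ?f y * ?g (x - y) \<partial>lborel) \<partial>lborel)"
    using lborel_pair.Fubini_integral[OF integrable_convolution_kernel[OF fi gi]] by simp
  also have "\<dots> = (\<integral>y. ?f y * (\<integral>x. ?g (x - y) \<partial>lborel) \<partial>lborel)"
    by simp
  also have "\<dots> = (\<integral>y. ?f y * fourier g \<xi> \<partial>lborel)"
  proof -
    have "(\<integral>x. ?g (x - y) \<partial>lborel) = fourier g \<xi>" for y
    proof -
      have "fourier g \<xi> = (\<integral>x. ?g x \<partial>distr lborel borel ((+) (- y)))"
        by (simp only: lborel_distr_plus fourier_def)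
      also have "\<dots> = (\<integral>x. ?g (- y + x) \<partial>lborel)"
        using borel_measurable_integrable[OF gi] by (intro integral_distr) simp_all
      finally show ?thesis by simp
    qed
    then show ?thesis by simp
  qed
  also have "\<dots> = fourier f \<xi> * fourier g \<xi>"
    by (simp add: fourier_def)
  finally show ?thesis .
qed


text \<open>
  The group $C^*$-algebra of the vector group \<^typ>\<open>'a\<close>: the completion of $L^1$, with convolution
  and involution, for the $C^*$-norm. The group being abelian, that norm is the sup norm of the
  Fourier transform. Elements are classes of Cauchy sequences of integrable functions.
\<close>

definition cstar_seminorm :: "('a::euclidean_space \<Rightarrow> complex) \<Rightarrow> real" where
  "cstar_seminorm f = (SUP \<xi>. cmod (fourier f \<xi>))"

definition cstar_cauchy :: "(nat \<Rightarrow> 'a::euclidean_space \<Rightarrow> complex) \<Rightarrow> bool" where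
  "cstar_cauchy X \<longleftrightarrow> (\<forall>k. integrable lborel (X k)) \<and>
    (\<forall>e>0. \<exists>M. \<forall>m\<ge>M. \<forall>n\<ge>M. cstar_seminorm (\<lambda>x. X m x - X n x) < e)"

definition cstar_rel ::
    "(nat \<Rightarrow> 'a::euclidean_space \<Rightarrow> complex) \<Rightarrow> (nat \<Rightarrow> 'a \<Rightarrow> complex) \<Rightarrow> bool" where
  "cstar_rel X Y \<longleftrightarrow> cstar_cauchy X \<and> cstar_cauchy Y \<and>
    (\<lambda>k. cstar_seminorm (\<lambda>x. X k x - Y k x)) \<longlonglongrightarrow> 0"

definition fourier_lim :: "(nat \<Rightarrow> 'a::euclidean_space \<Rightarrow> complex) \<Rightarrow> 'a \<Rightarrow> complex" where
  "fourier_lim X \<xi> = lim (\<lambda>k. fourier (X k) \<xi>)"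

lemma bdd_above_fourier:
  "integrable lborel f \<Longrightarrow> bdd_above (range (\<lambda>\<xi>. cmod (fourier f \<xi>)))"
  using norm_fourier_le by (fast intro: bdd_aboveI)

lemma norm_fourier_le_seminorm:
  "integrable lborel f \<Longrightarrow> cmod (fourier f \<xi>) \<le> cstar_seminorm f"
  unfolding cstar_seminorm_def by (rule cSUP_upper) (auto intro: bdd_above_fourier)

lemma seminorm_le: "(\<And>\<xi>. cmod (fourier f \<xi>) \<le> B) \<Longrightarrow> cstar_seminorm f \<le> B"
  unfolding cstar_seminorm_def by (rule cSUP_least) auto

lemma dist_fourier_le:
  assumes "integrable lborel f" "integrable lborel g"
  shows "dist (fourier f \<xi>) (fourier g \<xi>) \<le> cstar_seminorm (\<lambda>x. f x - g x)"
  using norm_fourier_le_seminorm[of "\<lambda>x. f x - g x" \<xi>] assms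
  by (simp add: dist_norm fourier_diff)

lemma seminorm_diff_le:
  assumes "integrable lborel f" "integrable lborel g"
    and "\<And>\<xi>. dist (fourier f \<xi>) (fourier g \<xi>) \<le> B"
  shows "cstar_seminorm (\<lambda>x. f x - g x) \<le> B"
  by (rule seminorm_le) (use assms in \<open>simp add: dist_norm fourier_diff\<close>)

lemma cstar_cauchy_iff:
  "cstar_cauchy X \<longleftrightarrow> (\<forall>k. integrable lborel (X k)) \<and>
    uniformly_Cauchy_on UNIV (\<lambda>k. fourier (X k))"
proof (cases "\<forall>k. integrable lborel (X k)")
  case True
  have "(\<forall>e>0. \<exists>M. \<forall>m\<ge>M. \<forall>n\<ge>M. cstar_seminorm (\<lambda>x. X m x - X n x) < e) \<longleftrightarrow>
    (\<forall>e>0. \<exists>M. \<forall>\<xi>. \<forall>m\<ge>M. \<forall>n\<ge>M. dist (fourier (X m) \<xi>) (fourier (X n) \<xi>) < e)"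
    (is "?L \<longleftrightarrow> ?R")
  proof
    assume ?L
    show ?R
    proof (intro allI impI)
      fix e :: real assume "e > 0"
      then obtain M where M: "\<forall>m\<ge>M. \<forall>n\<ge>M. cstar_seminorm (\<lambda>x. X m x - X n x) < e"
        using \<open>?L\<close> by blast
      have "dist (fourier (X m) \<xi>) (fourier (X n) \<xi>) < e" if "m \<ge> M" "n \<ge> M" for m n \<xi>
      proof -
        have "dist (fourier (X m) \<xi>) (fourier (X n) \<xi>) \<le> cstar_seminorm (\<lambda>x. X m x - X n x)"
          by (rule dist_fourier_le) (simp_all add: True)
        also have "\<dots> < e"
          using M that by simp
        finally show ?thesis .
      qed
      then show "\<exists>M. \<forall>\<xi>. \<forall>m\<ge>M. \<forall>n\<ge>M. dist (fourier (X m) \<xi>) (fourier (X n) \<xi>) < e"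
        by blast
    qed
  next
    assume R: ?R
    show ?L
    proof (intro allI impI)
      fix e :: real assume "e > 0"
      then have "e / 2 > 0" by simp
      then obtain M where M: "\<forall>\<xi>. \<forall>m\<ge>M. \<forall>n\<ge>M. dist (fourier (X m) \<xi>) (fourier (X n) \<xi>) < e / 2"
        using R by blast
      have "cstar_seminorm (\<lambda>x. X m x - X n x) < e" if "m \<ge> M" "n \<ge> M" for m n
      proof -
        have "cstar_seminorm (\<lambda>x. X m x - X n x) \<le> e / 2"
          by (rule seminorm_diff_le) (use True M that in \<open>auto intro: less_imp_le\<close>)
        then show ?thesis using \<open>e > 0\<close> by simp
      qed
      then show "\<exists>M. \<forall>m\<ge>M. \<forall>n\<ge>M. cstar_seminorm (\<lambda>x. X m x - X n x) < e" by blast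
    qed
  qed
  with True show ?thesis by (simp add: cstar_cauchy_def uniformly_Cauchy_on_def)
qed (auto simp: cstar_cauchy_def)

lemma cstar_cauchy_integrable: "cstar_cauchy X \<Longrightarrow> integrable lborel (X k)"
  by (simp add: cstar_cauchy_def)

lemma uniform_limit_fourier_lim:
  "cstar_cauchy X \<Longrightarrow> uniform_limit UNIV (\<lambda>k. fourier (X k)) (fourier_lim X) sequentially"
  unfolding fourier_lim_def[abs_def]
  by (simp add: cstar_cauchy_iff Cauchy_uniformly_convergent
      uniformly_convergent_uniform_limit_iff[symmetric])

lemma cstar_cauchyI:
  assumes "\<And>k. integrable lborel (X k)"
    and lim: "uniform_limit UNIV (\<lambda>k. fourier (X k)) G sequentially"
  shows "cstar_cauchy X" "fourier_lim X = G"
proof -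
  have "uniformly_convergent_on UNIV (\<lambda>k. fourier (X k))"
    using lim by (auto simp: uniformly_convergent_on_def)
  then show "cstar_cauchy X"
    using assms(1) by (simp add: cstar_cauchy_iff uniformly_convergent_Cauchy)
  show "fourier_lim X = G"
    unfolding fourier_lim_def using tendsto_uniform_limitI[OF lim] by (auto intro!: limI)
qed

lemma bounded_fourier_lim:
  assumes "cstar_cauchy X"
  shows "bounded (range (fourier_lim X))"
proof (rule uniform_limit_bounded[OF uniform_limit_fourier_lim[OF assms]])
  show "\<forall>\<^sub>F k in sequentially. bounded (range (fourier (X k)))"
    using norm_fourier_le[OF cstar_cauchy_integrable[OF assms]]
    by (intro always_eventually allI) (fast intro: boundedI)
qed simp

lemma cstar_rel_iff:
  "cstar_rel X Y \<longleftrightarrow> cstar_cauchy X \<and> cstar_cauchy Y \<and> fourier_lim X = fourier_lim Y"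
proof (cases "cstar_cauchy X \<and> cstar_cauchy Y")
  case True
  then have X: "uniform_limit UNIV (\<lambda>k. fourier (X k)) (fourier_lim X) sequentially"
    and Y: "uniform_limit UNIV (\<lambda>k. fourier (Y k)) (fourier_lim Y) sequentially"
    and int: "\<And>k. integrable lborel (X k)" "\<And>k. integrable lborel (Y k)"
    by (simp_all add: uniform_limit_fourier_lim cstar_cauchy_integrable)
  have "(\<lambda>k. cstar_seminorm (\<lambda>x. X k x - Y k x)) \<longlonglongrightarrow> 0 \<longleftrightarrow> fourier_lim X = fourier_lim Y"
  proof
    assume lim: "(\<lambda>k. cstar_seminorm (\<lambda>x. X k x - Y k x)) \<longlonglongrightarrow> 0"
    show "fourier_lim X = fourier_lim Y"
    proof
      fix \<xi>
      have "(\<lambda>k. fourier (X k) \<xi> - fourier (Y k) \<xi>) \<longlonglongrightarrow> 0"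
        by (rule Lim_null_comparison[OF _ lim])
           (use dist_fourier_le[OF int] in \<open>simp add: dist_norm\<close>)
      moreover have "(\<lambda>k. fourier (X k) \<xi> - fourier (Y k) \<xi>) \<longlonglongrightarrow> fourier_lim X \<xi> - fourier_lim Y \<xi>"
        by (intro tendsto_diff tendsto_uniform_limitI[OF X] tendsto_uniform_limitI[OF Y]) auto
      ultimately show "fourier_lim X \<xi> = fourier_lim Y \<xi>"
        using LIMSEQ_unique by fastforce
    qed
  next
    assume eq: "fourier_lim X = fourier_lim Y"
    show "(\<lambda>k. cstar_seminorm (\<lambda>x. X k x - Y k x)) \<longlonglongrightarrow> 0"
    proof (rule tendstoI)
      fix e :: real assume "e > 0"
      then have e: "e / 4 > 0" by simp
      show "\<forall>\<^sub>F k in sequentially. dist (cstar_seminorm (\<lambda>x. X k x - Y k x)) 0 < e"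
        using uniform_limitD[OF X e] uniform_limitD[OF Y e]
      proof eventually_elim
        case (elim k)
        have le: "cstar_seminorm (\<lambda>x. X k x - Y k x) \<le> e / 2"
        proof (rule seminorm_diff_le[OF int])
          fix \<xi>
          have "dist (fourier (X k) \<xi>) (fourier (Y k) \<xi>)
              \<le> dist (fourier (X k) \<xi>) (fourier_lim X \<xi>) + dist (fourier (Y k) \<xi>) (fourier_lim X \<xi>)"
            by (rule dist_triangle2)
          also have "\<dots> \<le> e / 4 + e / 4"
            using elim eq by (intro add_mono less_imp_le) auto
          finally show "dist (fourier (X k) \<xi>) (fourier (Y k) \<xi>) \<le> e / 2" by simp
        qed
        have "0 \<le> cstar_seminorm (\<lambda>x. X k x - Y k x)"
          using dist_fourier_le[OF int, of k 0 k] by (rule order_trans[OF zero_le_dist])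
        with le \<open>e > 0\<close> show ?case by simp
      qed
    qed
  qed
  with True show ?thesis by (simp add: cstar_rel_def)
qed (auto simp: cstar_rel_def)

lemma cstar_const:
  assumes "integrable lborel f"
  shows "cstar_cauchy (\<lambda>_. f)" "fourier_lim (\<lambda>_. f) = fourier f"
proof -
  have "uniform_limit UNIV (\<lambda>_::nat. fourier f) (fourier f) sequentially"
    by (rule uniform_limit_const)
  then show "cstar_cauchy (\<lambda>_. f)" "fourier_lim (\<lambda>_. f) = fourier f"
    using cstar_cauchyI[of "\<lambda>_. f"] assms by auto
qed

lemma cstar_add:
  assumes "cstar_cauchy X" "cstar_cauchy Y"
  shows "cstar_cauchy (\<lambda>k x. X k x + Y k x)"
    "fourier_lim (\<lambda>k x. X k x + Y k x) = (\<lambda>\<xi>. fourier_lim X \<xi> + fourier_lim Y \<xi>)"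
proof -
  note int = cstar_cauchy_integrable[OF assms(1)] cstar_cauchy_integrable[OF assms(2)]
  have "uniform_limit UNIV (\<lambda>k \<xi>. fourier (X k) \<xi> + fourier (Y k) \<xi>)
      (\<lambda>\<xi>. fourier_lim X \<xi> + fourier_lim Y \<xi>) sequentially"
    by (intro uniform_limit_add uniform_limit_fourier_lim assms)
  then have lim: "uniform_limit UNIV (\<lambda>k. fourier (\<lambda>x. X k x + Y k x))
      (\<lambda>\<xi>. fourier_lim X \<xi> + fourier_lim Y \<xi>) sequentially"
    by (simp add: fourier_add[OF int, abs_def])
  show "cstar_cauchy (\<lambda>k x. X k x + Y k x)"
    "fourier_lim (\<lambda>k x. X k x + Y k x) = (\<lambda>\<xi>. fourier_lim X \<xi> + fourier_lim Y \<xi>)"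
    using int by (auto intro!: cstar_cauchyI[OF _ lim])
qed

lemma cstar_scale:
  assumes "cstar_cauchy X"
  shows "cstar_cauchy (\<lambda>k x. c * X k x)"
    "fourier_lim (\<lambda>k x. c * X k x) = (\<lambda>\<xi>. c * fourier_lim X \<xi>)"
proof -
  have "uniform_limit UNIV (\<lambda>k \<xi>. c * fourier (X k) \<xi>) (\<lambda>\<xi>. c * fourier_lim X \<xi>) sequentially"
    by (intro bounded_linear.uniform_limit[OF bounded_linear_mult_right]
        uniform_limit_fourier_lim assms)
  then have lim: "uniform_limit UNIV (\<lambda>k. fourier (\<lambda>x. c * X k x))
      (\<lambda>\<xi>. c * fourier_lim X \<xi>) sequentially"
    by (simp add: fourier_scale[abs_def])
  show "cstar_cauchy (\<lambda>k x. c * X k x)"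
    "fourier_lim (\<lambda>k x. c * X k x) = (\<lambda>\<xi>. c * fourier_lim X \<xi>)"
    using cstar_cauchy_integrable[OF assms] by (auto intro!: cstar_cauchyI[OF _ lim])
qed

lemma cstar_mult:
  assumes "cstar_cauchy X" "cstar_cauchy Y"
  shows "cstar_cauchy (\<lambda>k. convolution (X k) (Y k))"
    "fourier_lim (\<lambda>k. convolution (X k) (Y k)) = (\<lambda>\<xi>. fourier_lim X \<xi> * fourier_lim Y \<xi>)"
proof -
  note int = cstar_cauchy_integrable[OF assms(1)] cstar_cauchy_integrable[OF assms(2)]
  have "uniform_limit UNIV (\<lambda>k \<xi>. fourier (X k) \<xi> * fourier (Y k) \<xi>)
      (\<lambda>\<xi>. fourier_lim X \<xi> * fourier_lim Y \<xi>) sequentially"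
    by (intro uniform_lim_mult uniform_limit_fourier_lim bounded_fourier_lim assms)
  then have lim: "uniform_limit UNIV (\<lambda>k. fourier (convolution (X k) (Y k)))
      (\<lambda>\<xi>. fourier_lim X \<xi> * fourier_lim Y \<xi>) sequentially"
    by (simp add: fourier_convolution[OF int, abs_def])
  show "cstar_cauchy (\<lambda>k. convolution (X k) (Y k))"
    "fourier_lim (\<lambda>k. convolution (X k) (Y k)) = (\<lambda>\<xi>. fourier_lim X \<xi> * fourier_lim Y \<xi>)"
    using int by (auto intro!: cstar_cauchyI[OF _ lim] integrable_convolution)
qed

lemma cstar_involution:
  assumes "cstar_cauchy X"
  shows "cstar_cauchy (\<lambda>k. l1_involution (X k))"
    "fourier_lim (\<lambda>k. l1_involution (X k)) = (\<lambda>\<xi>. cnj (fourier_lim X \<xi>))"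
proof -
  note int = cstar_cauchy_integrable[OF assms]
  have "uniform_limit UNIV (\<lambda>k \<xi>. cnj (fourier (X k) \<xi>)) (\<lambda>\<xi>. cnj (fourier_lim X \<xi>)) sequentially"
    by (intro bounded_linear.uniform_limit[OF bounded_linear_cnj] uniform_limit_fourier_lim assms)
  then have lim: "uniform_limit UNIV (\<lambda>k. fourier (l1_involution (X k)))
      (\<lambda>\<xi>. cnj (fourier_lim X \<xi>)) sequentially"
    by (simp add: fourier_l1_involution[OF int, abs_def])
  show "cstar_cauchy (\<lambda>k. l1_involution (X k))"
    "fourier_lim (\<lambda>k. l1_involution (X k)) = (\<lambda>\<xi>. cnj (fourier_lim X \<xi>))"
    using int by (auto intro!: cstar_cauchyI[OF _ lim] integrable_l1_involution)
qed

lemma bdd_above_norm_range: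
  "bounded (range f) \<Longrightarrow> bdd_above (range (\<lambda>\<xi>. norm (f \<xi>)))"
  using bdd_above_norm[of "range f"] by (simp add: image_image)

lemma seminorm_tendsto:
  assumes X: "cstar_cauchy X"
  shows "(\<lambda>k. cstar_seminorm (X k)) \<longlonglongrightarrow> (SUP \<xi>. cmod (fourier_lim X \<xi>))"
proof (rule tendstoI)
  let ?S = "SUP \<xi>. cmod (fourier_lim X \<xi>)"
  have up: "cmod (fourier_lim X \<xi>) \<le> ?S" for \<xi>
    by (rule cSUP_upper[OF _ bdd_above_norm_range[OF bounded_fourier_lim[OF X]]]) simp
  fix e :: real assume e: "e > 0"
  then have "e / 2 > 0" by simp
  show "\<forall>\<^sub>F k in sequentially. dist (cstar_seminorm (X k)) ?S < e"
    using uniform_limitD[OF uniform_limit_fourier_lim[OF X] \<open>e / 2 > 0\<close>]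
  proof eventually_elim
    case (elim k)
    then have d: "cmod (fourier (X k) \<xi> - fourier_lim X \<xi>) \<le> e / 2" for \<xi>
      by (auto simp: dist_norm intro: less_imp_le)
    have "cstar_seminorm (X k) \<le> ?S + e / 2"
    proof (rule seminorm_le)
      fix \<xi>
      show "cmod (fourier (X k) \<xi>) \<le> ?S + e / 2"
        using d[of \<xi>] up[of \<xi>] norm_triangle_sub[of "fourier (X k) \<xi>" "fourier_lim X \<xi>"] by linarith
    qed
    moreover have "?S \<le> cstar_seminorm (X k) + e / 2"
    proof (rule cSUP_least)
      fix \<xi>
      show "cmod (fourier_lim X \<xi>) \<le> cstar_seminorm (X k) + e / 2"
        using d[of \<xi>] norm_fourier_le_seminorm[OF cstar_cauchy_integrable[OF X], of k \<xi>]
          norm_triangle_sub[of "fourier_lim X \<xi>" "fourier (X k) \<xi>"]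
        by (simp add: norm_minus_commute)
    qed simp
    ultimately show ?case using e by (simp add: dist_real_def abs_if)
  qed
qed

quotient_type (overloaded) 'a group_cstar = "nat \<Rightarrow> 'a::euclidean_space \<Rightarrow> complex" / partial: cstar_rel
  morphisms rep_group_cstar cstar_of_seq
proof (rule part_equivpI)
  show "\<exists>X :: nat \<Rightarrow> 'a \<Rightarrow> complex. cstar_rel X X"
    using cstar_const[of "\<lambda>_. 0"] by (intro exI[of _ "\<lambda>_ _. 0"]) (simp add: cstar_rel_iff)
qed (auto simp: cstar_rel_iff intro!: sympI transpI)

definition cstar_of_l1 :: "('a::euclidean_space \<Rightarrow> complex) \<Rightarrow> 'a group_cstar" where
  "cstar_of_l1 f = cstar_of_seq (\<lambda>_. f)"

lift_definition gelfand :: "'a::euclidean_space group_cstar \<Rightarrow> 'a \<Rightarrow> complex"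
  is fourier_lim
  by (simp add: cstar_rel_iff)

lift_definition involution :: "'a::euclidean_space group_cstar \<Rightarrow> 'a group_cstar"
  is "\<lambda>X k. l1_involution (X k)"
  by (simp add: cstar_rel_iff cstar_involution)

lemma gelfand_inject: "gelfand x = gelfand y \<longleftrightarrow> x = y"
  by transfer (simp add: cstar_rel_iff)

lemma bounded_gelfand: "bounded (range (gelfand x))"
  by transfer (simp add: cstar_rel_iff bounded_fourier_lim)

lemma gelfand_cstar_of_l1: "integrable lborel f \<Longrightarrow> gelfand (cstar_of_l1 f) = fourier f"
  unfolding cstar_of_l1_def
  by (simp add: gelfand.abs_eq cstar_rel_iff cstar_const fun_eq_iff)

lemma bdd_above_gelfand: "bdd_above (range (\<lambda>\<xi>. cmod (gelfand x \<xi>)))"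
  by (rule bdd_above_norm_range[OF bounded_gelfand])

lemma SUP_norm_scale:
  assumes "bounded (range f)"
  shows "(SUP \<xi>. cmod (c * f \<xi>)) = cmod c * (SUP \<xi>. cmod (f \<xi>))"
proof -
  have bdd: "bdd_above (range (\<lambda>\<xi>. cmod (f \<xi>)))"
    using assms by (rule bdd_above_norm_range)
  show ?thesis
    using continuous_at_Sup_mono[of "\<lambda>t. cmod c * t" "range (\<lambda>\<xi>. cmod (f \<xi>))"] bdd
    by (simp add: norm_mult image_image monoI mult_left_mono continuous_intros)
qed

instantiation group_cstar :: (euclidean_space) real_normed_algebra
begin

lift_definition zero_group_cstar :: "'a group_cstar" is "\<lambda>_ _. 0"
  by (simp add: cstar_rel_iff cstar_const)

lift_definition plus_group_cstar :: "'a group_cstar \<Rightarrow> 'a group_cstar \<Rightarrow> 'a group_cstar"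
  is "\<lambda>X Y k x. X k x + Y k x"
  by (simp add: cstar_rel_iff cstar_add)

lift_definition times_group_cstar :: "'a group_cstar \<Rightarrow> 'a group_cstar \<Rightarrow> 'a group_cstar"
  is "\<lambda>X Y k. convolution (X k) (Y k)"
  by (simp add: cstar_rel_iff cstar_mult)

lift_definition scaleR_group_cstar :: "real \<Rightarrow> 'a group_cstar \<Rightarrow> 'a group_cstar"
  is "\<lambda>r X k x. of_real r * X k x"
  by (simp add: cstar_rel_iff cstar_scale)

lift_definition norm_group_cstar :: "'a group_cstar \<Rightarrow> real"
  is "\<lambda>X. lim (\<lambda>k. cstar_seminorm (X k))"
  by (auto simp: cstar_rel_iff limI[OF seminorm_tendsto])

definition uminus_group_cstar :: "'a group_cstar \<Rightarrow> 'a group_cstar" where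
  "uminus_group_cstar x = (- 1) *\<^sub>R x"

definition minus_group_cstar :: "'a group_cstar \<Rightarrow> 'a group_cstar \<Rightarrow> 'a group_cstar" where
  "minus_group_cstar x y = x + - y"

definition sgn_group_cstar :: "'a group_cstar \<Rightarrow> 'a group_cstar" where
  "sgn_group_cstar x = inverse (norm x) *\<^sub>R x"

definition dist_group_cstar :: "'a group_cstar \<Rightarrow> 'a group_cstar \<Rightarrow> real" where
  "dist_group_cstar x y = norm (x - y)"

definition uniformity_group_cstar :: "('a group_cstar \<times> 'a group_cstar) filter" where
  "uniformity_group_cstar = (INF e\<in>{0<..}. principal {(x, y). dist x y < e})"

definition open_group_cstar :: "'a group_cstar set \<Rightarrow> bool" where
  "open_group_cstar S = (\<forall>x\<in>S. \<forall>\<^sub>F (x', y) in uniformity. x' = x \<longrightarrow> y \<in> S)"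

lemma gelfand_zero: "gelfand (0 :: 'a group_cstar) = (\<lambda>_. 0)"
  by transfer (use cstar_const[of "\<lambda>_. 0"] in \<open>simp add: fourier_def fun_eq_iff\<close>)

lemma gelfand_add: "gelfand (x + y :: 'a group_cstar) = (\<lambda>\<xi>. gelfand x \<xi> + gelfand y \<xi>)"
  by transfer (simp add: cstar_rel_iff cstar_add)

lemma gelfand_mult: "gelfand (x * y :: 'a group_cstar) = (\<lambda>\<xi>. gelfand x \<xi> * gelfand y \<xi>)"
  by transfer (simp add: cstar_rel_iff cstar_mult)

lemma gelfand_scaleR: "gelfand (r *\<^sub>R x :: 'a group_cstar) = (\<lambda>\<xi>. of_real r * gelfand x \<xi>)"
  by transfer (simp add: cstar_rel_iff cstar_scale)

lemma gelfand_uminus: "gelfand (- x :: 'a group_cstar) = (\<lambda>\<xi>. - gelfand x \<xi>)"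
  by (simp add: uminus_group_cstar_def gelfand_scaleR)

lemma norm_group_cstar: "norm (x :: 'a group_cstar) = (SUP \<xi>. cmod (gelfand x \<xi>))"
  by transfer (simp add: cstar_rel_iff limI[OF seminorm_tendsto])

lemma norm_gelfand_le: "cmod (gelfand x \<xi>) \<le> norm (x :: 'a group_cstar)"
  unfolding norm_group_cstar by (rule cSUP_upper[OF _ bdd_above_gelfand]) simp

instance
proof
  fix x y z :: "'a group_cstar" and r s :: real and S :: "'a group_cstar set"
  note g = gelfand_inject[symmetric] gelfand_zero gelfand_add gelfand_mult gelfand_scaleR
    gelfand_uminus fun_eq_iff algebra_simps
  show "x + y + z = x + (y + z)" by (simp add: g)
  show "x + y = y + x" by (simp add: g)
  show "0 + x = x" by (simp add: g)
  show "- x + x = 0" by (simp add: g)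
  show "x - y = x + - y" by (rule minus_group_cstar_def)
  show "r *\<^sub>R (x + y) = r *\<^sub>R x + r *\<^sub>R y" by (simp add: g)
  show "(r + s) *\<^sub>R x = r *\<^sub>R x + s *\<^sub>R x" by (simp add: g)
  show "r *\<^sub>R s *\<^sub>R x = (r * s) *\<^sub>R x" by (simp add: g)
  show "1 *\<^sub>R x = x" by (simp add: g)
  show "x * y * z = x * (y * z)" by (simp add: g)
  show "(x + y) * z = x * z + y * z" by (simp add: g)
  show "x * (y + z) = x * y + x * z" by (simp add: g)
  show "r *\<^sub>R x * y = r *\<^sub>R (x * y)" by (simp add: g)
  show "x * r *\<^sub>R y = r *\<^sub>R (x * y)" by (simp add: g)
  show "sgn x = inverse (norm x) *\<^sub>R x" by (rule sgn_group_cstar_def)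
  show "dist x y = norm (x - y)" by (rule dist_group_cstar_def)
  show "uniformity = (INF e\<in>{0<..}. principal {(x :: 'a group_cstar, y). dist x y < e})"
    by (rule uniformity_group_cstar_def)
  show "open S = (\<forall>x\<in>S. \<forall>\<^sub>F (x', y) in uniformity. x' = x \<longrightarrow> y \<in> S)"
    by (rule open_group_cstar_def)
  have nonneg: "0 \<le> norm x" for x :: "'a group_cstar"
    using norm_gelfand_le[of x 0] by (rule order_trans[OF norm_ge_zero])
  show "norm x = 0 \<longleftrightarrow> x = 0"
  proof
    assume "norm x = 0"
    then have "gelfand x \<xi> = 0" for \<xi>
      using norm_gelfand_le[of x \<xi>] by simp
    then show "x = 0" by (simp add: gelfand_inject[symmetric] gelfand_zero fun_eq_iff)
  qed (simp add: norm_group_cstar gelfand_zero)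
  show "norm (x + y) \<le> norm x + norm y"
    unfolding norm_group_cstar[of "x + y"] gelfand_add
    by (rule cSUP_least)
       (auto intro!: order_trans[OF norm_triangle_ineq] add_mono norm_gelfand_le)
  show "norm (r *\<^sub>R x) = \<bar>r\<bar> * norm x"
    using SUP_norm_scale[OF bounded_gelfand[of x], of "of_real r"]
    by (simp add: norm_group_cstar gelfand_scaleR)
  show "norm (x * y) \<le> norm x * norm y"
    unfolding norm_group_cstar[of "x * y"] gelfand_mult
    by (rule cSUP_least) (auto simp: norm_mult intro!: mult_mono norm_gelfand_le nonneg)
qed

end

instantiation group_cstar :: (euclidean_space) complex_normed_vector
begin

lift_definition scaleC_group_cstar :: "complex \<Rightarrow> 'a group_cstar \<Rightarrow> 'a group_cstar"
  is "\<lambda>c X k x. c * X k x"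
  by (simp add: cstar_rel_iff cstar_scale)

lemma gelfand_scaleC: "gelfand (c *\<^sub>C x :: 'a group_cstar) = (\<lambda>\<xi>. c * gelfand x \<xi>)"
  by transfer (simp add: cstar_rel_iff cstar_scale)

instance
proof
  fix x y :: "'a group_cstar" and c d :: complex and r :: real
  note g = gelfand_inject[symmetric] gelfand_add gelfand_scaleR gelfand_scaleC
    fun_eq_iff algebra_simps
  show "of_real r *\<^sub>C x = r *\<^sub>R x" by (simp add: g)
  show "c *\<^sub>C (x + y) = c *\<^sub>C x + c *\<^sub>C y" by (simp add: g)
  show "(c + d) *\<^sub>C x = c *\<^sub>C x + d *\<^sub>C x" by (simp add: g)
  show "c *\<^sub>C d *\<^sub>C x = (c * d) *\<^sub>C x" by (simp add: g)
  show "norm (c *\<^sub>C x) = cmod c * norm x"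
    by (simp add: norm_group_cstar gelfand_scaleC SUP_norm_scale[OF bounded_gelfand])
qed

end


primrec iterated_derivative ::
    "'a::euclidean_space list \<Rightarrow> ('a \<Rightarrow> complex) \<Rightarrow> 'a \<Rightarrow> complex" where
  "iterated_derivative [] f = f"
| "iterated_derivative (v # vs) f =
    (\<lambda>x. frechet_derivative (iterated_derivative vs f) (at x) v)"

definition schwartz :: "('a::euclidean_space \<Rightarrow> complex) \<Rightarrow> bool" where
  "schwartz f \<longleftrightarrow> (\<forall>vs. set vs \<subseteq> Basis \<longrightarrow>
    (\<forall>x. iterated_derivative vs f differentiable (at x)) \<and>
    (\<forall>k::nat. bounded (range (\<lambda>x. norm x ^ k *\<^sub>R iterated_derivative vs f x))))"

type_synonym 'n l2_operator = "(real ^ 'n) l2 \<Rightarrow>\<^sub>L (real ^ 'n) l2"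

text \<open>
  \<^typ>\<open>'n l2_operator\<close> consists of the bounded real-linear operators; complex linearity is
  required where it is not automatic.
\<close>

definition compact_operator :: "'n::finite l2_operator \<Rightarrow> bool" where
  "compact_operator T \<longleftrightarrow> complex_linear (blinfun_apply T) \<and>
    compact (closure (blinfun_apply T ` cball 0 1))"

definition l2_adjoint :: "'n::finite l2_operator \<Rightarrow> 'n l2_operator" where
  "l2_adjoint T = (THE S. \<forall>x y. l2_inner (blinfun_apply T x) y = l2_inner x (blinfun_apply S y))"

definition orthogonal_projection :: "(real ^ 'n::finite) l2 set \<Rightarrow> 'n l2_operator" where
  "orthogonal_projection V = (THE P. \<forall>x. blinfun_apply P x \<in> V \<and>
    (\<forall>y\<in>V. l2_inner (x - blinfun_apply P x) y = 0))"

definition coherent_state ::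
    "(real ^ 'n::finite \<Rightarrow> complex) \<Rightarrow> real \<Rightarrow> real ^ 'n \<Rightarrow> real ^ 'n \<Rightarrow> (real ^ 'n) l2" where
  "coherent_state \<eta> lam a b = l2_of (\<lambda>s. of_real (\<bar>lam\<bar> powr (real CARD('n) / 4)) *
    cis (2 * pi * (a \<bullet> s)) * \<eta> ((\<bar>lam\<bar> powr (1 / 2)) *\<^sub>R (s + (1 / lam) *\<^sub>R b)))"

text \<open>
  The operator-valued integral is the gauge integral, since the library's Bochner integral is
  restricted to second countable codomains, which excludes spaces of operators. The integrand is
  continuous in operator norm and dominated by a multiple of \<open>\<bar>fourier h\<bar>\<close>, so both agree.
\<close>

definition nu_schwartz ::
    "(real ^ 'n::finite \<Rightarrow> complex) \<Rightarrow> real \<Rightarrow> ((real ^ 'n) \<times> (real ^ 'n) \<Rightarrow> complex) \<Rightarrow> 'n l2_operator"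
  where
  "nu_schwartz \<eta> lam h = integral UNIV (\<lambda>(a, b). (fourier h (a, b) / of_real (\<bar>lam\<bar> ^ CARD('n))) *\<^sub>C
    orthogonal_projection (range (\<lambda>c. c *\<^sub>C coherent_state \<eta> lam a b)))"

definition nu ::
    "(real ^ 'n::finite \<Rightarrow> complex) \<Rightarrow> real \<Rightarrow> ((real ^ 'n) \<times> (real ^ 'n)) group_cstar \<Rightarrow> 'n l2_operator"
  where
  "nu \<eta> lam = (THE N. continuous_on UNIV N \<and>
    (\<forall>h. schwartz h \<longrightarrow> N (cstar_of_l1 h) = nu_schwartz \<eta> lam h))"

text \<open>
  An operator field stores its value at \<open>0\<close>, which lies in another algebra, separately; the unused
  value \<open>fiber F 0\<close> is fixed to be \<open>0\<close> in the definition of \<open>operator_fields\<close>.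
\<close>

datatype 'n operator_field = Operator_Field
  (fiber: "real \<Rightarrow> 'n::finite l2_operator")
  (zero_fiber: "((real ^ 'n) \<times> (real ^ 'n)) group_cstar")

definition operator_fields :: "'n::finite operator_field set" where
  "operator_fields = {F. fiber F 0 = 0 \<and>
    (\<forall>lam. lam \<noteq> 0 \<longrightarrow> compact_operator (fiber F lam)) \<and>
    continuous_on (- {0}) (fiber F) \<and>
    ((\<lambda>lam. norm (fiber F lam)) \<longlongrightarrow> 0) at_infinity \<and>
    bdd_above ((\<lambda>lam. norm (fiber F lam)) ` (- {0}))}"

definition field_norm :: "'n::finite operator_field \<Rightarrow> real" where
  "field_norm F = max (SUP lam\<in>- {0}. norm (fiber F lam)) (norm (zero_fiber F))"

definition field_add ::
    "'n::finite operator_field \<Rightarrow> 'n operator_field \<Rightarrow> 'n operator_field" where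
  "field_add F G =
    Operator_Field (\<lambda>lam. fiber F lam + fiber G lam) (zero_fiber F + zero_fiber G)"

definition field_scale :: "complex \<Rightarrow> 'n::finite operator_field \<Rightarrow> 'n operator_field" where
  "field_scale c F = Operator_Field (\<lambda>lam. c *\<^sub>C fiber F lam) (c *\<^sub>C zero_fiber F)"

definition nu_field ::
    "(real ^ 'n::finite \<Rightarrow> complex) \<Rightarrow> ((real ^ 'n) \<times> (real ^ 'n)) group_cstar \<Rightarrow> 'n operator_field"
  where
  "nu_field \<eta> h = Operator_Field (\<lambda>lam. if lam = 0 then 0 else nu \<eta> lam h) h"

end

theory Submission
  imports Defs "HOL-Probability.Characteristic_Functions"
begin

text \<open>
  Fix \<open>lam \<noteq> 0\<close> and let \<open>V x\<close> be the function on phase space that sends \<open>u = (a, b)\<close> to the suitably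
  normalised inner product of \<open>x\<close> with the coherent state at \<open>u\<close>. By Plancherel's formula \<open>V\<close> is an isometry
  for a Schwartz window of norm \<open>1\<close>; this is the Moyal identity \<open>norm_voice_l2\<close>. Hence the integral that defines
  the operators is \<open>V\<^sup>* M V\<close>, where \<open>M\<close> is multiplication by the Gelfand transform of \<open>h\<close>. Schwartz
  functions are dense in the group algebra (\<open>schwartz_dense_cstar\<close>), so this formula extends by continuity
  to all \<open>h\<close> (\<open>toeplitz_nu\<close>). It gives linearity, the contraction property and the exact identity
  \<open>\<nu>\<^sub>\<lambda>(h\<^sup>*) = \<nu>\<^sub>\<lambda>(h)\<^sup>*\<close>. Compactness and continuity in \<open>lam\<close> pass from the operators of rank one under
  the integral to the integral and then to norm limits.

  Multiplicativity in the limit rests on the fact that \<open>M V - V T\<close>, where \<open>T = V\<^sup>* M V\<close>, tends to \<open>0\<close> with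
  \<open>lam\<close> (\<open>symbol_intertwining\<close>). When the symbol is a character of phase space, \<open>M V = V' W\<close>
  (\<open>character_voice\<close>): here \<open>W\<close> is a unitary translation, and \<open>V'\<close> is the transform for the window that
  arises from \<open>\<eta>\<close> by a shift and a modulation, both of size proportional to the square root of \<open>\<bar>lam\<bar>\<close>.
  The Moyal identity for the difference of the two windows shows that \<open>V' - V\<close> has the norm of that
  difference, which tends to \<open>0\<close>. So \<open>M V x\<close> is close to the range of \<open>V\<close>, and \<open>V T x\<close> is its orthogonal
  projection there. The Fourier transform of an integrable \<open>h\<close> is an average of characters with weight \<open>h\<close>;
  dominated convergence gives the claim for it, and density extends the consequences to all of the group
  algebra.

  Given this, \<open>\<nu>\<^sub>\<lambda>(h \<cdot> h') - \<nu>\<^sub>\<lambda>(h) \<nu>\<^sub>\<lambda>(h')\<close> is \<open>V\<^sup>* M\<close> for \<open>h\<close> applied to \<open>M V - V T\<close> for \<open>h'\<close>.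
  The translations \<open>W\<close> multiply coherent states by the value of the character, up to the same change of
  window, and this makes coherent states approximate eigenvectors. These in turn bound the norm of
  \<open>\<nu>\<^sub>\<lambda>(h)\<close> from below by every value of the symbol.
\<close>

section \<open>Integration in Euclidean space\<close>

text \<open>
  In coordinates Lebesgue measure is a product of one-dimensional measures, so the integral of a
  product of functions of one coordinate each factors.
\<close>

lemma integrable_lborel_prod:
  fixes f :: "'a::euclidean_space \<Rightarrow> real \<Rightarrow> complex"
  assumes f: "\<And>b. b \<in> Basis \<Longrightarrow> integrable lborel (f b)"
  shows "integrable lborel (\<lambda>x::'a. \<Prod>b\<in>Basis. f b (x \<bullet> b))"
    and "(\<integral>x. (\<Prod>b\<in>Basis. f b (x \<bullet> b)) \<partial>(lborel :: 'a measure)) = (\<Prod>b\<in>Basis. (\<integral>t. f b t \<partial>lborel))"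
proof -
  interpret product_sigma_finite "\<lambda>_::'a. lborel :: real measure" ..
  have [measurable]: "f b \<in> borel_measurable borel" if "b \<in> Basis" for b
    using f[OF that] by auto
  have eq: "(\<Prod>b\<in>Basis. f b ((\<Sum>c\<in>Basis. g c *\<^sub>R c) \<bullet> b)) = (\<Prod>b\<in>Basis. f b (g b))" for g
    by (intro prod.cong refl) simp
  have P: "integrable (\<Pi>\<^sub>M b\<in>Basis. lborel) (\<lambda>g. \<Prod>b\<in>Basis. f b (g b))"
    by (intro product_integrable_prod f) auto
  show "integrable lborel (\<lambda>x::'a. \<Prod>b\<in>Basis. f b (x \<bullet> b))"
    unfolding lborel_eq[where 'a='a]
    by (subst integrable_distr_eq) (use P in \<open>simp_all add: eq\<close>)
  show "(\<integral>x. (\<Prod>b\<in>Basis. f b (x \<bullet> b)) \<partial>(lborel :: 'a measure)) = (\<Prod>b\<in>Basis. (\<integral>t. f b t \<partial>lborel))"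
    unfolding lborel_eq[where 'a='a]
    by (subst integral_distr) (simp_all add: eq product_integral_prod f)
qed

lemma nn_integral_lborel_affine:
  fixes c :: real and t :: "'a::euclidean_space"
  assumes c: "c \<noteq> 0" and [measurable]: "f \<in> borel_measurable borel"
  shows "(\<integral>\<^sup>+x. f x \<partial>lborel) = ennreal (\<bar>c\<bar> ^ DIM('a)) * (\<integral>\<^sup>+x. f (t + c *\<^sub>R x) \<partial>lborel)"
  by (subst lborel_affine[OF c, of t])
     (simp add: nn_integral_density nn_integral_distr nn_integral_cmult)

lemma integral_lborel_affine:
  fixes c :: real and t :: "'a::euclidean_space" and f :: "'a \<Rightarrow> 'b::{banach, second_countable_topology}"
  assumes c: "c \<noteq> 0" and f: "integrable lborel f"
  shows "integrable lborel (\<lambda>x. f (t + c *\<^sub>R x))"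
    and "(\<integral>x. f x \<partial>lborel) = \<bar>c\<bar> ^ DIM('a) *\<^sub>R (\<integral>x. f (t + c *\<^sub>R x) \<partial>lborel)"
proof -
  have [measurable]: "f \<in> borel_measurable borel" using f by auto
  have "(\<integral>\<^sup>+x. norm (f x) \<partial>lborel) < \<infinity>"
    using f by (simp add: integrable_iff_bounded)
  then have "(\<integral>\<^sup>+x. norm (f (t + c *\<^sub>R x)) \<partial>lborel) < \<infinity>"
    using c by (subst (asm) nn_integral_lborel_affine[OF c, of _ t])
      (auto simp: ennreal_mult_less_top)
  then show "integrable lborel (\<lambda>x. f (t + c *\<^sub>R x))"
    by (simp add: integrable_iff_bounded)
  show "(\<integral>x. f x \<partial>lborel) = \<bar>c\<bar> ^ DIM('a) *\<^sub>R (\<integral>x. f (t + c *\<^sub>R x) \<partial>lborel)"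
    by (subst lborel_affine[OF c, of t])
       (simp add: integral_density integral_distr)
qed

lemma integral_lborel_shift:
  fixes t :: "'a::euclidean_space" and f :: "'a \<Rightarrow> 'b::{banach, second_countable_topology}"
  assumes f: "integrable lborel f"
  shows "integrable lborel (\<lambda>x. f (x + t))"
    and "(\<integral>x. f (x + t) \<partial>lborel) = (\<integral>x. f x \<partial>lborel)"
  using integral_lborel_affine[of 1 f t] f by (simp_all add: add.commute)

section \<open>Gaussians and Plancherel's formula\<close>

text \<open>
  The characteristic function of the standard normal distribution after the substitution
  \<open>x \<mapsto> sqrt (2 * pi) * x\<close>. With this normalisation the Gaussian is its own Fourier transform, and no
  constants appear in the inversion argument.
\<close>

lemma gaussian_integral_real:
  fixes s :: real
  shows "integrable lborel (\<lambda>x. complex_of_real (exp (- pi * x\<^sup>2)) * cis (- 2 * pi * (x * s)))"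
    and "(\<integral>x. complex_of_real (exp (- pi * x\<^sup>2)) * cis (- 2 * pi * (x * s)) \<partial>lborel)
      = exp (- pi * s\<^sup>2)"
proof -
  let ?c = "sqrt (2 * pi)"
  let ?f = "\<lambda>x. std_normal_density x *\<^sub>R cis (- (?c * s) * x)"
  have c: "?c \<noteq> 0" "?c > 0" "?c * ?c = 2 * pi" "1 / ?c \<noteq> 0" by simp_all
  have int: "integrable lborel ?f"
  proof (rule Bochner_Integration.integrable_bound)
    show "integrable lborel std_normal_density" by simp
    show "?f \<in> borel_measurable lborel"
      by (intro borel_measurable_scaleR) (auto intro!: borel_measurable_continuous_onI continuous_intros)
  qed (simp add: abs_mult)
  have "char std_normal_distribution (- (?c * s)) = (\<integral>x. ?f x \<partial>lborel)"
    unfolding char_def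
    by (subst integral_density)
       (auto simp: cis_conv_exp intro!: borel_measurable_continuous_onI continuous_intros)
  moreover have "(?c * s)\<^sup>2 / 2 = pi * s\<^sup>2" by (simp add: power_mult_distrib)
  ultimately have val: "(\<integral>x. ?f x \<partial>lborel) = exp (- pi * s\<^sup>2)"
    by (simp add: char_std_normal_distribution del: of_real_exp of_real_power power_mult_distrib)
  have eq: "?f (?c * x) = (1 / ?c) *\<^sub>R (complex_of_real (exp (- pi * x\<^sup>2)) * cis (- 2 * pi * (x * s)))" for x
  proof -
    have "- (?c * s) * (?c * x) = - (?c * ?c) * (x * s)"
      by (metis (no_types) minus_mult_left mult.commute mult.left_commute mult.assoc)
    also have "\<dots> = - 2 * pi * (x * s)"
      by (simp only: c(3))
    finally show ?thesis
      by (simp only: std_normal_density_def) (simp add: power_mult_distrib scaleR_conv_of_real)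
  qed
  have "integrable lborel (\<lambda>x. ?f (0 + ?c * x))"
    by (rule lborel_integrable_real_affine[OF int c(1)])
  then show "integrable lborel (\<lambda>x. complex_of_real (exp (- pi * x\<^sup>2)) * cis (- 2 * pi * (x * s)))"
    using integrable_scaleR_right[of ?c lborel "\<lambda>x. ?f (0 + ?c * x)"] c
    by (simp only: add_0 eq scaleR_scaleR) simp
  show "(\<integral>x. complex_of_real (exp (- pi * x\<^sup>2)) * cis (- 2 * pi * (x * s)) \<partial>lborel)
      = exp (- pi * s\<^sup>2)"
    using lborel_integral_real_affine[OF c(1), of ?f 0] val c
    by (simp only: add_0 eq integral_scaleR_right) simp
qed

definition gaussian :: "'a::euclidean_space \<Rightarrow> complex" where
  "gaussian x = of_real (exp (- pi * (norm x)\<^sup>2))"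

lemma gaussian_prod: "gaussian x = (\<Prod>b\<in>Basis. complex_of_real (exp (- pi * (x \<bullet> b)\<^sup>2)))"
proof -
  have "(norm x)\<^sup>2 = (\<Sum>b\<in>Basis. (x \<bullet> b)\<^sup>2)"
    unfolding power2_norm_eq_inner by (subst euclidean_inner) (simp add: power2_eq_square)
  then have "gaussian x = of_real (exp (\<Sum>b\<in>Basis. - pi * (x \<bullet> b)\<^sup>2))"
    by (simp add: gaussian_def sum_distrib_left sum_negf)
  then show ?thesis by (simp only: exp_sum[OF finite_Basis] of_real_prod)
qed

lemma fourier_gaussian:
  shows "integrable lborel (gaussian :: 'a::euclidean_space \<Rightarrow> complex)"
    and "fourier (gaussian :: 'a \<Rightarrow> complex) = gaussian"
proof -
  have "integrable lborel (\<lambda>x. complex_of_real (exp (- pi * x\<^sup>2)))"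
    using gaussian_integral_real(1)[of 0] by simp
  from integrable_lborel_prod(1)[of "\<lambda>_. \<lambda>x. complex_of_real (exp (- pi * x\<^sup>2))", OF this]
  show "integrable lborel (gaussian :: 'a::euclidean_space \<Rightarrow> complex)"
    by (simp add: gaussian_prod[abs_def])
  show "fourier (gaussian :: 'a \<Rightarrow> complex) = gaussian"
  proof
    fix \<xi> :: 'a
    have cis: "cis (- 2 * pi * (x \<bullet> \<xi>)) = (\<Prod>b\<in>Basis. cis (- 2 * pi * ((x \<bullet> b) * (\<xi> \<bullet> b))))" for x :: 'a
      unfolding cis_conv_exp exp_sum[OF finite_Basis, symmetric]
      by (subst euclidean_inner) (simp add: sum_distrib_left sum_negf sum_distrib_right)
    have "fourier gaussian \<xi> = (\<integral>x. (\<Prod>b\<in>Basis. complex_of_real (exp (- pi * (x \<bullet> b)\<^sup>2)) *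
        cis (- 2 * pi * ((x \<bullet> b) * (\<xi> \<bullet> b)))) \<partial>(lborel :: 'a measure))"
      unfolding fourier_def gaussian_prod cis prod.distrib ..
    also have "\<dots> = gaussian \<xi>"
      unfolding gaussian_prod
      by (subst integrable_lborel_prod(2)[OF gaussian_integral_real(1)])
         (simp only: gaussian_integral_real(2))
    finally show "fourier gaussian \<xi> = gaussian \<xi>" .
  qed
qed

lemma continuous_fourier:
  assumes f: "integrable lborel (f :: 'a::euclidean_space \<Rightarrow> complex)"
  shows "continuous_on UNIV (fourier f)"
  unfolding continuous_on_sequentially comp_def
proof (intro allI ballI impI)
  fix x :: "nat \<Rightarrow> 'a" and a assume "(\<forall>n. x n \<in> UNIV) \<and> x \<longlonglongrightarrow> a"
  then have lim: "x \<longlonglongrightarrow> a" by simp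
  show "(\<lambda>n. fourier f (x n)) \<longlonglongrightarrow> fourier f a"
    unfolding fourier_def
  proof (rule integral_dominated_convergence[where w = "\<lambda>x. norm (f x)"])
    show "AE y in lborel. (\<lambda>n. f y * cis (- 2 * pi * (y \<bullet> x n))) \<longlonglongrightarrow> f y * cis (- 2 * pi * (y \<bullet> a))"
      using lim by (intro AE_I2 tendsto_intros)
    show "AE y in lborel. norm (f y * cis (- 2 * pi * (y \<bullet> x n))) \<le> norm (f y)" for n
      by (simp add: norm_mult)
  qed (use f integrable_fourier_kernel[OF f] in auto)
qed

lemma integrable_product_kernel:
  fixes f :: "'a::euclidean_space \<Rightarrow> complex" and g :: "'b::euclidean_space \<Rightarrow> complex"
  assumes f: "integrable lborel f" and g: "integrable lborel g"
    and k[measurable]: "k \<in> borel_measurable (lborel \<Otimes>\<^sub>M lborel)" and k1: "\<And>x y. cmod (k (x, y)) \<le> 1"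
  shows "integrable (lborel \<Otimes>\<^sub>M lborel) (\<lambda>(x, y). f x * g y * k (x, y))"
proof (rule Bochner_Integration.integrable_bound)
  have [measurable]: "f \<in> borel_measurable borel" "g \<in> borel_measurable borel"
    using f g by auto
  show "integrable (lborel \<Otimes>\<^sub>M lborel) (\<lambda>(x, y). f x * g y)"
  proof (rule lborel_pair.Fubini_integrable)
    show "integrable lborel (\<lambda>x. \<integral>y. norm (case (x, y) of (x, y) \<Rightarrow> f x * g y) \<partial>lborel)"
      using f by (simp add: norm_mult)
  qed (use g in auto)
  show "(\<lambda>(x, y). f x * g y * k (x, y)) \<in> borel_measurable (lborel \<Otimes>\<^sub>M lborel)"
    by measurable
  show "AE p in lborel \<Otimes>\<^sub>M lborel. norm (case p of (x, y) \<Rightarrow> f x * g y * k (x, y))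
      \<le> norm (case p of (x, y) \<Rightarrow> f x * g y)"
    using k1 by (auto simp: norm_mult split: prod.split intro!: AE_I2 mult_left_le)
qed

text \<open>
  Fubini moves the transform from one factor to the other. This gives Fourier inversion at a point,
  with a Gaussian as second factor, and later the decomposition of a multiplication operator into
  multiplications by characters, with the product of two square integrable functions.
\<close>

lemma integral_fourier_swap:
  fixes f g :: "'a::euclidean_space \<Rightarrow> complex"
  assumes f: "integrable lborel f" and g: "integrable lborel g"
  shows "(\<integral>\<xi>. fourier f \<xi> * g \<xi> \<partial>lborel) = (\<integral>x. f x * fourier g x \<partial>lborel)"
proof -
  let ?k = "\<lambda>(x::'a, y). cis (- 2 * pi * (x \<bullet> y))"
  have "?k \<in> borel_measurable borel"
    by (intro borel_measurable_continuous_onI) (auto simp: case_prod_beta intro!: continuous_intros)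
  then have k: "?k \<in> borel_measurable (lborel \<Otimes>\<^sub>M lborel)"
    by (simp add: lborel_prod)
  have I: "integrable (lborel \<Otimes>\<^sub>M lborel) (\<lambda>(x, y). f x * g y * ?k (x, y))"
    by (rule integrable_product_kernel[OF f g k]) simp
  have "(\<integral>\<xi>. fourier f \<xi> * g \<xi> \<partial>lborel) = (\<integral>\<xi>. (\<integral>x. f x * g \<xi> * ?k (x, \<xi>) \<partial>lborel) \<partial>lborel)"
    unfolding fourier_def
    by (subst integral_mult_left_zero[symmetric]) (simp add: ac_simps)
  also have "\<dots> = (\<integral>x. (\<integral>\<xi>. f x * g \<xi> * ?k (x, \<xi>) \<partial>lborel) \<partial>lborel)"
    using lborel_pair.Fubini_integral[OF I] by simp
  also have "\<dots> = (\<integral>x. f x * fourier g x \<partial>lborel)"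
    unfolding fourier_def
    by (subst integral_mult_right_zero[symmetric]) (simp add: ac_simps inner_commute)
  finally show ?thesis .
qed

text \<open>
  Integrate the transform of \<open>F\<close> against a Gaussian that spreads out to the constant \<open>1\<close>. With the
  transform moved to the Gaussian this is a Gaussian average of \<open>F\<close> around \<open>0\<close>, which tends to \<open>F 0\<close>.
  Positivity of the transform permits monotone convergence on the other side, so that its
  integrability comes out of the argument.
\<close>

lemma fourier_inversion_at_zero:
  fixes F :: "'a::euclidean_space \<Rightarrow> complex" and G :: "'a \<Rightarrow> real"
  assumes F: "integrable lborel F" and bdd: "\<And>x. cmod (F x) \<le> C" and cont: "isCont F 0"
    and FG: "\<And>\<xi>. fourier F \<xi> = of_real (G \<xi>)" and pos: "\<And>\<xi>. 0 \<le> G \<xi>"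
  shows "integrable lborel G" and "F 0 = of_real (\<integral>\<xi>. G \<xi> \<partial>lborel)"
proof -
  note gi = fourier_gaussian(1)[where 'a='a] and gf = fourier_gaussian(2)[where 'a='a]
  have [measurable]: "F \<in> borel_measurable borel" using F by auto
  have [measurable]: "(gaussian :: 'a \<Rightarrow> complex) \<in> borel_measurable borel" using gi by auto
  have contG: "continuous_on UNIV G"
  proof -
    have "continuous_on UNIV (\<lambda>\<xi>. Re (fourier F \<xi>))"
      by (intro continuous_intros continuous_fourier[OF F])
    then show ?thesis by (simp add: FG)
  qed
  have Gm[measurable]: "G \<in> borel_measurable borel"
    by (rule borel_measurable_continuous_onI[OF contG])
  define e :: "nat \<Rightarrow> real" where "e k = inverse (Suc k)" for k
  have e: "e k > 0" for k by (simp add: e_def)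
  have elim: "e \<longlonglongrightarrow> 0" unfolding e_def by (rule LIMSEQ_inverse_real_of_nat)
  let ?g = "\<lambda>k \<xi>::'a. gaussian (e k *\<^sub>R \<xi>)"
  have gint: "integrable lborel (?g k)" for k
    using integral_lborel_affine(1)[of "e k" gaussian 0] gi e[of k] by simp
  have gft: "fourier (?g k) (e k *\<^sub>R y) = gaussian y / of_real (e k ^ DIM('a))" for k y
  proof -
    have "gaussian y = (\<integral>x. gaussian x * cis (- 2 * pi * (x \<bullet> y)) \<partial>lborel)"
      using gf by (metis fourier_def)
    also have "\<dots> = e k ^ DIM('a) *\<^sub>R fourier (?g k) (e k *\<^sub>R y)"
      using integral_lborel_affine(2)[of "e k" "\<lambda>x. gaussian x * cis (- 2 * pi * (x \<bullet> y))" 0]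
        integrable_fourier_kernel[OF gi] e[of k]
      by (simp add: fourier_def)
    finally show ?thesis using e[of k] by (simp add: scaleR_conv_of_real)
  qed
  have bound: "cmod (F (e k *\<^sub>R y) * gaussian y) \<le> C * cmod (gaussian y)" for k y
    unfolding norm_mult using bdd by (intro mult_right_mono) auto
  have FGint: "integrable lborel (\<lambda>\<xi>. G \<xi> * exp (- pi * (norm (e k *\<^sub>R \<xi>))\<^sup>2))"
    and FGval: "(\<integral>y. F (e k *\<^sub>R y) * gaussian y \<partial>lborel)
      = of_real (\<integral>\<xi>. G \<xi> * exp (- pi * (norm (e k *\<^sub>R \<xi>))\<^sup>2) \<partial>lborel)" for k
  proof -
    have 1: "integrable lborel (\<lambda>\<xi>. fourier F \<xi> * ?g k \<xi>)"
    proof (rule Bochner_Integration.integrable_bound)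
      show "integrable lborel (\<lambda>\<xi>. (\<integral>x. cmod (F x) \<partial>lborel) * cmod (?g k \<xi>))"
        using gint by simp
      show "(\<lambda>\<xi>. fourier F \<xi> * ?g k \<xi>) \<in> borel_measurable lborel"
        unfolding FG by measurable
    qed (use norm_fourier_le[OF F] in \<open>auto simp: norm_mult intro!: AE_I2 mult_right_mono\<close>)
    then have "integrable lborel (\<lambda>\<xi>. Re (fourier F \<xi> * ?g k \<xi>))" by (rule integrable_Re)
    then show "integrable lborel (\<lambda>\<xi>. G \<xi> * exp (- pi * (norm (e k *\<^sub>R \<xi>))\<^sup>2))"
      by (simp add: FG gaussian_def)
    have 2: "integrable lborel (\<lambda>x. F x * fourier (?g k) x)"
    proof (rule Bochner_Integration.integrable_bound)
      show "integrable lborel (\<lambda>x. (\<integral>x. cmod (?g k x) \<partial>lborel) * cmod (F x))"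
        using F by simp
      show "(\<lambda>x. F x * fourier (?g k) x) \<in> borel_measurable lborel"
        using borel_measurable_continuous_onI[OF continuous_fourier[OF gint]] by measurable
    qed (use norm_fourier_le[OF gint] in \<open>auto simp: norm_mult mult.commute intro!: AE_I2 mult_left_mono\<close>)
    have "of_real (\<integral>\<xi>. G \<xi> * exp (- pi * (norm (e k *\<^sub>R \<xi>))\<^sup>2) \<partial>lborel)
        = (\<integral>\<xi>. fourier F \<xi> * ?g k \<xi> \<partial>lborel)"
      unfolding FG gaussian_def by (simp flip: of_real_mult)
    also have "\<dots> = (\<integral>x. F x * fourier (?g k) x \<partial>lborel)"
      by (rule integral_fourier_swap[OF F gint])
    also have "\<dots> = (\<integral>y. F (e k *\<^sub>R y) * gaussian y \<partial>lborel)"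
      using integral_lborel_affine(2)[OF _ 2, of "e k" 0] e[of k]
      by (simp add: gft scaleR_conv_of_real)
    finally show "(\<integral>y. F (e k *\<^sub>R y) * gaussian y \<partial>lborel)
      = of_real (\<integral>\<xi>. G \<xi> * exp (- pi * (norm (e k *\<^sub>R \<xi>))\<^sup>2) \<partial>lborel)" by simp
  qed
  have "(\<lambda>k. \<integral>y. F (e k *\<^sub>R y) * gaussian y \<partial>lborel) \<longlonglongrightarrow> (\<integral>y. F 0 * gaussian (y::'a) \<partial>lborel)"
  proof (rule integral_dominated_convergence[where w = "\<lambda>y. C * cmod (gaussian y)"])
    show "AE y in lborel. (\<lambda>k. F (e k *\<^sub>R y) * gaussian y) \<longlonglongrightarrow> F 0 * gaussian y"
    proof (rule AE_I2)
      fix y :: 'a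
      have "(\<lambda>k. e k *\<^sub>R y) \<longlonglongrightarrow> 0 *\<^sub>R y" by (intro tendsto_intros elim)
      then have "(\<lambda>k. F (e k *\<^sub>R y)) \<longlonglongrightarrow> F 0"
        using isCont_tendsto_compose[OF cont] by simp
      then show "(\<lambda>k. F (e k *\<^sub>R y) * gaussian y) \<longlonglongrightarrow> F 0 * gaussian y"
        by (intro tendsto_intros)
    qed
    show "AE y in lborel. norm (F (e k *\<^sub>R y) * gaussian y) \<le> C * cmod (gaussian y)" for k
      using bound by simp
  qed (use gi in simp_all)
  moreover have "(\<integral>y. gaussian y \<partial>(lborel :: 'a measure)) = 1"
    using fun_cong[OF gf, of 0] by (simp add: fourier_def gaussian_def)
  ultimately have "(\<lambda>k. complex_of_real (\<integral>\<xi>. G \<xi> * exp (- pi * (norm (e k *\<^sub>R \<xi>))\<^sup>2) \<partial>lborel)) \<longlonglongrightarrow> F 0"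
    by (simp add: FGval)
  then have lim: "(\<lambda>k. \<integral>\<xi>. G \<xi> * exp (- pi * (norm (e k *\<^sub>R \<xi>))\<^sup>2) \<partial>lborel) \<longlonglongrightarrow> Re (F 0)"
    and im: "Im (F 0) = 0"
    using tendsto_Re[of _ "F 0"] tendsto_Im[of _ "F 0" sequentially] LIMSEQ_unique
    by (fastforce simp: LIMSEQ_const_iff)+
  have edec: "e (Suc k) \<le> e k" for k by (simp add: e_def field_simps)
  \<comment> \<open>The widths \<open>1 / e k\<close> increase, so the Gaussian factors increase to \<open>1\<close>.\<close>
  have mono: "AE \<xi> in lborel. mono (\<lambda>k. G \<xi> * exp (- pi * (norm (e k *\<^sub>R \<xi>))\<^sup>2))"
  proof (intro AE_I2 incseq_SucI mult_left_mono pos)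
    fix \<xi> :: 'a and k
    have "(norm (e (Suc k) *\<^sub>R \<xi>))\<^sup>2 \<le> (norm (e k *\<^sub>R \<xi>))\<^sup>2"
      using edec[of k] e[of k] e[of "Suc k"] by (intro power_mono) (auto intro: mult_right_mono)
    then show "exp (- pi * (norm (e k *\<^sub>R \<xi>))\<^sup>2) \<le> exp (- pi * (norm (e (Suc k) *\<^sub>R \<xi>))\<^sup>2)"
      by simp
  qed
  have ptw: "AE \<xi> in lborel. (\<lambda>k. G \<xi> * exp (- pi * (norm (e k *\<^sub>R \<xi>))\<^sup>2)) \<longlonglongrightarrow> G \<xi>"
  proof (rule AE_I2)
    fix \<xi> :: 'a
    have "(\<lambda>k. G \<xi> * exp (- pi * (norm (e k *\<^sub>R \<xi>))\<^sup>2)) \<longlonglongrightarrow> G \<xi> * exp (- pi * (norm (0 *\<^sub>R \<xi>))\<^sup>2)"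
      by (intro tendsto_intros elim)
    then show "(\<lambda>k. G \<xi> * exp (- pi * (norm (e k *\<^sub>R \<xi>))\<^sup>2)) \<longlonglongrightarrow> G \<xi>" by simp
  qed
  show "integrable lborel G"
    by (rule integrable_monotone_convergence[OF FGint mono ptw lim]) measurable
  have "(\<integral>\<xi>. G \<xi> \<partial>lborel) = Re (F 0)"
    by (rule integral_monotone_convergence[OF FGint mono ptw lim]) measurable
  then show "F 0 = of_real (\<integral>\<xi>. G \<xi> \<partial>lborel)"
    using im by (simp add: complex_eq_iff)
qed

text \<open>
  The regularity that the proof uses of a window. Schwartz functions have it, and it survives the
  translations, modulations and differences to which windows are subjected. Boundedness makes these
  functions square integrable; continuity together with integrability makes dominated convergence
  available whenever a translation parameter varies.
\<close>

definition tame :: "('a::euclidean_space \<Rightarrow> complex) \<Rightarrow> bool" where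
  "tame f \<longleftrightarrow> continuous_on UNIV f \<and> bounded (range f) \<and> integrable lborel f"

lemma tameD:
  assumes "tame f"
  shows "continuous_on UNIV f" "integrable lborel f" "f \<in> borel_measurable borel"
  using assms by (auto simp: tame_def)

lemma tame_bound:
  assumes "tame f" shows "\<exists>C>0. \<forall>x. cmod (f x) \<le> C"
  using assms unfolding tame_def bounded_pos by auto

lemma tame_square_integrable:
  assumes f: "tame f" shows "square_integrable f"
proof -
  obtain C where C: "C > 0" "\<And>x. cmod (f x) \<le> C" using tame_bound[OF f] by blast
  note [measurable] = tameD(3)[OF f]
  have "integrable lborel (\<lambda>x. (cmod (f x))\<^sup>2)"
  proof (rule Bochner_Integration.integrable_bound)
    show "integrable lborel (\<lambda>x. C * cmod (f x))" using tameD(2)[OF f] by simp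
  qed (use C in \<open>auto simp: power2_eq_square intro!: mult_right_mono\<close>)
  then show ?thesis by (simp add: square_integrable_def)
qed

lemma tame_diff: "tame f \<Longrightarrow> tame g \<Longrightarrow> tame (\<lambda>x. f x - g x)"
  unfolding tame_def by (auto intro!: continuous_intros bounded_minus_comp)

lemma tame_affine:
  assumes f: "tame f" and c: "c \<noteq> 0"
  shows "tame (\<lambda>s. f (t + c *\<^sub>R s))"
proof -
  have "continuous_on UNIV (\<lambda>s. f (t + c *\<^sub>R s))"
    by (rule continuous_on_compose2[OF tameD(1)[OF f]]) (auto intro!: continuous_intros)
  moreover have "bounded (range (\<lambda>s. f (t + c *\<^sub>R s)))"
    by (rule bounded_subset[of "range f"]) (use f in \<open>auto simp: tame_def\<close>)
  ultimately show ?thesis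
    using integral_lborel_affine(1)[OF c tameD(2)[OF f]] by (simp add: tame_def)
qed

lemma tame_mult:
  assumes f: "tame f" and k: "continuous_on UNIV k" "\<And>s. cmod (k s) \<le> C"
  shows "tame (\<lambda>s. k s * f s)"
proof -
  obtain B where B: "B > 0" "\<And>x. cmod (f x) \<le> B" using tame_bound[OF f] by blast
  have C: "0 \<le> C" using order_trans[OF norm_ge_zero k(2)] .
  have [measurable]: "f \<in> borel_measurable borel" "k \<in> borel_measurable borel"
    using tameD(3)[OF f] borel_measurable_continuous_onI[OF k(1)] by auto
  have b: "cmod (k s * f s) \<le> C * cmod (f s)" for s
    unfolding norm_mult by (intro mult_right_mono k) simp
  have "integrable lborel (\<lambda>s. k s * f s)"
  proof (rule Bochner_Integration.integrable_bound)
    show "integrable lborel (\<lambda>s. C * cmod (f s))" using tameD(2)[OF f] by simp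
    show "AE s in lborel. norm (k s * f s) \<le> norm (C * cmod (f s))"
      using b C by (simp add: abs_mult)
  qed simp
  moreover have "bounded (range (\<lambda>s. k s * f s))"
  proof (rule boundedI)
    fix y assume "y \<in> range (\<lambda>s. k s * f s)"
    then obtain s where "y = k s * f s" by auto
    then show "norm y \<le> C * B" using order_trans[OF b mult_left_mono[OF B(2) C]] by simp
  qed
  moreover have "continuous_on UNIV (\<lambda>s. k s * f s)"
    by (intro continuous_intros k tameD(1)[OF f])
  ultimately show ?thesis by (simp add: tame_def)
qed

text \<open>
  The autocorrelation of \<open>f\<close> has the square of the modulus of the transform of \<open>f\<close> as its own transform
  and the integral of the square of \<open>\<bar>f\<bar>\<close> as its value at \<open>0\<close>. For \<open>f\<close> continuous, bounded and integrable
  it is continuous at \<open>0\<close>, so inversion at \<open>0\<close> applies to it.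
\<close>

lemma plancherel:
  fixes f :: "'a::euclidean_space \<Rightarrow> complex"
  assumes f: "tame f"
  shows "integrable lborel (\<lambda>\<xi>. (cmod (fourier f \<xi>))\<^sup>2)"
    and "(\<integral>\<xi>. (cmod (fourier f \<xi>))\<^sup>2 \<partial>lborel) = (\<integral>x. (cmod (f x))\<^sup>2 \<partial>lborel)"
proof -
  obtain C where C: "C > 0" "\<And>x. cmod (f x) \<le> C" using tame_bound[OF f] by blast
  note fi = tameD(2)[OF f] and [measurable] = tameD(3)[OF f]
  let ?F = "Defs.convolution f (l1_involution f)"
  have F: "?F z = (\<integral>y. f y * cnj (f (y - z)) \<partial>lborel)" for z
    by (simp add: Defs.convolution_def l1_involution_def)
  have b: "cmod (f y * cnj (f (y - z))) \<le> C * cmod (f y)" for y z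
    using mult_right_mono[OF C(2)[of "y - z"], of "cmod (f y)"] by (simp add: norm_mult mult.commute)
  have bdd: "cmod (?F z) \<le> (\<integral>y. C * cmod (f y) \<partial>lborel)" for z
    unfolding F
  proof (rule Bochner_Integration.integral_norm_bound_integral)
    show I: "integrable lborel (\<lambda>y. C * cmod (f y))" using fi by simp
    show "integrable lborel (\<lambda>y. f y * cnj (f (y - z)))"
    proof (rule Bochner_Integration.integrable_bound[OF I])
      show "AE y in lborel. norm (f y * cnj (f (y - z))) \<le> norm (C * cmod (f y))"
        using b C(1) by (simp add: abs_mult)
    qed measurable
  qed (rule b)
  have cont: "isCont ?F 0"
    unfolding continuous_at_sequentially comp_def
  proof (intro allI impI)
    fix x :: "nat \<Rightarrow> 'a" assume x: "x \<longlonglongrightarrow> 0"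
    show "(\<lambda>n. ?F (x n)) \<longlonglongrightarrow> ?F 0" unfolding F
    proof (rule integral_dominated_convergence[where w = "\<lambda>y. C * cmod (f y)"])
      show "AE y in lborel. (\<lambda>n. f y * cnj (f (y - x n))) \<longlonglongrightarrow> f y * cnj (f (y - 0))"
      proof (rule AE_I2)
        fix y
        have "isCont f (y - 0)" using tameD(1)[OF f] by (simp add: continuous_on_eq_continuous_at)
        then have "(\<lambda>n. f (y - x n)) \<longlonglongrightarrow> f (y - 0)"
          by (rule isCont_tendsto_compose) (intro tendsto_intros x)
        then show "(\<lambda>n. f y * cnj (f (y - x n))) \<longlonglongrightarrow> f y * cnj (f (y - 0))"
          by (intro tendsto_intros)
      qed
    qed (use b fi in auto)
  qed
  have ft: "fourier ?F \<xi> = of_real ((cmod (fourier f \<xi>))\<^sup>2)" for \<xi>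
    by (simp add: fourier_convolution[OF fi integrable_l1_involution[OF fi]]
      fourier_l1_involution[OF fi] complex_mult_cnj cmod_power2)
  have "integrable lborel ?F"
    by (intro integrable_convolution integrable_l1_involution fi)
  note inv = fourier_inversion_at_zero[OF this bdd cont ft]
  show "integrable lborel (\<lambda>\<xi>. (cmod (fourier f \<xi>))\<^sup>2)" by (rule inv(1)) simp
  have "of_real (\<integral>\<xi>. (cmod (fourier f \<xi>))\<^sup>2 \<partial>lborel) = ?F 0" by (rule inv(2)[symmetric]) simp
  also have "?F 0 = (\<integral>x. complex_of_real ((cmod (f x))\<^sup>2) \<partial>lborel)"
    unfolding F by (simp add: complex_mult_cnj cmod_power2)
  also have "\<dots> = of_real (\<integral>x. (cmod (f x))\<^sup>2 \<partial>lborel)"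
    by (simp only: integral_complex_of_real)
  finally show "(\<integral>\<xi>. (cmod (fourier f \<xi>))\<^sup>2 \<partial>lborel) = (\<integral>x. (cmod (f x))\<^sup>2 \<partial>lborel)"
    by (simp only: of_real_eq_iff)
qed

section \<open>Fourier transforms of Schwartz functions\<close>

lemma iterated_derivative_snoc:
  "iterated_derivative vs (\<lambda>x. frechet_derivative f (at x) v) = iterated_derivative (vs @ [v]) f"
  by (induction vs) simp_all

lemma schwartz_derivative:
  assumes f: "schwartz f" and v: "v \<in> Basis"
  shows "schwartz (\<lambda>x. frechet_derivative f (at x) v)"
  using assms unfolding schwartz_def iterated_derivative_snoc by simp

lemma schwartz_differentiable: "schwartz f \<Longrightarrow> f differentiable (at x)"
  unfolding schwartz_def using iterated_derivative.simps(1) by (metis empty_subsetI list.set(1))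

lemma schwartz_diff_scale:
  assumes f: "schwartz f" and g: "schwartz g"
  shows "schwartz (\<lambda>x. f x - c * g x)"
proof -
  have d: "iterated_derivative vs f differentiable (at x)" "iterated_derivative vs g differentiable (at x)"
    if "set vs \<subseteq> Basis" for vs x
    using f g that by (auto simp: schwartz_def)
  have eq: "iterated_derivative vs (\<lambda>x. f x - c * g x)
      = (\<lambda>x. iterated_derivative vs f x - c * iterated_derivative vs g x)" if "set vs \<subseteq> Basis" for vs
    using that
  proof (induction vs)
    case (Cons v vs)
    then have vs: "set vs \<subseteq> Basis" by simp
    have "frechet_derivative (\<lambda>x. iterated_derivative vs f x - c * iterated_derivative vs g x) (at x)
      = (\<lambda>h. frechet_derivative (iterated_derivative vs f) (at x) h
          - c * frechet_derivative (iterated_derivative vs g) (at x) h)" for x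
      using d[OF vs, of x]
      by (intro frechet_derivative_at[symmetric] has_derivative_diff has_derivative_mult_right)
        (simp_all add: frechet_derivative_works[symmetric])
    with Cons vs show ?case by simp
  qed simp
  show ?thesis
    unfolding schwartz_def
  proof (intro allI impI conjI)
    fix vs x and k :: nat assume vs: "set vs \<subseteq> (Basis :: 'a set)"
    show "iterated_derivative vs (\<lambda>x. f x - c * g x) differentiable at x"
      unfolding eq[OF vs] using d[OF vs] by (intro differentiable_diff differentiable_mult differentiable_const)
    have "bounded (range (\<lambda>x. norm x ^ k *\<^sub>R iterated_derivative vs f x))"
      "bounded (range (\<lambda>x. norm x ^ k *\<^sub>R iterated_derivative vs g x))"
      using f g vs by (auto simp: schwartz_def)
    moreover from this(2) have "bounded ((\<lambda>y. c * y) ` range (\<lambda>x. norm x ^ k *\<^sub>R iterated_derivative vs g x))"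
      by (rule bounded_linear_image[OF _ bounded_linear_mult_right])
    ultimately have "bounded (range (\<lambda>x. norm x ^ k *\<^sub>R iterated_derivative vs f x
        - c * norm x ^ k *\<^sub>R iterated_derivative vs g x))"
      by (intro bounded_minus_comp) (simp_all add: image_image)
    then show "bounded (range (\<lambda>x. norm x ^ k *\<^sub>R iterated_derivative vs (\<lambda>x. f x - c * g x) x))"
      unfolding eq[OF vs] by (simp add: scaleR_diff_right)
  qed
qed

lemma schwartz_diff: "schwartz f \<Longrightarrow> schwartz g \<Longrightarrow> schwartz (\<lambda>x. f x - g x)"
  using schwartz_diff_scale[of f g 1] by simp

lemma integrable_inverse_one_plus_square: "integrable lborel (\<lambda>t::real. 1 / (1 + t\<^sup>2))"
proof -
  have lim: "(arctan \<longlongrightarrow> pi / 2) at_top" "(arctan \<longlongrightarrow> - (pi / 2)) at_bot"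
    using tendsto_arctan_at_top tendsto_arctan_at_bot by auto
  have d: "(arctan has_real_derivative 1 / (1 + t\<^sup>2)) (at t)" for t
    using DERIV_arctan[of t] by (simp add: inverse_eq_divide)
  have nz: "1 + t\<^sup>2 \<noteq> 0" for t :: real
    using zero_le_power2[of t] by linarith
  have "set_integrable lborel (einterval (-\<infinity>) \<infinity>) (\<lambda>t. 1 / (1 + t\<^sup>2))"
    by (rule interval_integral_FTC_nonneg(1)[where F = arctan and A = "- (pi/2)" and B = "pi/2"])
       (use lim d nz in \<open>auto simp: ereal_tendsto_simps intro!: continuous_intros\<close>)
  then show ?thesis by (simp add: set_integrable_def einterval_def)
qed

lemma integrable_decay_weight:
  "integrable lborel (\<lambda>x::'a::euclidean_space. \<Prod>b\<in>Basis. 1 / (1 + (x \<bullet> b)\<^sup>2))"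
proof -
  have "integrable lborel (\<lambda>t. complex_of_real (1 / (1 + t\<^sup>2)))"
    using integrable_inverse_one_plus_square by (rule integrable_of_real)
  from integrable_lborel_prod(1)[of "\<lambda>_::'a. \<lambda>t. complex_of_real (1 / (1 + t\<^sup>2))", OF this]
  have "integrable lborel (\<lambda>x::'a. complex_of_real (\<Prod>b\<in>Basis. 1 / (1 + (x \<bullet> b)\<^sup>2)))"
    by (simp only: of_real_prod)
  then have "integrable lborel (\<lambda>x::'a. Re (complex_of_real (\<Prod>b\<in>Basis. 1 / (1 + (x \<bullet> b)\<^sup>2))))"
    by (rule integrable_Re)
  then show ?thesis by (simp only: Re_complex_of_real)
qed

lemma integrable_of_decay:
  fixes f :: "'a::euclidean_space \<Rightarrow> complex"
  assumes [measurable]: "f \<in> borel_measurable borel"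
    and f: "\<And>x. cmod (f x) * (\<Prod>b\<in>Basis. 1 + (x \<bullet> b)\<^sup>2) \<le> C"
  shows "integrable lborel f"
proof (rule Bochner_Integration.integrable_bound)
  show "integrable lborel (\<lambda>x::'a. C * (\<Prod>b\<in>Basis. 1 / (1 + (x \<bullet> b)\<^sup>2)))"
    by (intro integrable_mult_right integrable_decay_weight)
  show "AE x in lborel. norm (f x) \<le> norm (C * (\<Prod>b\<in>Basis. 1 / (1 + (x \<bullet> b)\<^sup>2)))"
  proof (rule AE_I2)
    fix x :: 'a
    have p: "0 < (\<Prod>b\<in>Basis. 1 + (x \<bullet> b)\<^sup>2)"
      by (intro prod_pos) (auto intro: add_pos_nonneg)
    have "norm (f x) \<le> C / (\<Prod>b\<in>Basis. 1 + (x \<bullet> b)\<^sup>2)"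
      using f[of x] p by (simp add: pos_le_divide_eq)
    also have "\<dots> \<le> norm (C / (\<Prod>b\<in>Basis. 1 + (x \<bullet> b)\<^sup>2))"
      unfolding real_norm_def by (rule abs_ge_self)
    finally show "norm (f x) \<le> norm (C * (\<Prod>b\<in>Basis. 1 / (1 + (x \<bullet> b)\<^sup>2)))"
      by (simp add: prod_dividef)
  qed
qed simp

text \<open>
  The power \<open>norm x ^ (2 * DIM('a))\<close> dominates the product of the weights \<open>1 + (x \<bullet> b)\<^sup>2\<close>, and the
  reciprocal of that product is integrable.
\<close>

lemma schwartz_tame:
  fixes f :: "'a::euclidean_space \<Rightarrow> complex"
  assumes f: "schwartz f"
  shows "tame f"
proof -
  have cont: "continuous_on UNIV f"
    using schwartz_differentiable[OF f]
    by (simp add: continuous_on_eq_continuous_at differentiable_imp_continuous_within)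
  have b: "bounded (range (\<lambda>x. norm x ^ k *\<^sub>R f x))" for k
    using f unfolding schwartz_def by (auto dest!: spec[of _ "[]"])
  from b[of 0] have bdd: "bounded (range f)" by simp
  then obtain A where A: "\<And>x. cmod (f x) \<le> A" by (auto simp: bounded_iff)
  from b[of "2 * DIM('a)"] obtain B where B: "\<And>x. norm x ^ (2 * DIM('a)) * cmod (f x) \<le> B"
    by (auto simp: bounded_iff)
  have "cmod (f x) * (\<Prod>b\<in>Basis. 1 + (x \<bullet> b)\<^sup>2) \<le> 2 ^ DIM('a) * (A + B)" for x
  proof -
    have "(\<Prod>b\<in>Basis. 1 + (x \<bullet> b)\<^sup>2) \<le> (\<Prod>b\<in>(Basis::'a set). 1 + (norm x)\<^sup>2)"
      by (intro prod_mono) (auto simp: Basis_le_norm power2_le_iff_abs_le)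
    also have "\<dots> = (1 + (norm x)\<^sup>2) ^ DIM('a)" by simp
    also have "\<dots> \<le> (2 * max 1 ((norm x)\<^sup>2)) ^ DIM('a)"
      by (intro power_mono) auto
    also have "\<dots> \<le> 2 ^ DIM('a) * (1 + norm x ^ (2 * DIM('a)))"
    proof -
      have "max 1 ((norm x)\<^sup>2) ^ DIM('a) \<le> 1 + norm x ^ (2 * DIM('a))"
        by (simp add: max_def power_mult)
      then show ?thesis by (simp add: power_mult_distrib)
    qed
    finally have "cmod (f x) * (\<Prod>b\<in>Basis. 1 + (x \<bullet> b)\<^sup>2)
        \<le> cmod (f x) * (2 ^ DIM('a) * (1 + norm x ^ (2 * DIM('a))))"
      by (rule mult_left_mono) simp
    also have "\<dots> = 2 ^ DIM('a) * (cmod (f x) + norm x ^ (2 * DIM('a)) * cmod (f x))"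
      by (simp add: algebra_simps)
    also have "\<dots> \<le> 2 ^ DIM('a) * (A + B)"
      using A B by (intro mult_left_mono add_mono) auto
    finally show ?thesis .
  qed
  then have "integrable lborel f"
    by (rule integrable_of_decay[OF borel_measurable_continuous_onI[OF cont]])
  with cont bdd show ?thesis by (simp add: tame_def)
qed

text \<open>
  The increments \<open>F (x + v) - F x\<close> integrate to \<open>0\<close> by translation invariance. Written as integrals of
  the derivative along the segment they integrate, by Fubini, to the integral of the derivative.
\<close>

lemma integral_directional_derivative_eq_0:
  fixes F D :: "'a::euclidean_space \<Rightarrow> complex"
  assumes F: "integrable lborel F" and D: "integrable lborel D" and contD: "continuous_on UNIV D"
    and deriv: "\<And>x. ((\<lambda>s. F (x + s *\<^sub>R v)) has_vector_derivative D x) (at 0)"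
  shows "(\<integral>x. D x \<partial>lborel) = 0"
proof -
  have [measurable]: "D \<in> borel_measurable borel" using D by auto
  have FTC: "(\<integral>s. indicator {0..1} s *\<^sub>R D (x + s *\<^sub>R v) \<partial>lborel) = F (x + v) - F x" for x
  proof -
    have "((\<lambda>s. F (x + s *\<^sub>R v)) has_vector_derivative D (x + s *\<^sub>R v)) (at s within {0..1})" for s
    proof -
      have "((\<lambda>t. F ((x + s *\<^sub>R v) + t *\<^sub>R v)) \<circ> (\<lambda>t. t - s) has_vector_derivative (1 *\<^sub>R D (x + s *\<^sub>R v))) (at s)"
        by (rule vector_diff_chain_at) (auto intro!: derivative_eq_intros deriv)
      moreover have "(\<lambda>t. F ((x + s *\<^sub>R v) + t *\<^sub>R v)) \<circ> (\<lambda>t. t - s) = (\<lambda>t. F (x + t *\<^sub>R v))"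
        by (auto simp: fun_eq_iff algebra_simps)
      ultimately show ?thesis by (simp add: has_vector_derivative_at_within)
    qed
    then have "(\<integral>s. indicator {0..1} s *\<^sub>R D (x + s *\<^sub>R v) \<partial>lborel) = F (x + 1 *\<^sub>R v) - F (x + 0 *\<^sub>R v)"
      by (intro integral_FTC_Icc[where F = "\<lambda>s. F (x + s *\<^sub>R v)"])
         (auto intro!: continuous_on_compose2[OF contD] continuous_intros)
    then show ?thesis by simp
  qed
  have sh: "integrable lborel (\<lambda>x. D (x + s *\<^sub>R v))" "(\<integral>x. D (x + s *\<^sub>R v) \<partial>lborel) = (\<integral>x. D x \<partial>lborel)" for s
    using integral_lborel_shift[OF D] by auto
  have shn: "(\<integral>x. cmod (D (x + s *\<^sub>R v)) \<partial>lborel) = (\<integral>x. cmod (D x) \<partial>lborel)" for s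
    using integral_lborel_shift(2)[of "\<lambda>x. cmod (D x)"] D by auto
  have I: "integrable (lborel \<Otimes>\<^sub>M lborel) (\<lambda>(s, x). indicator {0..1} s *\<^sub>R D (x + s *\<^sub>R v))"
  proof (rule lborel_pair.Fubini_integrable)
    show "integrable lborel (\<lambda>s. \<integral>x. norm (case (s, x) of (s, x) \<Rightarrow>
        indicator {0..1::real} s *\<^sub>R D (x + s *\<^sub>R v)) \<partial>lborel)"
      by (simp add: shn)
  qed (use sh in auto)
  have "(\<integral>s. (\<integral>x. indicator {0..1::real} s *\<^sub>R D (x + s *\<^sub>R v) \<partial>lborel) \<partial>lborel)
      = (\<integral>x. (\<integral>s. indicator {0..1} s *\<^sub>R D (x + s *\<^sub>R v) \<partial>lborel) \<partial>lborel)"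
    using lborel_pair.Fubini_integral[OF I] by simp
  also have "\<dots> = 0"
    unfolding FTC using F integral_lborel_shift[OF F, of v] by simp
  finally show ?thesis
    by (simp add: sh)
qed

lemma fourier_schwartz_derivative:
  fixes h :: "'a::euclidean_space \<Rightarrow> complex"
  assumes h: "schwartz h" and v: "v \<in> Basis"
  shows "fourier (\<lambda>x. frechet_derivative h (at x) v) \<xi> = (2 * pi * (\<xi> \<bullet> v)) * \<i> * fourier h \<xi>"
proof -
  let ?h' = "\<lambda>x. frechet_derivative h (at x) v"
  let ?e = "\<lambda>x. cis (- 2 * pi * (x \<bullet> \<xi>))"
  let ?w = "- 2 * pi * (v \<bullet> \<xi>) * \<i>"
  note th = schwartz_tame[OF h] and th' = schwartz_tame[OF schwartz_derivative[OF h v]]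
  have ih: "integrable lborel (\<lambda>x. h x * ?e x)" and ih': "integrable lborel (\<lambda>x. ?h' x * ?e x)"
    using integrable_fourier_kernel[OF tameD(2)[OF th]] integrable_fourier_kernel[OF tameD(2)[OF th']] by blast+
  have "(\<integral>x. ?h' x * ?e x + ?w * (h x * ?e x) \<partial>lborel) = 0"
  proof (rule integral_directional_derivative_eq_0[OF ih])
    show "integrable lborel (\<lambda>x. ?h' x * ?e x + ?w * (h x * ?e x))"
      using ih ih' by (intro Bochner_Integration.integrable_add integrable_mult_right) auto
    show "continuous_on UNIV (\<lambda>x. ?h' x * ?e x + ?w * (h x * ?e x))"
      by (intro continuous_intros tameD(1)[OF th] tameD(1)[OF th'])
    fix x
    have "(h has_derivative frechet_derivative h (at x)) (at x)"
      using schwartz_differentiable[OF h] by (simp add: frechet_derivative_works[symmetric])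
    moreover have "((\<lambda>s. x + s *\<^sub>R v) has_vector_derivative v) (at 0)"
      by (auto intro!: derivative_eq_intros)
    ultimately have 1: "((\<lambda>s. h (x + s *\<^sub>R v)) has_vector_derivative ?h' x) (at 0)"
      using vector_derivative_diff_chain_within[of "\<lambda>s. x + s *\<^sub>R v" v 0 UNIV h "frechet_derivative h (at x)"]
      by (simp add: comp_def has_derivative_at_withinI)
    have 2: "((\<lambda>s. ?e (x + s *\<^sub>R v)) has_vector_derivative (- 2 * pi * (v \<bullet> \<xi>)) *\<^sub>R (\<i> * ?e x)) (at 0)"
    proof -
      have "(cis has_vector_derivative \<i> * cis t) (at t)" for t
        unfolding cis_conv_exp
        by (auto intro!: derivative_eq_intros has_vector_derivative_real_field)
      then have "(cis \<circ> (\<lambda>s. - 2 * pi * ((x + s *\<^sub>R v) \<bullet> \<xi>)) has_vector_derivative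
          (- 2 * pi * (v \<bullet> \<xi>)) *\<^sub>R (\<i> * cis (- 2 * pi * ((x + 0 *\<^sub>R v) \<bullet> \<xi>)))) (at 0)"
        by (intro vector_diff_chain_at) (auto intro!: derivative_eq_intros simp: inner_left_distrib)
      then show ?thesis by (simp add: comp_def)
    qed
    have "((\<lambda>s. h (x + s *\<^sub>R v) * ?e (x + s *\<^sub>R v)) has_vector_derivative
        h (x + 0 *\<^sub>R v) * ((- 2 * pi * (v \<bullet> \<xi>)) *\<^sub>R (\<i> * ?e x)) + ?h' x * ?e (x + 0 *\<^sub>R v)) (at 0)"
      by (rule has_vector_derivative_mult[OF 1 2])
    then show "((\<lambda>s. h (x + s *\<^sub>R v) * ?e (x + s *\<^sub>R v)) has_vector_derivative
        ?h' x * ?e x + ?w * (h x * ?e x)) (at 0)"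
      by (simp add: scaleR_conv_of_real algebra_simps)
  qed
  then have "fourier ?h' \<xi> + ?w * fourier h \<xi> = 0"
    using ih ih' by (simp add: fourier_def)
  then show ?thesis by (simp add: inner_commute add_eq_0_iff)
qed

text \<open>
  Subtracting the second derivative in the direction \<open>b\<close> multiplies the transform by
  \<open>1 + (2 * pi * (\<xi> \<bullet> b))\<^sup>2\<close>. After doing so in every coordinate direction the transform is still that of
  an integrable function, hence bounded. The operator-valued integral that defines \<open>nu_schwartz\<close>
  converges because of this.
\<close>

lemma integrable_fourier_schwartz:
  fixes h :: "'a::euclidean_space \<Rightarrow> complex"
  assumes h: "schwartz h"
  shows "integrable lborel (fourier h)"
proof -
  have "\<exists>g. schwartz g \<and> (\<forall>\<xi>. fourier g \<xi> = (\<Prod>b\<in>A. 1 + (2 * pi * (\<xi> \<bullet> b))\<^sup>2) * fourier h \<xi>)"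
    if "finite A" "A \<subseteq> Basis" for A
    using that
  proof (induction A)
    case empty
    then show ?case using h by auto
  next
    case (insert v A)
    then obtain g where g: "schwartz g"
      "\<And>\<xi>. fourier g \<xi> = (\<Prod>b\<in>A. 1 + (2 * pi * (\<xi> \<bullet> b))\<^sup>2) * fourier h \<xi>" and v: "v \<in> Basis" by auto
    let ?d = "\<lambda>g x. frechet_derivative g (at x) v"
    have s: "schwartz (?d g)" "schwartz (?d (?d g))"
      using schwartz_derivative[OF _ v] g(1) by auto
    have "fourier (\<lambda>x. g x - ?d (?d g) x) \<xi> = (1 + (2 * pi * (\<xi> \<bullet> v))\<^sup>2) * fourier g \<xi>" for \<xi>
      using fourier_diff[of g "?d (?d g)" \<xi>] g(1) s
      by (simp add: fourier_schwartz_derivative[OF _ v] tameD(2) schwartz_tame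
          algebra_simps power2_eq_square)
    then show ?case
      using insert.hyps schwartz_diff[OF g(1) s(2)] g(2)
      by (intro exI[of _ "\<lambda>x. g x - ?d (?d g) x"]) (simp add: mult.assoc)
  qed
  from this[of Basis] obtain g where g: "schwartz g"
    "\<And>\<xi>. fourier g \<xi> = (\<Prod>b\<in>Basis. 1 + (2 * pi * (\<xi> \<bullet> b))\<^sup>2) * fourier h \<xi>" by auto
  note ig = tameD(2)[OF schwartz_tame[OF g(1)]]
  have "cmod (fourier h \<xi>) * (\<Prod>b\<in>Basis. 1 + (\<xi> \<bullet> b)\<^sup>2) \<le> (\<integral>x. cmod (g x) \<partial>lborel)" for \<xi>
  proof -
    have "(\<Prod>b\<in>Basis. 1 + (\<xi> \<bullet> b)\<^sup>2) \<le> (\<Prod>b\<in>Basis. 1 + (2 * pi * (\<xi> \<bullet> b))\<^sup>2)"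
    proof (intro prod_mono conjI add_left_mono)
      fix b :: 'a
      have "1 \<le> (2 * pi)\<^sup>2" using pi_gt3 by (intro one_le_power) simp
      then have "1 * (\<xi> \<bullet> b)\<^sup>2 \<le> (2 * pi)\<^sup>2 * (\<xi> \<bullet> b)\<^sup>2" by (rule mult_right_mono) simp
      then show "(\<xi> \<bullet> b)\<^sup>2 \<le> (2 * pi * (\<xi> \<bullet> b))\<^sup>2" by (simp add: power_mult_distrib)
    qed auto
    then have "cmod (fourier h \<xi>) * (\<Prod>b\<in>Basis. 1 + (\<xi> \<bullet> b)\<^sup>2)
        \<le> cmod (fourier h \<xi>) * (\<Prod>b\<in>Basis. 1 + (2 * pi * (\<xi> \<bullet> b))\<^sup>2)"
      by (rule mult_left_mono) simp
    also have "\<dots> = cmod (fourier g \<xi>)"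
      unfolding g(2) norm_mult norm_of_real
      by (subst abs_of_nonneg) (auto intro!: prod_nonneg simp: mult.commute)
    also have "\<dots> \<le> (\<integral>x. cmod (g x) \<partial>lborel)" by (rule norm_fourier_le[OF ig])
    finally show ?thesis .
  qed
  then show ?thesis
    by (intro integrable_of_decay borel_measurable_continuous_onI continuous_fourier
        tameD(2) schwartz_tame h)
qed

section \<open>Density of the Schwartz functions\<close>

lemma real_polynomial_directional_derivative:
  fixes p :: "'a::real_normed_vector \<Rightarrow> real"
  assumes "real_polynomial_function p"
  shows "\<exists>p'. real_polynomial_function p' \<and> (\<forall>x. \<exists>D. (p has_derivative D) (at x) \<and> D v = p' x)"
  using assms
proof induction
  case (linear f)
  then show ?case
    by (intro exI[of _ "\<lambda>_. f v"] conjI real_polynomial_function.intros(2) allI exI[of _ f])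
       (auto intro: bounded_linear_imp_has_derivative)
next
  case (const c)
  show ?case
    by (intro exI[of _ "\<lambda>_. 0"] conjI real_polynomial_function.intros(2) allI exI[of _ "\<lambda>_. 0"]) auto
next
  case (add f g)
  then obtain f' g' where p: "real_polynomial_function f'" "real_polynomial_function g'"
    and f: "\<And>x. \<exists>D. (f has_derivative D) (at x) \<and> D v = f' x"
    and g: "\<And>x. \<exists>D. (g has_derivative D) (at x) \<and> D v = g' x" by blast
  show ?case
  proof (rule exI[of _ "\<lambda>x. f' x + g' x"], intro conjI allI)
    fix x
    from f[of x] g[of x] obtain D E where "(f has_derivative D) (at x)" "D v = f' x"
      "(g has_derivative E) (at x)" "E v = g' x" by blast
    then show "\<exists>D. ((\<lambda>x. f x + g x) has_derivative D) (at x) \<and> D v = f' x + g' x"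
      by (intro exI[of _ "\<lambda>h. D h + E h"]) (auto intro: has_derivative_add)
  qed (use p in auto)
next
  case (mult f g)
  then obtain f' g' where p: "real_polynomial_function f'" "real_polynomial_function g'"
    and f: "\<And>x. \<exists>D. (f has_derivative D) (at x) \<and> D v = f' x"
    and g: "\<And>x. \<exists>D. (g has_derivative D) (at x) \<and> D v = g' x" by blast
  show ?case
  proof (rule exI[of _ "\<lambda>x. f x * g' x + f' x * g x"], intro conjI allI)
    fix x
    from f[of x] g[of x] obtain D E where "(f has_derivative D) (at x)" "D v = f' x"
      "(g has_derivative E) (at x)" "E v = g' x" by blast
    then show "\<exists>D. ((\<lambda>x. f x * g x) has_derivative D) (at x) \<and> D v = f x * g' x + f' x * g x"
      by (intro exI[of _ "\<lambda>h. f x * E h + D h * g x"]) (auto intro: has_derivative_mult)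
  qed (use p mult.hyps in auto)
qed

lemma real_polynomial_growth:
  fixes p :: "'a::real_normed_vector \<Rightarrow> real"
  assumes "real_polynomial_function p"
  shows "\<exists>C\<ge>0. \<exists>k. \<forall>x. \<bar>p x\<bar> \<le> C * (1 + norm x) ^ k"
  using assms
proof induction
  case (linear f)
  obtain K where K: "K > 0" "\<And>x. norm (f x) \<le> norm x * K"
    using bounded_linear.pos_bounded[OF linear] by blast
  have "\<bar>f x\<bar> \<le> K * (1 + norm x) ^ 1" for x
    using K(2)[of x] K(1) by (simp add: algebra_simps)
  with K(1) show ?case by (meson less_imp_le)
next
  case (const c)
  have "\<bar>c\<bar> \<le> \<bar>c\<bar> * (1 + norm x) ^ 0" for x :: 'a by simp
  then show ?case using abs_ge_zero by blast
next
  case (add f g)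
  then obtain C D k l where C: "C \<ge> 0" "D \<ge> 0" and b: "\<And>x. \<bar>f x\<bar> \<le> C * (1 + norm x) ^ k"
    "\<And>x. \<bar>g x\<bar> \<le> D * (1 + norm x) ^ l" by blast
  have "\<bar>f x + g x\<bar> \<le> (C + D) * (1 + norm x) ^ (k + l)" for x
  proof -
    have "(1 + norm x) ^ k \<le> (1 + norm x) ^ (k + l)" "(1 + norm x) ^ l \<le> (1 + norm x) ^ (k + l)"
      by (auto intro!: power_increasing)
    then have "C * (1 + norm x) ^ k \<le> C * (1 + norm x) ^ (k + l)"
      "D * (1 + norm x) ^ l \<le> D * (1 + norm x) ^ (k + l)"
      using C by (auto intro!: mult_left_mono)
    then show ?thesis using b[of x] by (simp add: distrib_right)
  qed
  then show ?case using C by (meson add_nonneg_nonneg)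
next
  case (mult f g)
  then obtain C D k l where C: "C \<ge> 0" "D \<ge> 0" and b: "\<And>x. \<bar>f x\<bar> \<le> C * (1 + norm x) ^ k"
    "\<And>x. \<bar>g x\<bar> \<le> D * (1 + norm x) ^ l" by blast
  have "\<bar>f x * g x\<bar> \<le> (C * D) * (1 + norm x) ^ (k + l)" for x
  proof -
    have "\<bar>f x\<bar> * \<bar>g x\<bar> \<le> (C * (1 + norm x) ^ k) * (D * (1 + norm x) ^ l)"
      using b C by (intro mult_mono) auto
    then show ?thesis by (simp add: abs_mult power_add ac_simps)
  qed
  then show ?case using C by (meson mult_nonneg_nonneg)
qed

text \<open>
  From \<open>y \<le> exp y\<close> at \<open>y = c * r\<^sup>2 / (N + 1)\<close>, raised to the power \<open>N\<close>.
\<close>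

lemma power_exp_bound:
  fixes r c :: real
  assumes r: "0 \<le> r" and c: "c > 0"
  shows "(1 + r) ^ N * exp (- c * r\<^sup>2) \<le> 2 ^ N * (1 + (real (Suc N) / c) ^ N)"
proof -
  have "(1 + r) ^ N \<le> (2 * max 1 r) ^ N"
    using r by (intro power_mono) auto
  also have "\<dots> = 2 ^ N * max 1 r ^ N" by (simp add: power_mult_distrib)
  also have "max 1 r ^ N \<le> 1 + (r\<^sup>2) ^ N"
  proof (cases "r \<le> 1")
    case False
    then have "r ^ N \<le> (r\<^sup>2) ^ N" by (intro power_mono) (auto simp: power2_eq_square)
    then show ?thesis using False by (simp add: max_def)
  qed (simp add: max_def)
  also have "(r\<^sup>2) ^ N \<le> (real (Suc N) / c) ^ N * exp (c * r\<^sup>2)"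
  proof -
    have "c * r\<^sup>2 / Suc N \<le> exp (c * r\<^sup>2 / Suc N)"
      using exp_ge_add_one_self[of "c * r\<^sup>2 / Suc N"] by linarith
    then have "(c * r\<^sup>2 / Suc N) ^ N \<le> exp (c * r\<^sup>2 / Suc N) ^ N"
      using c by (intro power_mono) auto
    also have "\<dots> = exp (real N * (c * r\<^sup>2 / Suc N))" by (simp only: exp_of_nat_mult)
    also have "\<dots> \<le> exp (c * r\<^sup>2)"
      using c by (simp add: field_simps)
    finally have "(c / Suc N) ^ N * (r\<^sup>2) ^ N \<le> exp (c * r\<^sup>2)"
      by (simp add: power_mult_distrib power_divide)
    then have "(Suc N / c) ^ N * ((c / Suc N) ^ N * (r\<^sup>2) ^ N) \<le> (Suc N / c) ^ N * exp (c * r\<^sup>2)"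
      using c by (intro mult_left_mono) auto
    moreover have "(Suc N / c) ^ N * ((c / Suc N) ^ N * (r\<^sup>2) ^ N) = (r\<^sup>2) ^ N"
      using c unfolding mult.assoc[symmetric] power_mult_distrib[symmetric] by simp
    ultimately show ?thesis by (simp only:)
  qed
  finally have "(1 + r) ^ N \<le> 2 ^ N * (1 + (real (Suc N) / c) ^ N * exp (c * r\<^sup>2))" by simp
  also have "\<dots> \<le> 2 ^ N * (exp (c * r\<^sup>2) + (real (Suc N) / c) ^ N * exp (c * r\<^sup>2))"
    using c by (intro mult_left_mono add_right_mono) auto
  finally have "(1 + r) ^ N \<le> 2 ^ N * (1 + (real (Suc N) / c) ^ N) * exp (c * r\<^sup>2)"
    by (simp add: algebra_simps)
  then have "(1 + r) ^ N * exp (- (c * r\<^sup>2)) \<le> 2 ^ N * (1 + (real (Suc N) / c) ^ N) * exp (c * r\<^sup>2) * exp (- (c * r\<^sup>2))"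
    by (rule mult_right_mono) simp
  then show ?thesis by (simp add: mult.assoc exp_minus_inverse)
qed

text \<open>
  All derivatives of \<open>exp (- q x)\<close> are of the form \<open>p x * exp (- q x)\<close> with \<open>p\<close> polynomial. So every
  seminorm is a bound for polynomial growth against a Gaussian.
\<close>

lemma schwartz_exp_polynomial:
  fixes q :: "'a::euclidean_space \<Rightarrow> real"
  assumes q: "real_polynomial_function q" and c: "c > 0" and qc: "\<And>x. c * (norm x)\<^sup>2 - d \<le> q x"
  shows "schwartz (\<lambda>x. of_real (exp (- q x)))"
proof -
  let ?f = "\<lambda>p x. complex_of_real (p x * exp (- q x))"
  have step: "\<exists>p'. real_polynomial_function p' \<and> (\<forall>x. ?f p differentiable (at x) \<and>
      frechet_derivative (?f p) (at x) v = ?f p' x)" if p: "real_polynomial_function p" for p v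
  proof -
    obtain p' q' where P: "real_polynomial_function p'" "real_polynomial_function q'"
      and dp: "\<And>x. \<exists>D. (p has_derivative D) (at x) \<and> D v = p' x"
      and dq: "\<And>x. \<exists>D. (q has_derivative D) (at x) \<and> D v = q' x"
      using real_polynomial_directional_derivative[OF p, of v]
        real_polynomial_directional_derivative[OF q, of v] by blast
    have "?f p differentiable (at x) \<and> frechet_derivative (?f p) (at x) v
        = ?f (\<lambda>x. p' x - p x * q' x) x" for x
    proof -
      from dp[of x] dq[of x] obtain D E where D: "(p has_derivative D) (at x)" "D v = p' x"
        "(q has_derivative E) (at x)" "E v = q' x" by blast
      have "(?f p has_derivative (\<lambda>h. of_real (p x * (exp (- q x) * (- E h)) + D h * exp (- q x)))) (at x)"
        using D by (auto intro!: derivative_eq_intros has_derivative_of_real)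
      then have "?f p differentiable (at x)"
        "frechet_derivative (?f p) (at x) = (\<lambda>h. of_real (p x * (exp (- q x) * (- E h)) + D h * exp (- q x)))"
        by (auto simp: differentiable_def frechet_derivative_at[symmetric])
      then show ?thesis using D by (simp add: algebra_simps)
    qed
    moreover have "real_polynomial_function (\<lambda>x. p' x - p x * q' x)"
      using P p by auto
    ultimately show ?thesis by blast
  qed
  have it: "\<exists>p. real_polynomial_function p \<and> iterated_derivative vs (\<lambda>x. of_real (exp (- q x))) = ?f p" for vs
  proof (induction vs)
    case Nil
    show ?case by (intro exI[of _ "\<lambda>_. 1"]) auto
  next
    case (Cons v vs)
    then obtain p where p: "real_polynomial_function p"
      "iterated_derivative vs (\<lambda>x. of_real (exp (- q x))) = ?f p" by blast
    from step[OF p(1), of v] obtain p' where "real_polynomial_function p'"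
      "\<forall>x. frechet_derivative (?f p) (at x) v = ?f p' x" by blast
    then show ?case unfolding iterated_derivative.simps p(2) by blast
  qed
  show ?thesis
    unfolding schwartz_def
  proof (intro allI impI conjI)
    fix vs :: "'a list" and x :: 'a and k :: nat
    obtain p where p: "real_polynomial_function p"
      "iterated_derivative vs (\<lambda>x. of_real (exp (- q x))) = ?f p" using it by blast
    show "iterated_derivative vs (\<lambda>x. of_real (exp (- q x))) differentiable at x"
      unfolding p(2) using step[OF p(1)] by blast
    obtain C l where C: "C \<ge> 0" "\<And>x. \<bar>p x\<bar> \<le> C * (1 + norm x) ^ l"
      using real_polynomial_growth[OF p(1)] by blast
    have "norm (norm x ^ k *\<^sub>R ?f p x) \<le> C * exp d * (2 ^ (k + l) * (1 + (real (Suc (k + l)) / c) ^ (k + l)))" for x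
    proof -
      have "norm (norm x ^ k *\<^sub>R ?f p x) = norm x ^ k * \<bar>p x\<bar> * exp (- q x)"
        by (simp only: norm_scaleR norm_of_real abs_mult abs_exp_cancel power_abs abs_norm_cancel mult.assoc)
      also have "\<dots> \<le> ((1 + norm x) ^ k * (C * (1 + norm x) ^ l)) * exp (d - c * (norm x)\<^sup>2)"
        using C qc[of x] by (intro mult_mono power_mono) auto
      also have "\<dots> = C * exp d * ((1 + norm x) ^ (k + l) * exp (- c * (norm x)\<^sup>2))"
        by (simp add: exp_diff exp_minus power_add field_simps)
      also have "\<dots> \<le> C * exp d * (2 ^ (k + l) * (1 + (real (Suc (k + l)) / c) ^ (k + l)))"
        using C c by (intro mult_left_mono power_exp_bound) auto
      finally show ?thesis .
    qed
    then show "bounded (range (\<lambda>x. norm x ^ k *\<^sub>R iterated_derivative vs (\<lambda>x. of_real (exp (- q x))) x))"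
      unfolding p(2) by (intro boundedI) auto
  qed
qed

lemma AE_not_hyperplane:
  fixes k :: "'a::euclidean_space"
  assumes "k \<in> Basis"
  shows "AE x in lborel. x \<bullet> k \<noteq> c"
proof -
  have "negligible {x. x \<bullet> k = c}" using assms by (rule negligible_standard_hyperplane)
  moreover have "{x. x \<bullet> k = c} \<in> sets lborel"
    by (simp add: closed_hyperplane inner_commute borel_closed)
  ultimately have "{x. x \<bullet> k = c} \<in> null_sets lborel"
    by (simp add: negligible_iff_null_sets null_sets_completion_iff)
  then show ?thesis by (auto dest: AE_not_in)
qed

text \<open>
  Membership in the closure of the Schwartz functions in \<open>L\<^sup>1\<close>.
\<close>

definition l1_schwartz_limit :: "('a::euclidean_space \<Rightarrow> complex) \<Rightarrow> bool" where
  "l1_schwartz_limit f \<longleftrightarrow> integrable lborel f \<and>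
    (\<forall>e>0. \<exists>g. schwartz g \<and> (\<integral>x. cmod (f x - g x) \<partial>lborel) < e)"

lemma l1_schwartz_limitI:
  assumes f: "integrable lborel f"
    and int: "\<And>k::nat. integrable lborel (s k)" and s: "\<And>k. l1_schwartz_limit (s k)"
    and lim: "AE x in lborel. (\<lambda>k. s k x) \<longlonglongrightarrow> f x" and w: "integrable lborel w"
    and bd: "\<And>k. AE x in lborel. cmod (s k x) \<le> w x"
  shows "l1_schwartz_limit f"
  unfolding l1_schwartz_limit_def
proof (intro conjI f allI impI)
  fix e :: real assume e: "e > 0"
  have [measurable]: "f \<in> borel_measurable borel" "\<And>k. s k \<in> borel_measurable borel"
    using f int by auto
  have "(\<lambda>k. \<integral>x. cmod (f x - s k x) \<partial>lborel) \<longlonglongrightarrow> (\<integral>x. 0 \<partial>(lborel :: 'a measure))"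
  proof (rule integral_dominated_convergence[where w = "\<lambda>x. cmod (f x) + w x"])
    show "AE x in lborel. (\<lambda>k. cmod (f x - s k x)) \<longlonglongrightarrow> 0"
      using lim
    proof eventually_elim
      case (elim x)
      then have "(\<lambda>k. cmod (f x - s k x)) \<longlonglongrightarrow> cmod (f x - f x)" by (intro tendsto_intros)
      then show ?case by simp
    qed
    show "AE x in lborel. norm (cmod (f x - s k x)) \<le> cmod (f x) + w x" for k
      using bd[of k]
    proof eventually_elim
      case (elim x)
      then show ?case using norm_triangle_ineq4[of "f x" "s k x"] by simp
    qed
  qed (use f w in auto)
  then have "(\<lambda>k. \<integral>x. cmod (f x - s k x) \<partial>lborel) \<longlonglongrightarrow> 0" by simp
  then have "\<forall>\<^sub>F k in sequentially. (\<integral>x. cmod (f x - s k x) \<partial>lborel) < e / 2"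
    by (rule order_tendstoD(2)) (use e in simp)
  then obtain k where k: "(\<integral>x. cmod (f x - s k x) \<partial>lborel) < e / 2"
    by (auto simp: eventually_sequentially)
  obtain g where g: "schwartz g" "(\<integral>x. cmod (s k x - g x) \<partial>lborel) < e / 2"
    using s[of k] e unfolding l1_schwartz_limit_def by (meson half_gt_zero)
  note ig = tameD(2)[OF schwartz_tame[OF g(1)]]
  have "(\<integral>x. cmod (f x - g x) \<partial>lborel) \<le> (\<integral>x. cmod (f x - s k x) + cmod (s k x - g x) \<partial>lborel)"
  proof (rule integral_mono)
    show "cmod (f x - g x) \<le> cmod (f x - s k x) + cmod (s k x - g x)" for x
      using norm_triangle_ineq[of "f x - s k x" "s k x - g x"] by simp
  qed (use f int ig in auto)
  also have "\<dots> = (\<integral>x. cmod (f x - s k x) \<partial>lborel) + (\<integral>x. cmod (s k x - g x) \<partial>lborel)"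
    using f int ig by (intro Bochner_Integration.integral_add) auto
  also have "\<dots> < e" using k g by simp
  finally show "\<exists>g. schwartz g \<and> (\<integral>x. cmod (f x - g x) \<partial>lborel) < e" using g(1) by blast
qed

lemma l1_schwartz_limit_schwartz: "schwartz f \<Longrightarrow> l1_schwartz_limit f"
  unfolding l1_schwartz_limit_def using tameD(2)[OF schwartz_tame] by (auto intro!: exI[of _ f])

lemma l1_schwartz_limit_diff_scale:
  assumes f: "l1_schwartz_limit f" and g: "l1_schwartz_limit g"
  shows "l1_schwartz_limit (\<lambda>x. f x - c * g x)"
  unfolding l1_schwartz_limit_def
proof (intro conjI allI impI)
  have int: "integrable lborel f" "integrable lborel g"
    using f g by (auto simp: l1_schwartz_limit_def)
  then show "integrable lborel (\<lambda>x. f x - c * g x)" by simp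
  fix e :: real assume e: "e > 0"
  define d where "d = e / (2 * (1 + cmod c))"
  have p: "1 + cmod c > 0" by (simp add: add_pos_nonneg)
  have d: "d > 0" using e p by (simp add: d_def)
  obtain F where F: "schwartz F" "(\<integral>x. cmod (f x - F x) \<partial>lborel) < d"
    using f d by (auto simp: l1_schwartz_limit_def)
  obtain G where G: "schwartz G" "(\<integral>x. cmod (g x - G x) \<partial>lborel) < d"
    using g d by (auto simp: l1_schwartz_limit_def)
  note iFG = tameD(2)[OF schwartz_tame[OF F(1)]] tameD(2)[OF schwartz_tame[OF G(1)]]
  have "(\<integral>x. cmod ((f x - c * g x) - (F x - c * G x)) \<partial>lborel)
      \<le> (\<integral>x. cmod (f x - F x) + cmod c * cmod (g x - G x) \<partial>lborel)"
  proof (rule integral_mono)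
    fix x
    have "(f x - c * g x) - (F x - c * G x) = (f x - F x) - c * (g x - G x)" by (simp add: algebra_simps)
    then show "cmod ((f x - c * g x) - (F x - c * G x)) \<le> cmod (f x - F x) + cmod c * cmod (g x - G x)"
      using norm_triangle_ineq4[of "f x - F x" "c * (g x - G x)"] unfolding norm_mult by metis
  qed (use int iFG in auto)
  also have "\<dots> = (\<integral>x. cmod (f x - F x) \<partial>lborel) + cmod c * (\<integral>x. cmod (g x - G x) \<partial>lborel)"
    using int iFG by simp
  also have "\<dots> \<le> d + cmod c * d"
    using F(2) G(2) by (intro add_mono mult_left_mono) auto
  also have "\<dots> = (1 + cmod c) * d" by (simp only: distrib_right mult_1)
  also have "\<dots> = e / 2"
  proof -
    have "p * (e / (2 * p)) = e / 2" if "p > 0" for p :: real using that by simp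
    from this[OF p] show ?thesis by (simp only: d_def)
  qed
  also have "\<dots> < e" using e by simp
  finally show "\<exists>g'. schwartz g' \<and> (\<integral>x. cmod ((f x - c * g x) - g' x) \<partial>lborel) < e"
    using schwartz_diff_scale[OF F(1) G(1)] by blast
qed

lemma l1_schwartz_limit_zero: "l1_schwartz_limit (\<lambda>_ :: 'a::euclidean_space. 0)"
proof -
  have "schwartz (\<lambda>x::'a. of_real (exp (- (x \<bullet> x))))"
  proof (rule schwartz_exp_polynomial[where c = 1 and d = 0])
    have "(\<lambda>x::'a. x \<bullet> x) = (\<lambda>x. \<Sum>b\<in>Basis. (x \<bullet> b) * (x \<bullet> b))"
      by (subst euclidean_inner) simp
    then show "real_polynomial_function (\<lambda>x::'a. x \<bullet> x)"
      by (simp only:) (intro real_polynomial_function_sum real_polynomial_function.intros(4)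
        real_polynomial_function.intros(1) bounded_linear_inner_left finite_Basis)
  qed (auto simp: power2_norm_eq_inner)
  then have l: "l1_schwartz_limit (\<lambda>x::'a. of_real (exp (- (x \<bullet> x))))"
    by (rule l1_schwartz_limit_schwartz)
  from l1_schwartz_limit_diff_scale[OF l l, of 1] show ?thesis by simp
qed

lemma l1_schwartz_limit_scale:
  "l1_schwartz_limit f \<Longrightarrow> l1_schwartz_limit (\<lambda>x :: 'a::euclidean_space. c * f x)"
  using l1_schwartz_limit_diff_scale[OF l1_schwartz_limit_zero, of f "- c"] by simp

lemma l1_schwartz_limit_add:
  "l1_schwartz_limit f \<Longrightarrow> l1_schwartz_limit g \<Longrightarrow>
    l1_schwartz_limit (\<lambda>x :: 'a::euclidean_space. f x + g x)"
  using l1_schwartz_limit_diff_scale[of f g "-1"] by simp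

lemma integrable_indicator_complex:
  fixes A :: "'a::euclidean_space set"
  assumes "A \<in> sets borel" "emeasure lborel A < \<infinity>"
  shows "integrable lborel (indicator A :: 'a \<Rightarrow> complex)"
proof -
  have "integrable lborel (\<lambda>x. complex_of_real (indicator A x))"
    using assms by (intro integrable_of_real integrable_real_indicator) auto
  moreover have "(\<lambda>x. complex_of_real (indicator A x)) = indicator A"
    by (auto simp: indicator_def)
  ultimately show ?thesis by simp
qed

text \<open>
  Let \<open>s b\<close> be the affine coordinates that carry the box onto the cube \<open>\<bar>s b\<bar> < 1\<close>. The Schwartz
  functions \<open>exp (- (\<Sum>b\<in>Basis. s b x ^ (2 * (N + 1))))\<close> tend to \<open>1\<close> inside the box and to \<open>0\<close> outside its
  closure. The one with exponent \<open>2\<close>, times a constant, dominates them all since \<open>t\<^sup>2 - 1 \<le> t ^ (2 * (N + 1))\<close>.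
\<close>

lemma l1_schwartz_limit_box:
  fixes l u :: "'a::euclidean_space"
  shows "l1_schwartz_limit (indicator (box l u) :: 'a \<Rightarrow> complex)"
proof (cases "box l u = {}")
  case True
  then show ?thesis using l1_schwartz_limit_zero[where 'a='a] by (simp add: indicator_def[abs_def])
next
  case False
  then have lu: "l \<bullet> b < u \<bullet> b" if "b \<in> Basis" for b using that by (simp add: box_ne_empty)
  define r where "r b = (u \<bullet> b - l \<bullet> b) / 2" for b
  define s where "s b x = (x \<bullet> b - (u \<bullet> b + l \<bullet> b) / 2) / r b" for b x
  have r: "r b > 0" if "b \<in> Basis" for b using lu[OF that] by (simp add: r_def)
  define q where "q N x = (\<Sum>b\<in>Basis. s b x ^ (2 * Suc N))" for N x
  define f where "f N x = complex_of_real (exp (- q N x))" for N x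
  have sbox: "\<bar>s b x\<bar> < 1 \<longleftrightarrow> l \<bullet> b < x \<bullet> b \<and> x \<bullet> b < u \<bullet> b" if "b \<in> Basis" for b x
    using r[OF that] by (simp add: s_def abs_less_iff r_def field_simps) linarith
  have sbd: "\<bar>s b x\<bar> = 1 \<longrightarrow> x \<bullet> b = l \<bullet> b \<or> x \<bullet> b = u \<bullet> b" if "b \<in> Basis" for b x
    using r[OF that] by (auto simp: s_def abs_if r_def field_simps split: if_splits)
  have pow: "(s b x)\<^sup>2 - 1 \<le> s b x ^ (2 * Suc N)" for b x N
  proof (cases "\<bar>s b x\<bar> \<le> 1")
    case True
    then have "(s b x)\<^sup>2 \<le> 1" by (simp add: abs_square_le_1)
    moreover have "0 \<le> s b x ^ (2 * Suc N)" by (simp only: zero_le_even_power even_mult_iff even_numeral simp_thms)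
    ultimately show ?thesis by linarith
  next
    case False
    then have "1 \<le> (s b x)\<^sup>2" by (simp add: abs_square_le_1 not_le less_imp_le abs_square_less_1[symmetric] linorder_not_le) (metis abs_square_less_1 linorder_not_le less_imp_le)
    then have "((s b x)\<^sup>2) ^ 1 \<le> ((s b x)\<^sup>2) ^ Suc N" by (intro power_increasing) auto
    then show ?thesis by (simp only: power_mult) simp
  qed
  obtain R where R: "R > 0" "\<And>b. b \<in> Basis \<Longrightarrow> r b \<le> R"
  proof
    show "1 + (\<Sum>b\<in>Basis. r b) > 0" using r by (intro add_pos_nonneg sum_nonneg) (auto intro: less_imp_le)
    show "r b \<le> 1 + (\<Sum>b\<in>Basis. r b)" if "b \<in> Basis" for b
      using member_le_sum[OF that, of r] r by (fastforce intro: less_imp_le)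
  qed
  let ?c = "(1 / 2) *\<^sub>R (u + l)"
  have sc: "s b x = (x - ?c) \<bullet> b / r b" for b x
    by (simp add: s_def inner_diff_left inner_add_left)
  have qlow: "1 / (2 * R\<^sup>2) * (norm x)\<^sup>2 - ((norm ?c)\<^sup>2 / R\<^sup>2 + DIM('a)) \<le> q N x" for N x
  proof -
    have "(norm x)\<^sup>2 \<le> (norm (x - ?c) + norm ?c)\<^sup>2"
      using norm_triangle_ineq[of "x - ?c" ?c] by (intro power_mono) auto
    also have "\<dots> \<le> 2 * (norm (x - ?c))\<^sup>2 + 2 * (norm ?c)\<^sup>2"
      using sum_squares_bound[of "norm (x - ?c)" "norm ?c"] by (simp add: power2_sum)
    finally have "1 / (2 * R\<^sup>2) * (norm x)\<^sup>2 \<le> 1 / (2 * R\<^sup>2) * (2 * (norm (x - ?c))\<^sup>2 + 2 * (norm ?c)\<^sup>2)"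
      by (rule mult_left_mono) simp
    then have 1: "1 / (2 * R\<^sup>2) * (norm x)\<^sup>2 - (norm ?c)\<^sup>2 / R\<^sup>2 \<le> (norm (x - ?c))\<^sup>2 / R\<^sup>2"
      by (simp only: distrib_left) simp
    have "(norm (x - ?c))\<^sup>2 / R\<^sup>2 = (\<Sum>b\<in>Basis. ((x - ?c) \<bullet> b)\<^sup>2 / R\<^sup>2)"
      unfolding power2_norm_eq_inner by (subst euclidean_inner) (simp add: power2_eq_square sum_divide_distrib)
    also have "\<dots> \<le> (\<Sum>b\<in>Basis. (s b x)\<^sup>2)"
      unfolding sc power_divide
      by (intro sum_mono divide_left_mono power_mono) (use r R in \<open>auto intro!: mult_pos_pos zero_less_power intro: less_imp_le\<close>)
    also have "\<dots> \<le> (\<Sum>b\<in>Basis. s b x ^ (2 * Suc N) + 1)"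
      by (intro sum_mono) (use pow in \<open>simp add: le_diff_eq algebra_simps\<close>)
    also have "\<dots> = q N x + DIM('a)" by (simp add: q_def sum.distrib)
    finally show ?thesis using 1 by linarith
  qed
  have sch: "schwartz (f N)" for N
    unfolding f_def[abs_def]
  proof (rule schwartz_exp_polynomial[OF _ _ qlow])
    have "real_polynomial_function (s b)" for b
      unfolding s_def[abs_def] by (intro real_polynomial_function_divide real_polynomial_function_diff
        real_polynomial_function.intros(1) real_polynomial_function.intros(2) bounded_linear_inner_left)
    then show "real_polynomial_function (q N)"
      unfolding q_def[abs_def] by (intro real_polynomial_function_sum real_polynomial_function_power) auto
  qed (use R in simp)
  show ?thesis
  proof (rule l1_schwartz_limitI[where s = f])
    show "integrable lborel (indicator (box l u) :: 'a \<Rightarrow> complex)"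
      by (intro integrable_indicator_complex emeasure_lborel_box_finite) auto
    show "integrable lborel (f N)" for N by (rule tameD(2)[OF schwartz_tame[OF sch]])
    then show "integrable lborel (\<lambda>x. exp (real DIM('a)) * cmod (f 0 x))" by auto
    show "l1_schwartz_limit (f N)" for N by (rule l1_schwartz_limit_schwartz[OF sch])
    show "AE x in lborel. cmod (f N x) \<le> exp (real DIM('a)) * cmod (f 0 x)" for N
    proof (rule AE_I2)
      fix x
      have "q 0 x - DIM('a) = (\<Sum>b\<in>Basis. (s b x)\<^sup>2 - 1)"
        by (simp add: q_def sum_subtractf power2_eq_square)
      also have "\<dots> \<le> q N x" unfolding q_def by (intro sum_mono pow)
      finally have "- q N x \<le> real DIM('a) + - q 0 x" by simp
      then have "exp (- q N x) \<le> exp (real DIM('a) + - q 0 x)" by (simp only: exp_le_cancel_iff)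
      also have "\<dots> = exp (real DIM('a)) * exp (- q 0 x)" by (rule exp_add)
      finally show "cmod (f N x) \<le> exp (real DIM('a)) * cmod (f 0 x)" by (simp add: f_def)
    qed
    have "AE x in lborel. \<forall>b\<in>Basis. x \<bullet> b \<noteq> l \<bullet> b \<and> x \<bullet> b \<noteq> u \<bullet> b"
      by (intro AE_finite_allI AE_conjI AE_not_hyperplane) auto
    then show "AE x in lborel. (\<lambda>N. f N x) \<longlonglongrightarrow> indicator (box l u) x"
    proof eventually_elim
      case (elim x)
      then have s1: "\<bar>s b x\<bar> \<noteq> 1" if "b \<in> Basis" for b using sbd that by blast
      show ?case
      proof (cases "x \<in> box l u")
        case True
        then have "\<bar>s b x\<bar> < 1" if "b \<in> Basis" for b
          using sbox[OF that] that by (auto simp: mem_box)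
        then have "(\<lambda>N. (s b x)\<^sup>2 ^ Suc N) \<longlonglongrightarrow> 0" if "b \<in> Basis" for b
          using that by (intro LIMSEQ_Suc LIMSEQ_realpow_zero) (auto simp: abs_square_less_1)
        then have "(\<lambda>N. q N x) \<longlonglongrightarrow> (\<Sum>b\<in>(Basis::'a set). 0)"
          unfolding q_def power_mult by (intro tendsto_sum) auto
        then have "(\<lambda>N. f N x) \<longlonglongrightarrow> of_real (exp (- (\<Sum>b\<in>(Basis::'a set). 0)))"
          unfolding f_def by (intro tendsto_intros)
        then show ?thesis using True by simp
      next
        case False
        then obtain b where b: "b \<in> Basis" "\<not> \<bar>s b x\<bar> < 1"
          using sbox by (auto simp: mem_box)
        with s1 have "1 < (s b x)\<^sup>2" by (metis abs_square_less_1 abs_square_eq_1 linorder_neqE_linordered_idom)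
        have pow_top: "filterlim (\<lambda>N. a ^ N) at_top sequentially" if "1 < a" for a :: real
        proof (rule filterlim_at_infinity_imp_filterlim_at_top)
          show "filterlim (\<lambda>N. a ^ N) at_infinity sequentially"
            using that by (intro filterlim_realpow_sequentially_gt1) simp
          show "\<forall>\<^sub>F N in sequentially. 0 < a ^ N"
            using that by simp
        qed
        have "filterlim (\<lambda>N. (s b x)\<^sup>2 ^ N) at_top sequentially"
          by (rule pow_top[OF \<open>1 < (s b x)\<^sup>2\<close>])
        then have "filterlim (\<lambda>N. (s b x)\<^sup>2 ^ Suc N) at_top sequentially"
          by (rule filterlim_compose) (rule filterlim_Suc)
        then have "filterlim (\<lambda>N. q N x) at_top sequentially"
        proof (rule filterlim_at_top_mono)
          show "\<forall>\<^sub>F N in sequentially. (s b x)\<^sup>2 ^ Suc N \<le> q N x"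
            unfolding q_def power_mult
            by (intro always_eventually allI member_le_sum[where f = "\<lambda>b. (s b x)\<^sup>2 ^ Suc N" for N]) (use b in auto)
        qed
        then have "(\<lambda>N. exp (- q N x)) \<longlonglongrightarrow> 0"
          by (intro filterlim_compose[OF exp_at_bot] filterlim_uminus_at_bot_at_top[THEN filterlim_compose])
        then have "(\<lambda>N. f N x) \<longlonglongrightarrow> of_real 0"
          unfolding f_def by (intro tendsto_of_real)
        then show ?thesis using False by simp
      qed
    qed
  qed
qed

text \<open>
  Within a bounded box the measurable sets whose indicator functions lie in the closure form a Dynkin
  system that contains all boxes. Unbounded sets of finite measure are exhausted by their parts in
  larger and larger boxes.
\<close>

lemma l1_schwartz_limit_indicator:
  fixes A :: "'a::euclidean_space set"
  assumes A: "A \<in> sets borel" and fin: "emeasure lborel A < \<infinity>"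
  shows "l1_schwartz_limit (indicator A :: 'a \<Rightarrow> complex)"
proof -
  define B where "B k = (box (- real k *\<^sub>R One) (real k *\<^sub>R One) :: 'a set)" for k :: nat
  have Bfin: "emeasure lborel (C \<inter> B k) < \<infinity>" if "C \<in> sets borel" for C k
  proof -
    have "emeasure lborel (C \<inter> B k) \<le> emeasure lborel (B k)"
      using that by (intro emeasure_mono) (auto simp: B_def)
    also have "\<dots> < \<infinity>" unfolding B_def by (rule emeasure_lborel_box_finite)
    finally show ?thesis .
  qed
  have Bs: "C \<inter> B k \<in> sets borel" if "C \<in> sets borel" for C k
    using that by (auto simp: B_def)
  have Bint: "integrable lborel (indicator (C \<inter> B k) :: 'a \<Rightarrow> complex)"
      "integrable lborel (indicator (C \<inter> B k) :: 'a \<Rightarrow> real)" if "C \<in> sets borel" for C k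
    using Bfin[OF that] Bs[OF that] by (auto intro: integrable_indicator_complex integrable_real_indicator)
  have in_ball: "l1_schwartz_limit (indicator (C \<inter> B k) :: 'a \<Rightarrow> complex)" if C: "C \<in> sets borel" for C k
  proof -
    let ?G = "range (\<lambda>(a, b). box a b :: 'a set)"
    have "Int_stable ?G" by (auto simp: Int_stable_def box_Int_box)
    moreover have "?G \<subseteq> Pow UNIV" by simp
    moreover have "C \<in> sigma_sets UNIV ?G" using C unfolding borel_eq_box by simp
    ultimately show ?thesis
    proof (induction rule: sigma_sets_induct_disjoint)
      case (basic C)
      then show ?case by (auto simp: B_def box_Int_box l1_schwartz_limit_box)
    next
      case empty
      then show ?case using l1_schwartz_limit_zero[where 'a='a] by (simp add: indicator_def[abs_def])
    next
      case (compl C)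
      have "indicator ((UNIV - C) \<inter> B k) = (\<lambda>x. indicator (B k) x - 1 * indicator (C \<inter> B k) x :: complex)"
        by (auto simp: fun_eq_iff indicator_def)
      then show ?case
        using l1_schwartz_limit_diff_scale[OF l1_schwartz_limit_box compl(2), of _ _ 1]
        by (simp only: B_def)
    next
      case (union D)
      have D: "D i \<in> sets borel" for i using union(2) unfolding borel_eq_box by auto
      show ?case
      proof (rule l1_schwartz_limitI[where s = "\<lambda>n x. \<Sum>i<n. indicator (D i \<inter> B k) x"])
        show "integrable lborel (indicator ((\<Union>i. D i) \<inter> B k) :: 'a \<Rightarrow> complex)"
          "integrable lborel (indicator ((\<Union>i. D i) \<inter> B k) :: 'a \<Rightarrow> real)"
          using D by (auto intro!: Bint)
        show "integrable lborel (\<lambda>x. \<Sum>i<n. indicator (D i \<inter> B k) x :: complex)" for n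
          using D by (intro Bochner_Integration.integrable_sum Bint) auto
        show "l1_schwartz_limit (\<lambda>x. \<Sum>i<n. indicator (D i \<inter> B k) x)" for n
          by (induction n) (auto intro: l1_schwartz_limit_zero l1_schwartz_limit_add union(3))
        have dis: "disjoint_family (\<lambda>i. D i \<inter> B k)"
          using union(1) by (auto simp: disjoint_family_on_def)
        have part: "(\<Sum>i<n. indicator (D i \<inter> B k) x) = (indicator (\<Union>i<n. D i \<inter> B k) x :: complex)" for n x
          using dis by (intro indicator_UN_disjoint[symmetric] disjoint_family_on_mono[OF _ dis]) auto
        show "AE x in lborel. (\<lambda>n. \<Sum>i<n. indicator (D i \<inter> B k) x) \<longlonglongrightarrow> (indicator ((\<Union>i. D i) \<inter> B k) x :: complex)"
        proof (rule AE_I2)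
          fix x
          have "(\<lambda>n. indicator (\<Union>i<n. D i \<inter> B k) x) \<longlonglongrightarrow> (indicator (\<Union>i. D i \<inter> B k) x :: complex)"
            by (rule LIMSEQ_indicator_UN)
          then show "(\<lambda>n. \<Sum>i<n. indicator (D i \<inter> B k) x) \<longlonglongrightarrow> (indicator ((\<Union>i. D i) \<inter> B k) x :: complex)"
            unfolding part by simp
        qed
        show "AE x in lborel. cmod (\<Sum>i<n. indicator (D i \<inter> B k) x) \<le> indicator ((\<Union>i. D i) \<inter> B k) x" for n
          unfolding part by (auto simp: indicator_def intro!: AE_I2)
      qed
    qed
  qed
  have ABI: "integrable lborel (indicator A :: 'a \<Rightarrow> complex)" "integrable lborel (indicator A :: 'a \<Rightarrow> real)"
    using A fin by (auto intro: integrable_indicator_complex integrable_real_indicator)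
  show ?thesis
  proof (rule l1_schwartz_limitI[where s = "\<lambda>k. indicator (A \<inter> B k)" and w = "indicator A"])
    show "AE x in lborel. (\<lambda>k. indicator (A \<inter> B k) x) \<longlonglongrightarrow> (indicator A x :: complex)"
    proof (rule AE_I2)
      fix x :: 'a
      obtain k0 :: nat where k0: "norm x < k0" using reals_Archimedean2 by blast
      have "x \<in> B k" if "k \<ge> k0" for k
      proof -
        have "\<bar>x \<bullet> b\<bar> < k" if "b \<in> Basis" for b
          using Basis_le_norm[OF that, of x] k0 \<open>k \<ge> k0\<close> by linarith
        then show ?thesis by (auto simp: B_def mem_box abs_less_iff) (metis minus_less_iff)
      qed
      then have "\<forall>\<^sub>F k in sequentially. indicator (A \<inter> B k) x = (indicator A x :: complex)"
        unfolding eventually_sequentially by (intro exI[of _ k0]) (auto simp: indicator_def)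
      then show "(\<lambda>k. indicator (A \<inter> B k) x) \<longlonglongrightarrow> (indicator A x :: complex)"
        by (rule tendsto_eventually)
    qed
    show "AE x in lborel. cmod (indicator (A \<inter> B k) x) \<le> indicator A x" for k
      by (auto simp: indicator_def intro!: AE_I2)
  qed (use A ABI Bint in_ball in auto)
qed

lemma schwartz_dense_l1:
  fixes f :: "'a::euclidean_space \<Rightarrow> complex"
  assumes "integrable lborel f" "e > 0"
  shows "\<exists>g. schwartz g \<and> (\<integral>x. cmod (f x - g x) \<partial>lborel) < e"
proof -
  have "l1_schwartz_limit f"
    using assms(1)
  proof (induction rule: integrable_induct)
    case (base A c)
    then have "l1_schwartz_limit (\<lambda>x. c * indicator A x)"
      by (intro l1_schwartz_limit_scale l1_schwartz_limit_indicator) auto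
    moreover have "(\<lambda>x. c * indicator A x) = (\<lambda>x. indicator A x *\<^sub>R c)"
      by (auto simp: indicator_def)
    ultimately show ?case by simp
  next
    case (add f g)
    then show ?case by (intro l1_schwartz_limit_add)
  next
    case (lim f s)
    show ?case
    proof (rule l1_schwartz_limitI[where s = s and w = "\<lambda>x. 2 * cmod (f x)"])
      show "integrable lborel (\<lambda>x. 2 * cmod (f x))" by (intro integrable_mult_right integrable_norm lim)
      show "AE x in lborel. (\<lambda>k. s k x) \<longlonglongrightarrow> f x" by (intro AE_I2 lim) simp
      show "AE x in lborel. cmod (s k x) \<le> 2 * cmod (f x)" for k by (intro AE_I2 lim) simp
    qed (rule lim)+
  qed
  with assms(2) show ?thesis by (auto simp: l1_schwartz_limit_def)
qed

section \<open>Approximation in the group algebra and in the Hilbert space\<close>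

lemma gelfand_minus: "gelfand (x - y) \<xi> = gelfand x \<xi> - gelfand (y :: 'a::euclidean_space group_cstar) \<xi>"
proof -
  have "gelfand (x - y + y) \<xi> = gelfand (x - y) \<xi> + gelfand y \<xi>" by (simp only: gelfand_add)
  then show ?thesis by simp
qed

lemma norm_group_cstar_le:
  "(\<And>\<xi>. cmod (gelfand x \<xi>) \<le> B) \<Longrightarrow> norm (x :: 'a::euclidean_space group_cstar) \<le> B"
  unfolding norm_group_cstar by (rule cSUP_least) auto

lemma l1_dense_cstar:
  fixes x :: "'a::euclidean_space group_cstar"
  assumes e: "e > 0"
  shows "\<exists>f. integrable lborel f \<and> norm (x - cstar_of_l1 f) < e"
proof -
  obtain X where X: "cstar_cauchy X" "gelfand x = fourier_lim X"
  proof -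
    have "cstar_rel (rep_group_cstar x) (rep_group_cstar x)"
      by (rule Quotient_rep_reflp[OF Quotient_group_cstar])
    then show ?thesis by (intro that[of "rep_group_cstar x"]) (auto simp: cstar_rel_iff gelfand.rep_eq)
  qed
  from uniform_limitD[OF uniform_limit_fourier_lim[OF X(1)], of "e / 2"] e
  obtain k where k: "\<And>\<xi>. dist (fourier (X k) \<xi>) (fourier_lim X \<xi>) < e / 2"
    by (auto simp: eventually_sequentially)
  note i = cstar_cauchy_integrable[OF X(1), of k]
  have "norm (x - cstar_of_l1 (X k)) \<le> e / 2"
    using k by (intro norm_group_cstar_le)
      (simp add: gelfand_minus gelfand_cstar_of_l1[OF i] X(2) dist_norm norm_minus_commute less_imp_le)
  with e have "norm (x - cstar_of_l1 (X k)) < e" by simp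
  with i show ?thesis by blast
qed

text \<open>
  It suffices to approximate in \<open>L\<^sup>1\<close>, whose norm dominates the norm of the group algebra.
\<close>

lemma schwartz_dense_cstar:
  fixes x :: "'a::euclidean_space group_cstar"
  assumes e: "e > 0"
  shows "\<exists>f. schwartz f \<and> norm (x - cstar_of_l1 f) < e"
proof -
  obtain f where f: "integrable lborel f" "norm (x - cstar_of_l1 f) < e / 2"
    using l1_dense_cstar[of "e / 2" x] e by auto
  obtain g where g: "schwartz g" "(\<integral>x. cmod (f x - g x) \<partial>lborel) < e / 2"
    using schwartz_dense_l1[OF f(1), of "e / 2"] e by auto
  note ig = tameD(2)[OF schwartz_tame[OF g(1)]]
  have "norm (cstar_of_l1 f - cstar_of_l1 g) \<le> (\<integral>x. cmod (f x - g x) \<partial>lborel)"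
  proof (rule norm_group_cstar_le)
    fix \<xi>
    show "cmod (gelfand (cstar_of_l1 f - cstar_of_l1 g) \<xi>) \<le> (\<integral>x. cmod (f x - g x) \<partial>lborel)"
      using norm_fourier_le[of "\<lambda>x. f x - g x" \<xi>] f(1) ig
      by (simp add: gelfand_minus gelfand_cstar_of_l1 fourier_diff)
  qed
  then have "norm ((x - cstar_of_l1 f) + (cstar_of_l1 f - cstar_of_l1 g)) < e"
    using f(2) g(2) by (intro norm_triangle_lt) linarith
  then show ?thesis using g(1) by auto
qed

lemma continuous_gelfand:
  "continuous_on UNIV (gelfand (x :: 'a::euclidean_space group_cstar))"
proof -
  have "\<forall>n. \<exists>f. integrable lborel f \<and> norm (x - cstar_of_l1 f) < inverse (real (Suc n))"
    by (intro allI l1_dense_cstar) simp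
  then obtain f where f: "\<And>n. integrable lborel (f n)"
    "\<And>n. norm (x - cstar_of_l1 (f n)) < inverse (real (Suc n))" by metis
  have "uniform_limit UNIV (\<lambda>n. fourier (f n)) (gelfand x) sequentially"
  proof (rule uniform_limitI)
    fix e :: real assume "e > 0"
    then have "\<forall>\<^sub>F n in sequentially. inverse (real (Suc n)) < e"
      using order_tendstoD(2)[OF LIMSEQ_inverse_real_of_nat] by blast
    then show "\<forall>\<^sub>F n in sequentially. \<forall>\<xi>\<in>UNIV. dist (fourier (f n) \<xi>) (gelfand x \<xi>) < e"
    proof eventually_elim
      case (elim n)
      have "cmod (gelfand x \<xi> - fourier (f n) \<xi>) \<le> norm (x - cstar_of_l1 (f n))" for \<xi>
        using norm_gelfand_le[of "x - cstar_of_l1 (f n)" \<xi>]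
        by (simp add: gelfand_minus gelfand_cstar_of_l1 f(1))
      then show ?case using f(2)[of n] elim
        by (auto simp: dist_norm norm_minus_commute intro: le_less_trans less_trans)
    qed
  qed
  then show ?thesis
    by (rule uniform_limit_theorem[rotated]) (auto intro!: always_eventually continuous_fourier f(1))
qed

lemma gelfand_involution:
  "gelfand (involution x) = (\<lambda>\<xi>. cnj (gelfand (x :: 'a::euclidean_space group_cstar) \<xi>))"
  by transfer (simp add: cstar_rel_iff cstar_involution)

text \<open>
  The transform of the indicator function of the unit cube does not vanish at \<open>0\<close>.
\<close>

lemma exists_norm_one_cstar: "\<exists>x :: 'a::euclidean_space group_cstar. norm x = 1"
proof -
  let ?h = "indicator (cbox 0 One) :: 'a \<Rightarrow> complex"
  have i: "integrable lborel ?h"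
    by (intro integrable_indicator_complex emeasure_lborel_cbox_finite) auto
  have "fourier ?h 0 = (\<integral>x. complex_of_real (indicator (cbox 0 One :: 'a set) x) \<partial>lborel)"
    unfolding fourier_def by (intro Bochner_Integration.integral_cong) (auto simp: indicator_def)
  also have "\<dots> = of_real (measure lborel (cbox 0 One :: 'a set))"
    by (simp only: integral_complex_of_real) simp
  also have "\<dots> = 1" by (simp add: measure_lborel_cbox_eq)
  finally have "fourier ?h 0 = 1" .
  then have "gelfand (cstar_of_l1 ?h) 0 \<noteq> 0"
    by (simp add: gelfand_cstar_of_l1[OF i])
  then have "cstar_of_l1 ?h \<noteq> 0" by (auto simp: gelfand_zero)
  then show ?thesis by (intro exI[of _ "sgn (cstar_of_l1 ?h)"]) (simp add: norm_sgn)
qed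

text \<open>
  A truncation of \<open>f\<close> in height and support is integrable, hence close in \<open>L\<^sup>1\<close> to a Schwartz function.
  Projecting the values of the latter to the disc that contains the values of the truncation preserves
  the approximation and continuity. Between functions with values in one disc the \<open>L\<^sup>1\<close> distance
  controls the \<open>L\<^sup>2\<close> distance.
\<close>

lemma tame_dense_l2:
  fixes f :: "'a::euclidean_space \<Rightarrow> complex"
  assumes f: "square_integrable f" and e: "e > 0"
  shows "\<exists>g. tame g \<and> (\<integral>x. (cmod (f x - g x))\<^sup>2 \<partial>lborel) < e"
proof -
  have [measurable]: "f \<in> borel_measurable borel" and f2: "integrable lborel (\<lambda>x. (cmod (f x))\<^sup>2)"
    using f by (auto simp: square_integrable_def)
  define T where "T k = {x. cmod (f x) \<le> real k \<and> norm x \<le> real k}" for k :: nat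
  have T[measurable]: "T k \<in> sets borel" for k
    unfolding T_def by measurable
  let ?t = "\<lambda>k x. indicator (T k) x * f x"
  have "(\<lambda>k. \<integral>x. (cmod (f x - ?t k x))\<^sup>2 \<partial>lborel) \<longlonglongrightarrow> (\<integral>x. 0 \<partial>(lborel :: 'a measure))"
  proof (rule integral_dominated_convergence[where w = "\<lambda>x. (cmod (f x))\<^sup>2"])
    show "AE x in lborel. (\<lambda>k. (cmod (f x - ?t k x))\<^sup>2) \<longlonglongrightarrow> 0"
    proof (rule AE_I2)
      fix x :: 'a
      obtain k0 :: nat where k0: "max (cmod (f x)) (norm x) < k0" using reals_Archimedean2 by blast
      have "x \<in> T k" if "k \<ge> k0" for k
        using k0 that by (auto simp: T_def intro: order_trans less_imp_le)
      then have "\<forall>\<^sub>F k in sequentially. (cmod (f x - ?t k x))\<^sup>2 = 0"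
        unfolding eventually_sequentially by (intro exI[of _ k0]) (auto simp: indicator_def)
      then show "(\<lambda>k. (cmod (f x - ?t k x))\<^sup>2) \<longlonglongrightarrow> 0" by (rule tendsto_eventually)
    qed
    show "AE x in lborel. norm ((cmod (f x - ?t k x))\<^sup>2) \<le> (cmod (f x))\<^sup>2" for k
      by (auto simp: indicator_def intro!: AE_I2)
  qed (use f2 in auto)
  then have "(\<lambda>k. \<integral>x. (cmod (f x - ?t k x))\<^sup>2 \<partial>lborel) \<longlonglongrightarrow> 0" by simp
  then have "\<forall>\<^sub>F k in sequentially. (\<integral>x. (cmod (f x - ?t k x))\<^sup>2 \<partial>lborel) < e / 8"
    by (rule order_tendstoD(2)) (use e in simp)
  then obtain k where k: "(\<integral>x. (cmod (f x - ?t k x))\<^sup>2 \<partial>lborel) < e / 8"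
    by (auto simp: eventually_sequentially)
  have tb: "cmod (?t k x) \<le> real k" for x by (auto simp: indicator_def T_def)
  have ti: "integrable lborel (?t k)"
  proof (rule Bochner_Integration.integrable_bound)
    show "integrable lborel (\<lambda>x::'a. real k * indicator (cball 0 (real k)) x)"
      by (intro integrable_mult_right integrable_real_indicator emeasure_bounded_finite) auto
  qed (auto simp: indicator_def T_def intro!: AE_I2)
  define d where "d = e / (8 * (real k + 1))"
  have d: "d > 0" using e by (simp add: d_def)
  obtain g where g: "schwartz g" "(\<integral>x. cmod (?t k x - g x) \<partial>lborel) < d"
    using schwartz_dense_l1[OF ti d] by blast
  note tg = schwartz_tame[OF g(1)]
  \<comment> \<open>Projection to a convex set is a contraction, so clamping moves \<open>g\<close> no further from the truncation.\<close>
  define c where "c = (\<lambda>z. closest_point (cball 0 (real k)) (z :: complex))"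
  have lip: "dist (c y) (c z) \<le> dist y z" for y z
    unfolding c_def by (rule closest_point_lipschitz) auto
  have cin: "cmod (c z) \<le> real k" for z
    using closest_point_in_set[of "cball 0 (real k)" z] by (auto simp: c_def)
  have cid: "c z = z" if "cmod z \<le> real k" for z
    using that by (auto simp: c_def intro!: closest_point_self)
  have contc: "continuous_on UNIV c"
    unfolding c_def by (rule continuous_on_closest_point) auto
  let ?g = "\<lambda>x. c (g x)"
  have cg: "continuous_on UNIV ?g"
    by (rule continuous_on_compose2[OF contc tameD(1)[OF tg]]) auto
  then have [measurable]: "?g \<in> borel_measurable borel" by (rule borel_measurable_continuous_onI)
  have "integrable lborel ?g"
  proof (rule Bochner_Integration.integrable_bound[OF tameD(2)[OF tg]])
    show "AE x in lborel. norm (c (g x)) \<le> norm (g x)"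
      using lip[of _ 0] cid[of 0] by auto
  qed simp
  with cg cin have tame: "tame ?g" by (auto simp: tame_def intro!: boundedI)
  have diff: "cmod (?t k x - ?g x) \<le> cmod (?t k x - g x)" for x
    using lip[of "?t k x" "g x"] cid[OF tb] by (simp add: dist_norm)
  have pt: "(cmod (?t k x - ?g x))\<^sup>2 \<le> 2 * real k * cmod (?t k x - g x)" for x
  proof -
    have "cmod (?t k x - ?g x) \<le> 2 * real k"
      using norm_triangle_ineq4[of "?t k x" "?g x"] tb[of x] cin[of "g x"] by linarith
    then show ?thesis unfolding power2_eq_square using diff[of x] by (intro mult_mono) auto
  qed
  have pt2: "(cmod (f x - ?g x))\<^sup>2 \<le> 2 * (cmod (f x - ?t k x))\<^sup>2 + 2 * (2 * real k * cmod (?t k x - g x))" for x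
  proof -
    have "(cmod (f x - ?g x))\<^sup>2 \<le> (cmod (f x - ?t k x) + cmod (?t k x - ?g x))\<^sup>2"
      using norm_triangle_ineq[of "f x - ?t k x" "?t k x - ?g x"] by (intro power_mono) simp_all
    also have "\<dots> \<le> 2 * (cmod (f x - ?t k x))\<^sup>2 + 2 * (cmod (?t k x - ?g x))\<^sup>2"
      using sum_squares_bound[of "cmod (f x - ?t k x)" "cmod (?t k x - ?g x)"] by (simp add: power2_sum)
    finally show ?thesis using pt[of x] by linarith
  qed
  have i1: "integrable lborel (\<lambda>x. (cmod (f x - ?t k x))\<^sup>2)"
    by (rule Bochner_Integration.integrable_bound[OF f2]) (auto simp: indicator_def intro!: AE_I2)
  have i2: "integrable lborel (\<lambda>x. cmod (?t k x - g x))"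
    using ti tameD(2)[OF tg] by auto
  have i3: "integrable lborel (\<lambda>x. 2 * (cmod (f x - ?t k x))\<^sup>2 + 2 * (2 * real k * cmod (?t k x - g x)))"
    by (intro Bochner_Integration.integrable_add integrable_mult_right i1 i2)
  have "(\<integral>x. (cmod (f x - ?g x))\<^sup>2 \<partial>lborel) \<le> (\<integral>x. 2 * (cmod (f x - ?t k x))\<^sup>2 + 2 * (2 * real k * cmod (?t k x - g x)) \<partial>lborel)"
  proof (rule integral_mono)
    show "integrable lborel (\<lambda>x. (cmod (f x - ?g x))\<^sup>2)"
    proof (rule Bochner_Integration.integrable_bound[OF i3])
      show "AE x in lborel. norm ((cmod (f x - ?g x))\<^sup>2)
          \<le> norm (2 * (cmod (f x - ?t k x))\<^sup>2 + 2 * (2 * real k * cmod (?t k x - g x)))"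
        using pt2 by (intro AE_I2) (simp only: real_norm_def abs_power2, rule order_trans[OF _ abs_ge_self])
    qed simp
  qed (use i3 pt2 in auto)
  also have "\<dots> = 2 * (\<integral>x. (cmod (f x - ?t k x))\<^sup>2 \<partial>lborel) + 2 * (2 * real k * (\<integral>x. cmod (?t k x - g x) \<partial>lborel))"
    by (subst Bochner_Integration.integral_add)
       (simp_all only: integrable_mult_right i1 i2 integral_mult_right_zero)
  also have "\<dots> \<le> 2 * (e / 8) + 2 * (2 * (real k + 1) * d)"
    using k g(2) d by (intro add_mono mult_left_mono mult_mono) auto
  also have "2 * (2 * (real k + 1) * d) = e / 2"
    unfolding d_def by (simp add: field_simps)
  finally have le: "(\<integral>x. (cmod (f x - ?g x))\<^sup>2 \<partial>lborel) \<le> 2 * (e / 8) + e / 2" .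
  then have "(\<integral>x. (cmod (f x - ?g x))\<^sup>2 \<partial>lborel) < e" using e by linarith
  with tame show ?thesis by blast
qed

section \<open>The Hilbert space of square integrable functions\<close>

lemma l2_rel_refl_iff: "l2_rel f f \<longleftrightarrow> square_integrable f"
  by (simp add: l2_rel_def)

lemma square_integrable_rep: "square_integrable (rep_l2 x)"
  using Quotient_rep_reflp[OF Quotient_l2, of x] by (simp add: l2_rel_refl_iff)

lemma square_integrable_measurable: "square_integrable f \<Longrightarrow> f \<in> borel_measurable borel"
  by (simp add: square_integrable_def)

lemma square_integrable_power2: "square_integrable f \<Longrightarrow> integrable lborel (\<lambda>x. (cmod (f x))\<^sup>2)"
  by (simp add: square_integrable_def)

lemma l2_of_rep [simp]: "l2_of (rep_l2 x) = x"
  by (rule Quotient_abs_rep[OF Quotient_l2])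

lemma rep_l2_of:
  assumes "square_integrable f"
  shows "AE x in lborel. rep_l2 (l2_of f) x = f x"
  using Quotient_rep_abs[OF Quotient_l2, of f] assms by (simp add: l2_rel_def)

lemma l2_of_eqI:
  assumes "square_integrable f" "square_integrable g" "AE x in lborel. f x = g x"
  shows "l2_of f = l2_of g"
  by (rule Quotient_rel_abs[OF Quotient_l2]) (use assms in \<open>simp add: l2_rel_def\<close>)

lemma l2_cases:
  obtains f where "square_integrable f" "x = l2_of f"
  using square_integrable_rep[of x] l2_of_rep[of x] by metis

lemma square_integrable_uminus: "square_integrable f \<Longrightarrow> square_integrable (\<lambda>x. - f x)"
  using square_integrable_scale[of f "-1"] by simp

lemma square_integrable_diff:
  "square_integrable f \<Longrightarrow> square_integrable g \<Longrightarrow> square_integrable (\<lambda>x. f x - g x)"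
  using square_integrable_add[of f "\<lambda>x. - g x"] square_integrable_uminus[of g] by simp

lemma l2_of_add:
  "square_integrable f \<Longrightarrow> square_integrable g \<Longrightarrow> l2_of f + l2_of g = l2_of (\<lambda>x. f x + g x)"
  by (simp add: plus_l2.abs_eq l2_rel_refl_iff)

lemma l2_of_scaleC: "square_integrable f \<Longrightarrow> c *\<^sub>C l2_of f = l2_of (\<lambda>x. c * f x)"
  by (simp add: scaleC_l2.abs_eq l2_rel_refl_iff)

lemma l2_of_diff:
  "square_integrable f \<Longrightarrow> square_integrable g \<Longrightarrow> l2_of f - l2_of g = l2_of (\<lambda>x. f x - g x)"
  using l2_of_add[OF square_integrable_diff[of f g], of g] by (simp add: algebra_simps eq_diff_eq)

lemma l2_of_sum:
  assumes "\<And>i. i \<in> I \<Longrightarrow> square_integrable (f i)"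
  shows "square_integrable (\<lambda>x. \<Sum>i\<in>I. f i x) \<and> (\<Sum>i\<in>I. l2_of (f i)) = l2_of (\<lambda>x. \<Sum>i\<in>I. f i x)"
  using assms
proof (induction I rule: infinite_finite_induct)
  case (insert i I)
  then show ?case by (auto simp: l2_of_add intro: square_integrable_add)
qed (auto simp: zero_l2_def square_integrable_def)

lemma l2_inner_of:
  "square_integrable f \<Longrightarrow> square_integrable g \<Longrightarrow> l2_inner (l2_of f) (l2_of g) = (\<integral>x. f x * cnj (g x) \<partial>lborel)"
  by (simp add: l2_inner.abs_eq l2_rel_refl_iff)

lemma l2_inner_add_left: "l2_inner (x + y) z = l2_inner x z + l2_inner y z"
proof -
  obtain f g h where *: "square_integrable f" "square_integrable g" "square_integrable h"
    "x = l2_of f" "y = l2_of g" "z = l2_of h" by (metis l2_cases)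
  then show ?thesis
    by (simp add: l2_of_add l2_inner_of square_integrable_add distrib_right square_integrable_inner)
qed

lemma l2_inner_scaleC_left: "l2_inner (c *\<^sub>C x) z = c * l2_inner x z"
proof -
  obtain f h where *: "square_integrable f" "square_integrable h"
    "x = l2_of f" "z = l2_of h" by (metis l2_cases)
  then show ?thesis
    by (simp add: l2_of_scaleC l2_inner_of square_integrable_scale mult.assoc)
qed

lemma l2_inner_commute: "l2_inner x y = cnj (l2_inner y x)"
proof -
  obtain f h where *: "square_integrable f" "square_integrable h"
    "x = l2_of f" "y = l2_of h" by (metis l2_cases)
  have "(\<integral>t. f t * cnj (h t) \<partial>lborel) = (\<integral>t. cnj (h t * cnj (f t)) \<partial>lborel)"
    by (simp add: mult.commute)
  also have "\<dots> = cnj (\<integral>t. h t * cnj (f t) \<partial>lborel)"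
    by (rule Bochner_Integration.integral_cnj)
  finally show ?thesis using * by (simp add: l2_inner_of)
qed

lemma l2_inner_add_right: "l2_inner z (x + y) = l2_inner z x + l2_inner z y"
  using l2_inner_commute[of z] l2_inner_add_left[of x y z] by (metis complex_cnj_add)

lemma l2_inner_scaleC_right: "l2_inner x (c *\<^sub>C y) = cnj c * l2_inner x y"
  using l2_inner_commute[of x] l2_inner_scaleC_left[of c y x] by (metis complex_cnj_mult)

lemma l2_inner_scaleR_left: "l2_inner (r *\<^sub>R x) y = of_real r * l2_inner x y"
  by (metis l2_inner_scaleC_left scaleC_of_real)

lemma l2_inner_scaleR_right: "l2_inner x (r *\<^sub>R y) = of_real r * l2_inner x y"
  by (metis l2_inner_scaleC_right scaleC_of_real complex_cnj_complex_of_real)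

lemma l2_inner_diff_left: "l2_inner (x - y) z = l2_inner x z - l2_inner y z"
  using l2_inner_add_left[of "x - y" y z] by simp

lemma l2_inner_diff_right: "l2_inner z (x - y) = l2_inner z x - l2_inner z y"
  using l2_inner_add_right[of z "x - y" y] by simp

lemma l2_inner_self: "l2_inner x x = of_real ((norm x)\<^sup>2)"
proof -
  have "Im (l2_inner x x) = 0"
    using l2_inner_commute[of x x] by (metis complex_In_mult_cnj_zero Reals_cnj_iff complex_is_Real_iff)
  moreover have "Re (l2_inner x x) = (norm x)\<^sup>2"
    by (simp add: power2_norm_eq_inner inner_l2_def)
  ultimately show ?thesis by (simp add: complex_eq_iff)
qed

lemma norm_l2_of:
  assumes "square_integrable f"
  shows "(norm (l2_of f))\<^sup>2 = (\<integral>x. (cmod (f x))\<^sup>2 \<partial>lborel)"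
proof -
  have "complex_of_real ((norm (l2_of f))\<^sup>2) = (\<integral>x. of_real ((cmod (f x))\<^sup>2) \<partial>lborel)"
    unfolding l2_inner_self[symmetric] l2_inner_of[OF assms assms]
    by (simp add: complex_mult_cnj cmod_power2)
  also have "\<dots> = of_real (\<integral>x. (cmod (f x))\<^sup>2 \<partial>lborel)" by (simp only: integral_complex_of_real)
  finally show ?thesis by (simp only: of_real_eq_iff)
qed

lemma norm_l2_of_nn:
  assumes "square_integrable f"
  shows "(\<integral>\<^sup>+x. ennreal ((cmod (f x))\<^sup>2) \<partial>lborel) = ennreal ((norm (l2_of f))\<^sup>2)"
  unfolding norm_l2_of[OF assms]
  by (rule nn_integral_eq_integral) (use assms in \<open>auto simp: square_integrable_def\<close>)

lemma norm_l2_of_nnD: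
  assumes [measurable]: "f \<in> borel_measurable borel" and c: "c \<ge> 0"
    and le: "(\<integral>\<^sup>+x. ennreal ((cmod (f x))\<^sup>2) \<partial>lborel) \<le> ennreal (c\<^sup>2)"
  shows "square_integrable f" "norm (l2_of f) \<le> c"
proof -
  have "(\<integral>\<^sup>+x. ennreal ((cmod (f x))\<^sup>2) \<partial>lborel) < \<infinity>"
    using le by (rule le_less_trans) simp
  then show f: "square_integrable f"
    by (simp add: square_integrable_def integrable_iff_bounded)
  have "(norm (l2_of f))\<^sup>2 \<le> c\<^sup>2" using le unfolding norm_l2_of_nn[OF f] by simp
  then show "norm (l2_of f) \<le> c" using c by (rule power2_le_imp_le)
qed

lemma l2_cauchy_schwarz: "cmod (l2_inner x y) \<le> norm x * norm y"
proof (cases "l2_inner x y = 0")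
  case False
  define c where "c = cnj (sgn (l2_inner x y))"
  have c: "cmod c = 1" using False by (simp add: c_def norm_sgn)
  have "cnj (l2_inner x y) * l2_inner x y = of_real ((cmod (l2_inner x y))\<^sup>2)"
    using complex_norm_square[of "l2_inner x y"] by (simp add: mult.commute)
  then have "c * l2_inner x y = of_real (cmod (l2_inner x y))"
    using False by (simp add: c_def sgn_eq power2_eq_square field_simps)
  then have "cmod (l2_inner x y) = inner (c *\<^sub>C x) y"
    by (simp add: inner_l2_def l2_inner_scaleC_left)
  also have "\<dots> \<le> norm (c *\<^sub>C x) * norm y" by (rule norm_cauchy_schwarz)
  finally show ?thesis by (simp add: norm_scaleC c)
qed simp

lemma l2_eqI:
  assumes "\<And>y. l2_inner x y = l2_inner x' y"
  shows "x = x'"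
proof -
  have "l2_inner (x - x') (x - x') = 0" by (simp add: l2_inner_diff_left assms)
  then show ?thesis by (simp add: l2_inner_self)
qed

lemma norm_l2_leI:
  assumes "0 \<le> B" "\<And>y. cmod (l2_inner x y) \<le> B * norm y"
  shows "norm x \<le> B"
proof (cases "norm x = 0")
  case True
  with assms(1) show ?thesis by simp
next
  case False
  have "norm x * norm x \<le> B * norm x"
    using assms(2)[of x] unfolding l2_inner_self norm_of_real abs_power2 by (simp add: power2_eq_square)
  with False show ?thesis by simp
qed

text \<open>
  Used for completeness, and to pass from a dense set of vectors to all vectors in the Moyal identity.
\<close>

lemma l2_fatou:
  fixes f :: "nat \<Rightarrow> 'a::euclidean_space \<Rightarrow> complex"
  assumes f: "\<And>k. square_integrable (f k)" and [measurable]: "g \<in> borel_measurable borel"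
    and lim: "AE x in lborel. (\<lambda>k. f k x) \<longlonglongrightarrow> g x" and le: "\<And>k. norm (l2_of (f k)) \<le> c"
  shows "square_integrable g" "norm (l2_of g) \<le> c"
proof -
  have [measurable]: "f k \<in> borel_measurable borel" for k
    using f by (rule square_integrable_measurable)
  have c: "0 \<le> c" using order_trans[OF norm_ge_zero le] .
  have "(\<integral>\<^sup>+x. ennreal ((cmod (g x))\<^sup>2) \<partial>lborel) = (\<integral>\<^sup>+x. liminf (\<lambda>k. ennreal ((cmod (f k x))\<^sup>2)) \<partial>lborel)"
  proof (rule nn_integral_cong_AE)
    show "AE x in lborel. ennreal ((cmod (g x))\<^sup>2) = liminf (\<lambda>k. ennreal ((cmod (f k x))\<^sup>2))"
      using lim
    proof eventually_elim
      case (elim x)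
      have "(\<lambda>k. ennreal ((cmod (f k x))\<^sup>2)) \<longlonglongrightarrow> ennreal ((cmod (g x))\<^sup>2)"
        by (intro tendsto_ennrealI tendsto_intros elim)
      then show ?case by (intro lim_imp_Liminf[symmetric]) auto
    qed
  qed
  also have "\<dots> \<le> liminf (\<lambda>k. \<integral>\<^sup>+x. ennreal ((cmod (f k x))\<^sup>2) \<partial>lborel)"
    by (rule nn_integral_liminf) simp
  also have "\<dots> \<le> liminf (\<lambda>k. ennreal (c\<^sup>2))"
    unfolding norm_l2_of_nn[OF f]
    by (intro Liminf_mono always_eventually allI ennreal_leI power_mono le) simp
  also have "\<dots> = ennreal (c\<^sup>2)" by (simp add: Liminf_const)
  finally show "square_integrable g" "norm (l2_of g) \<le> c"
    using norm_l2_of_nnD[of g c] c by auto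
qed

text \<open>
  The theorem of Riesz and Fischer. Along a subsequence with summable increments the absolute
  increments have a square integrable sum, by monotone convergence. So the subsequence converges almost
  everywhere, and by Fatou the limit is also the limit in norm. Integration and extension by continuity
  of operator-valued functions depend on this completeness.
\<close>

instance l2 :: (euclidean_space) banach
proof
  fix X :: "nat \<Rightarrow> 'a l2" assume X: "Cauchy X"
  have "\<forall>k. \<exists>M. \<forall>m\<ge>M. \<forall>n\<ge>M. norm (X m - X n) < (1/2) ^ k"
    using X by (auto simp: Cauchy_iff)
  then obtain M where M: "\<And>k m n. m \<ge> M k \<Longrightarrow> n \<ge> M k \<Longrightarrow> norm (X m - X n) < (1/2) ^ k" by metis
  define r where "r k = (\<Sum>i\<le>k. M i) + k" for k
  have rM: "r k \<ge> M j" if "j \<le> k" for j k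
    using member_le_sum[of j "{..k}" M] that by (auto simp: r_def)
  have rsm: "strict_mono r" by (rule strict_monoI_Suc) (simp add: r_def)
  define f where "f k = rep_l2 (X (r k))" for k
  have f: "square_integrable (f k)" "l2_of (f k) = X (r k)" for k
    by (simp_all add: f_def square_integrable_rep)
  have [measurable]: "f k \<in> borel_measurable borel" for k
    using f(1) by (rule square_integrable_measurable)
  define d where "d k x = complex_of_real (cmod (f (Suc k) x - f k x))" for k x
  have d: "square_integrable (d k)" for k
  proof -
    have "d k \<in> borel_measurable borel" unfolding d_def by measurable
    then show ?thesis
      using square_integrable_diff[OF f(1)[of "Suc k"] f(1)[of k]]
      by (simp add: square_integrable_def d_def)
  qed
  have dn: "norm (l2_of (d k)) \<le> (1/2) ^ k" for k
  proof -
    have "(norm (l2_of (d k)))\<^sup>2 = (norm (X (r (Suc k)) - X (r k)))\<^sup>2"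
      unfolding f(2)[symmetric] l2_of_diff[OF f(1) f(1)]
      by (simp only: norm_l2_of[OF d] norm_l2_of[OF square_integrable_diff[OF f(1) f(1)]]) (simp add: d_def)
    then have "norm (l2_of (d k)) = norm (X (r (Suc k)) - X (r k))" by simp
    also have "\<dots> < (1/2) ^ k" by (intro M rM) auto
    finally show ?thesis by simp
  qed
  \<comment> \<open>Half powers are summable to \<open>2\<close>, so every partial sum has norm at most \<open>2\<close>.\<close>
  define G where "G n x = (\<Sum>k<n. cmod (f (Suc k) x - f k x))" for n x
  have [measurable]: "G n \<in> borel_measurable borel" for n unfolding G_def by measurable
  have Gn: "(\<integral>\<^sup>+x. ennreal ((G n x)\<^sup>2) \<partial>lborel) \<le> 4" for n
  proof -
    have S: "square_integrable (\<lambda>x. \<Sum>k<n. d k x)" "(\<Sum>k<n. l2_of (d k)) = l2_of (\<lambda>x. \<Sum>k<n. d k x)"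
      using l2_of_sum[of "{..<n}" d] d by auto
    have "norm (\<Sum>k<n. l2_of (d k)) \<le> (\<Sum>k<n. (1/2) ^ k)"
      by (intro order_trans[OF norm_sum] sum_mono dn)
    also have "\<dots> = 2 - 2 * (1/2) ^ n" by (induction n) auto
    also have "\<dots> \<le> 2" by simp
    finally have "(norm (l2_of (\<lambda>x. \<Sum>k<n. d k x)))\<^sup>2 \<le> 2\<^sup>2" unfolding S(2) by (intro power_mono) auto
    then have "(\<integral>\<^sup>+x. ennreal ((cmod (\<Sum>k<n. d k x))\<^sup>2) \<partial>lborel) \<le> ennreal 4"
      unfolding norm_l2_of_nn[OF S(1)] by (intro ennreal_leI) simp
    moreover have "(cmod (\<Sum>k<n. d k x))\<^sup>2 = (G n x)\<^sup>2" for x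
      unfolding G_def d_def of_real_sum[symmetric] norm_of_real by simp
    ultimately show ?thesis by simp
  qed
  have "(\<integral>\<^sup>+x. (SUP n. ennreal ((G n x)\<^sup>2)) \<partial>lborel) = (SUP n. \<integral>\<^sup>+x. ennreal ((G n x)\<^sup>2) \<partial>lborel)"
  proof (rule nn_integral_monotone_convergence_SUP)
    show "incseq (\<lambda>n x. ennreal ((G n x)\<^sup>2))"
      by (intro incseq_SucI le_funI ennreal_leI power_mono) (auto simp: G_def intro: sum_nonneg)
  qed simp
  also have "\<dots> \<le> 4" by (intro SUP_least Gn)
  finally have "(\<integral>\<^sup>+x. (SUP n. ennreal ((G n x)\<^sup>2)) \<partial>lborel) \<noteq> \<infinity>"
    by (auto simp: top_unique)
  then have "AE x in lborel. (SUP n. ennreal ((G n x)\<^sup>2)) \<noteq> \<infinity>"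
    by (intro nn_integral_noteq_infinite) auto
  then have conv: "AE x in lborel. convergent (\<lambda>k. f k x)"
  proof eventually_elim
    case (elim x)
    then obtain B where B: "B \<ge> 0" "(SUP n. ennreal ((G n x)\<^sup>2)) = ennreal B"
      by (cases "SUP n. ennreal ((G n x)\<^sup>2)") auto
    have "G n x \<le> 1 + B" for n
    proof -
      have "ennreal ((G n x)\<^sup>2) \<le> ennreal B" unfolding B(2)[symmetric] by (rule SUP_upper) simp
      then have "(G n x)\<^sup>2 \<le> B" using B(1) by simp
      also have "B \<le> (1 + B)\<^sup>2" using B(1) by (simp add: power2_eq_square algebra_simps)
      finally show ?thesis using B(1) by (auto intro: power2_le_imp_le)
    qed
    then have "summable (\<lambda>k. cmod (f (Suc k) x - f k x))"
      by (intro summableI_nonneg_bounded[where x = "1 + B"]) (auto simp: G_def)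
    then have "summable (\<lambda>k. f (Suc k) x - f k x)" by (rule summable_norm_cancel)
    then have "convergent (\<lambda>n. \<Sum>k<n. f (Suc k) x - f k x)"
      by (simp add: summable_iff_convergent)
    then have "convergent (\<lambda>n. f n x - f 0 x)" by (simp add: sum_lessThan_telescope[of "\<lambda>k. f k x"])
    then have "convergent (\<lambda>n. (f n x - f 0 x) + f 0 x)" by (intro convergent_add convergent_const)
    then show ?case by simp
  qed
  define g where "g x = lim (\<lambda>k. f k x)" for x
  have [measurable]: "g \<in> borel_measurable borel" unfolding g_def by measurable
  have lim: "AE x in lborel. (\<lambda>k. f k x) \<longlonglongrightarrow> g x"
    using conv by eventually_elim (simp add: g_def convergent_LIMSEQ_iff)
  obtain B where B: "\<And>n. norm (X n) \<le> B"
    using Cauchy_Bseq[OF X] by (auto simp: Bseq_def)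
  have g: "square_integrable g"
  proof (rule l2_fatou(1)[OF f(1) _ lim])
    from B show "norm (l2_of (f k)) \<le> B" for k by (simp add: f)
  qed simp
  have sub: "norm (X (r k) - l2_of g) \<le> (1/2) ^ k" for k
  proof -
    have "norm (l2_of (\<lambda>x. f k x - g x)) \<le> (1/2) ^ k"
    proof (rule l2_fatou(2)[where f = "\<lambda>m x. f k x - f (m + k) x"])
      show "AE x in lborel. (\<lambda>m. f k x - f (m + k) x) \<longlonglongrightarrow> f k x - g x"
        using lim by eventually_elim (intro tendsto_intros LIMSEQ_ignore_initial_segment)
      show "norm (l2_of (\<lambda>x. f k x - f (m + k) x)) \<le> (1/2) ^ k" for m
        unfolding l2_of_diff[OF f(1) f(1), symmetric] f(2)
        by (rule less_imp_le, intro M rM) auto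
    qed (auto intro: square_integrable_diff f)
    then show ?thesis by (simp add: l2_of_diff[OF f(1) g, symmetric] f(2))
  qed
  have "(\<lambda>k. X (r k) - l2_of g) \<longlonglongrightarrow> 0"
    by (rule Lim_null_comparison[OF _ LIMSEQ_realpow_zero[of "1/2"]]) (use sub in auto)
  then have "(X \<circ> r) \<longlonglongrightarrow> l2_of g"
    by (simp add: LIM_zero_iff comp_def)
  then have "X \<longlonglongrightarrow> l2_of g" by (rule Cauchy_converges_subseq[OF X rsm])
  then show "convergent X" by (auto simp: convergent_def)
qed

text \<open>
  When all norms agree, \<open>norm (x - y) ^ 2\<close> is controlled by the inner product of \<open>x\<close> and \<open>y\<close>. So
  pointwise convergence under a uniform bound suffices: the integrable limit \<open>f\<close> serves as dominating
  function for the inner products.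
\<close>

lemma l2_convergence:
  fixes g :: "nat \<Rightarrow> 'a::euclidean_space \<Rightarrow> complex"
  assumes g: "\<And>k. square_integrable (g k)" and f: "square_integrable f" "integrable lborel f"
    and lim: "\<And>x. (\<lambda>k. g k x) \<longlonglongrightarrow> f x" and bd: "\<And>k x. cmod (g k x) \<le> C"
    and nrm: "\<And>k. norm (l2_of (g k)) = norm (l2_of f)"
  shows "(\<lambda>k. norm (l2_of (g k) - l2_of f)) \<longlonglongrightarrow> 0"
proof -
  have [measurable]: "f \<in> borel_measurable borel" "g k \<in> borel_measurable borel" for k
    using f g by (auto dest: square_integrable_measurable)
  have "(\<lambda>k. \<integral>x. f x * cnj (g k x) \<partial>lborel) \<longlonglongrightarrow> (\<integral>x. f x * cnj (f x) \<partial>lborel)"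
  proof (rule integral_dominated_convergence[where w = "\<lambda>x. C * cmod (f x)"])
    show "AE x in lborel. (\<lambda>k. f x * cnj (g k x)) \<longlonglongrightarrow> f x * cnj (f x)"
      by (intro AE_I2 tendsto_intros lim)
    show "AE x in lborel. norm (f x * cnj (g k x)) \<le> C * cmod (f x)" for k
    proof (rule AE_I2)
      fix x
      have "cmod (g k x) * cmod (f x) \<le> C * cmod (f x)" by (intro mult_right_mono bd) simp
      then show "norm (f x * cnj (g k x)) \<le> C * cmod (f x)" by (simp add: norm_mult mult.commute)
    qed
  qed (use f in auto)
  then have "(\<lambda>k. l2_inner (l2_of f) (l2_of (g k))) \<longlonglongrightarrow> l2_inner (l2_of f) (l2_of f)"
    by (simp add: l2_inner_of f g)
  then have "(\<lambda>k. inner (l2_of f) (l2_of (g k))) \<longlonglongrightarrow> inner (l2_of f) (l2_of f)"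
    unfolding inner_l2_def by (rule tendsto_Re)
  then have "(\<lambda>k. sqrt (2 * (norm (l2_of f))\<^sup>2 - 2 * inner (l2_of f) (l2_of (g k))))
      \<longlonglongrightarrow> sqrt (2 * (norm (l2_of f))\<^sup>2 - 2 * inner (l2_of f) (l2_of f))"
    by (intro tendsto_real_sqrt tendsto_diff tendsto_const tendsto_mult_left)
  moreover have "sqrt (2 * (norm (l2_of f))\<^sup>2 - 2 * inner (l2_of f) (l2_of (g k))) = norm (l2_of (g k) - l2_of f)" for k
  proof -
    have "(norm (l2_of (g k) - l2_of f))\<^sup>2 = 2 * (norm (l2_of f))\<^sup>2 - 2 * inner (l2_of f) (l2_of (g k))"
      using nrm[of k] by (simp add: power2_norm_eq_inner inner_diff_left inner_diff_right inner_commute)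
        (metis power2_norm_eq_inner)
    then show ?thesis by (metis norm_ge_zero real_sqrt_unique)
  qed
  moreover have "sqrt (2 * (norm (l2_of f))\<^sup>2 - 2 * inner (l2_of f) (l2_of f)) = 0"
    by (simp add: power2_norm_eq_inner)
  ultimately show ?thesis by (simp only:)
qed

lemma bounded_bilinear_l2_inner: "bounded_bilinear l2_inner"
proof
  show "\<exists>K. \<forall>a b. norm (l2_inner a b) \<le> norm a * norm b * K"
    by (auto intro!: exI[of _ 1] l2_cauchy_schwarz)
qed (simp_all add: l2_inner_add_left l2_inner_add_right l2_inner_scaleR_left l2_inner_scaleR_right
    scaleR_conv_of_real)

lemma l2_inner_eq_inner: "l2_inner x y = Complex (inner x y) (inner x (\<i> *\<^sub>C y))"
  by (simp add: inner_l2_def l2_inner_scaleC_right complex_eq_iff)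

section \<open>Coherent states and the Moyal identity\<close>

definition coherent_fun ::
    "(real ^ 'n::finite \<Rightarrow> complex) \<Rightarrow> real \<Rightarrow> real ^ 'n \<Rightarrow> real ^ 'n \<Rightarrow> real ^ 'n \<Rightarrow> complex" where
  "coherent_fun g lam a b s = of_real (\<bar>lam\<bar> powr (real CARD('n) / 4)) *
    cis (2 * pi * (a \<bullet> s)) * g ((\<bar>lam\<bar> powr (1 / 2)) *\<^sub>R (s + (1 / lam) *\<^sub>R b))"

lemma coherent_state_eq: "coherent_state g lam a b = l2_of (coherent_fun g lam a b)"
  by (simp add: coherent_state_def coherent_fun_def[abs_def])

lemma powr_half_power: "lam \<noteq> 0 \<Longrightarrow> (\<bar>lam\<bar> powr (1 / 2)) ^ n = \<bar>lam\<bar> powr (real n / 2)"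
  by (simp add: powr_realpow[symmetric] powr_powr)

lemma powr_quarter_square: "lam \<noteq> 0 \<Longrightarrow> (\<bar>lam\<bar> powr (real n / 4))\<^sup>2 = \<bar>lam\<bar> powr (real n / 2)"
  by (simp add: power2_eq_square powr_add[symmetric])

lemma norm_coherent_fun:
  assumes "lam \<noteq> 0"
  shows "(cmod (coherent_fun (g :: real ^ 'n \<Rightarrow> complex) lam a b s))\<^sup>2
    = \<bar>lam\<bar> powr (real CARD('n) / 2) * (cmod (g ((\<bar>lam\<bar> powr (1 / 2)) *\<^sub>R (s + (1 / lam) *\<^sub>R b))))\<^sup>2"
  by (simp add: coherent_fun_def norm_mult power_mult_distrib powr_quarter_square[OF assms])

lemma coherent_fun_measurable [measurable]:
  assumes [measurable]: "g \<in> borel_measurable borel"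
  shows "coherent_fun g lam a b \<in> borel_measurable borel"
proof -
  have [measurable]: "(\<lambda>s. cis (2 * pi * (a \<bullet> s))) \<in> borel_measurable borel"
    by (intro borel_measurable_continuous_onI continuous_intros)
  show ?thesis unfolding coherent_fun_def by measurable
qed

lemma coherent_fun_l2:
  fixes g :: "real ^ 'n::finite \<Rightarrow> complex"
  assumes lam: "lam \<noteq> 0" and g: "square_integrable g"
  shows "square_integrable (coherent_fun g lam a b)"
    and "norm (coherent_state g lam a b) = norm (l2_of g)"
proof -
  let ?r = "\<bar>lam\<bar> powr (1 / 2)"
  have [measurable]: "g \<in> borel_measurable borel" using g by (rule square_integrable_measurable)
  have "(\<integral>\<^sup>+s. ennreal ((cmod (coherent_fun g lam a b s))\<^sup>2) \<partial>lborel)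
      = (\<integral>\<^sup>+s. ennreal (\<bar>lam\<bar> powr (real CARD('n) / 2)) *
          ennreal ((cmod (g (?r *\<^sub>R ((1 / lam) *\<^sub>R b) + ?r *\<^sub>R s)))\<^sup>2) \<partial>lborel)"
    unfolding norm_coherent_fun[OF lam]
    by (simp add: ennreal_mult' scaleR_add_right add.commute)
  also have "\<dots> = ennreal (\<bar>?r\<bar> ^ DIM(real ^ 'n)) * (\<integral>\<^sup>+s. ennreal ((cmod (g (?r *\<^sub>R ((1 / lam) *\<^sub>R b) + ?r *\<^sub>R s)))\<^sup>2) \<partial>lborel)"
    using lam by (simp add: nn_integral_cmult powr_half_power)
  also have "\<dots> = (\<integral>\<^sup>+s. ennreal ((cmod (g s))\<^sup>2) \<partial>lborel)"
    by (rule nn_integral_lborel_affine[symmetric]) (use lam in auto)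
  also have "\<dots> = ennreal ((norm (l2_of g))\<^sup>2)" by (rule norm_l2_of_nn[OF g])
  finally have *: "(\<integral>\<^sup>+s. ennreal ((cmod (coherent_fun g lam a b s))\<^sup>2) \<partial>lborel) = ennreal ((norm (l2_of g))\<^sup>2)" .
  show si: "square_integrable (coherent_fun g lam a b)"
    by (rule norm_l2_of_nnD(1)[of _ "norm (l2_of g)"]) (use * in auto)
  have "(norm (coherent_state g lam a b))\<^sup>2 = (norm (l2_of g))\<^sup>2"
    using * unfolding norm_l2_of_nn[OF si] coherent_state_eq by simp
  then show "norm (coherent_state g lam a b) = norm (l2_of g)" by simp
qed

lemma tame_coherent_fun:
  assumes "tame g" "lam \<noteq> 0"
  shows "tame (coherent_fun (g :: real ^ 'n::finite \<Rightarrow> complex) lam a b)"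
proof -
  let ?r = "\<bar>lam\<bar> powr (1 / 2)"
  have "tame (\<lambda>s. (of_real (\<bar>lam\<bar> powr (real CARD('n) / 4)) * cis (2 * pi * (a \<bullet> s))) *
      g (?r *\<^sub>R ((1 / lam) *\<^sub>R b) + ?r *\<^sub>R s))"
    by (rule tame_mult[OF tame_affine[OF assms(1)], where C = "\<bar>lam\<bar> powr (real CARD('n) / 4)"])
       (use assms(2) in \<open>auto intro!: continuous_intros simp: norm_mult\<close>)
  then show ?thesis
    by (simp add: coherent_fun_def[abs_def] scaleR_add_right add.commute mult.assoc)
qed

text \<open>
  All coherent states have the norm of their window, so pointwise convergence is enough.
\<close>

lemma continuous_coherent_state:
  fixes g :: "real ^ 'n::finite \<Rightarrow> complex"
  assumes g: "tame g"
  shows "continuous_on ({lam. lam \<noteq> 0} \<times> UNIV) (\<lambda>(lam, a, b). coherent_state g lam a b)"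
  unfolding continuous_on_sequentially
proof (intro allI ballI impI)
  fix X :: "nat \<Rightarrow> real \<times> (real ^ 'n) \<times> (real ^ 'n)" and p
  assume p: "p \<in> {lam. lam \<noteq> 0} \<times> UNIV" and X: "(\<forall>n. X n \<in> {lam. lam \<noteq> 0} \<times> UNIV) \<and> X \<longlonglongrightarrow> p"
  obtain lam a b where pe: "p = (lam, a, b)" by (cases p)
  define L A B where "L n = fst (X n)" and "A n = fst (snd (X n))" and "B n = snd (snd (X n))" for n
  have Xe: "X n = (L n, A n, B n)" for n by (simp add: L_def A_def B_def)
  have l0: "lam \<noteq> 0" "L n \<noteq> 0" for n using p X by (auto simp: pe Xe)
  have lim: "L \<longlonglongrightarrow> lam" "A \<longlonglongrightarrow> a" "B \<longlonglongrightarrow> b"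
  proof -
    from X have "X \<longlonglongrightarrow> (lam, a, b)" by (simp add: pe)
    from tendsto_fst[OF this] tendsto_fst[OF tendsto_snd[OF this]] tendsto_snd[OF tendsto_snd[OF this]]
    show "L \<longlonglongrightarrow> lam" "A \<longlonglongrightarrow> a" "B \<longlonglongrightarrow> b"
      by (simp_all add: L_def[abs_def] A_def[abs_def] B_def[abs_def])
  qed
  obtain C where C: "C > 0" "\<And>x. cmod (g x) \<le> C" using tame_bound[OF g] by blast
  have limp: "(\<lambda>n. \<bar>L n\<bar> powr (real CARD('n) / 4)) \<longlonglongrightarrow> \<bar>lam\<bar> powr (real CARD('n) / 4)"
    by (intro tendsto_intros lim) (use l0 in auto)
  then have "Bseq (\<lambda>n. \<bar>L n\<bar> powr (real CARD('n) / 4))"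
    by (intro convergent_imp_Bseq convergentI)
  then obtain M where M: "\<And>n. norm (\<bar>L n\<bar> powr (real CARD('n) / 4)) \<le> M"
    unfolding Bseq_def by blast
  have "(\<lambda>n. norm (l2_of (coherent_fun g (L n) (A n) (B n)) - l2_of (coherent_fun g lam a b))) \<longlonglongrightarrow> 0"
  proof (rule l2_convergence)
    show "square_integrable (coherent_fun g (L k) (A k) (B k))"
      "norm (l2_of (coherent_fun g (L k) (A k) (B k))) = norm (l2_of (coherent_fun g lam a b))" for k
      using coherent_fun_l2[OF _ tame_square_integrable[OF g]] l0 by (auto simp: coherent_state_eq)
    show "square_integrable (coherent_fun g lam a b)" "integrable lborel (coherent_fun g lam a b)"
      using tame_coherent_fun[OF g l0(1)] by (auto intro: tame_square_integrable tameD(2))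
    show "(\<lambda>k. coherent_fun g (L k) (A k) (B k) x) \<longlonglongrightarrow> coherent_fun g lam a b x" for x
    proof -
      have "isCont g y" for y using tameD(1)[OF g] by (simp add: continuous_on_eq_continuous_at)
      then have "(\<lambda>k. g ((\<bar>L k\<bar> powr (1 / 2)) *\<^sub>R (x + (1 / L k) *\<^sub>R B k)))
          \<longlonglongrightarrow> g ((\<bar>lam\<bar> powr (1 / 2)) *\<^sub>R (x + (1 / lam) *\<^sub>R b))"
        by (rule isCont_tendsto_compose) (intro tendsto_intros lim; use l0 in auto)
      then show ?thesis
        unfolding coherent_fun_def by (intro tendsto_intros limp lim)
    qed
    show "cmod (coherent_fun g (L k) (A k) (B k) x) \<le> M * C" for k x
      unfolding coherent_fun_def norm_mult norm_of_real norm_cis mult_1_right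
      using M[of k] order_trans[OF norm_ge_zero M[of k]] C by (intro mult_mono) auto
  qed
  then have "(\<lambda>n. coherent_state g (L n) (A n) (B n) - coherent_state g lam a b) \<longlonglongrightarrow> 0"
    unfolding coherent_state_eq by (rule tendsto_norm_zero_cancel)
  then show "((\<lambda>(lam, a, b). coherent_state g lam a b) \<circ> X) \<longlonglongrightarrow> (case p of (lam, a, b) \<Rightarrow> coherent_state g lam a b)"
    by (simp add: comp_def Xe pe LIM_zero_iff)
qed

lemma continuous_coherent_state_phase:
  fixes g :: "real ^ 'n::finite \<Rightarrow> complex"
  assumes "tame g" "lam \<noteq> 0"
  shows "continuous_on UNIV (\<lambda>u. coherent_state g lam (fst u) (snd u))"
  using continuous_on_compose2[OF continuous_coherent_state[OF assms(1)], of UNIV "\<lambda>u. (lam, u)"] assms(2)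
  by (auto simp: case_prod_beta continuous_on_Pair continuous_on_id continuous_on_const)

lemma coherent_state_diff:
  assumes "square_integrable g" "square_integrable h" "lam \<noteq> 0"
  shows "coherent_state (\<lambda>s. g s - h s) lam a b = coherent_state g lam a b - coherent_state h lam a b"
proof -
  have "coherent_fun (\<lambda>s. g s - h s) lam a b = (\<lambda>s. coherent_fun g lam a b s - coherent_fun h lam a b s)"
    by (simp add: fun_eq_iff coherent_fun_def right_diff_distrib)
  then show ?thesis by (simp add: coherent_state_eq l2_of_diff coherent_fun_l2 assms)
qed

text \<open>
  The coefficients of a vector against the coherent states: the short-time Fourier transform, at the
  scale set by \<open>lam\<close>. The power of \<open>lam\<close> is the square root of the density of the measure
  \<open>du / \<bar>lam\<bar>\<^sup>n\<close>, so that the transform is isometric for Lebesgue measure.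
\<close>

definition voice ::
    "(real ^ 'n::finite \<Rightarrow> complex) \<Rightarrow> real \<Rightarrow> (real ^ 'n) l2 \<Rightarrow> (real ^ 'n) \<times> (real ^ 'n) \<Rightarrow> complex" where
  "voice g lam x u = of_real (\<bar>lam\<bar> powr (- (real CARD('n) / 2))) *
    l2_inner x (coherent_state g lam (fst u) (snd u))"

definition voice_l2 ::
    "(real ^ 'n::finite \<Rightarrow> complex) \<Rightarrow> real \<Rightarrow> (real ^ 'n) l2 \<Rightarrow> ((real ^ 'n) \<times> (real ^ 'n)) l2" where
  "voice_l2 g lam x = l2_of (voice g lam x)"

lemma continuous_voice:
  assumes "tame g" "lam \<noteq> 0"
  shows "continuous_on UNIV (voice g lam x)"
  unfolding voice_def[abs_def]
  by (intro continuous_intros bounded_bilinear.continuous_on[OF bounded_bilinear_l2_inner]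
      continuous_coherent_state_phase[OF assms])

text \<open>
  For fixed \<open>b\<close> the coefficients are the Fourier transform, as a function of \<open>a\<close>, of \<open>f\<close> times the
  conjugate of a translated window. Plancherel in \<open>a\<close> turns the square integral into one over \<open>s\<close>, and
  the integral over \<open>b\<close>, taken first, gives the square of the norm of the window after an affine
  substitution.
\<close>

lemma moyal_tame:
  fixes f g :: "real ^ 'n::finite \<Rightarrow> complex"
  assumes f: "tame f" and g: "tame g" and lam: "lam \<noteq> 0"
  shows "(\<integral>\<^sup>+u. ennreal ((cmod (voice g lam (l2_of f) u))\<^sup>2) \<partial>lborel)
    = ennreal ((norm (l2_of g) * norm (l2_of f))\<^sup>2)"
proof -
  let ?n = "real CARD('n)" and ?r = "\<bar>lam\<bar> powr (1 / 2)"
  let ?K = "\<bar>lam\<bar> powr (?n / 4)"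
  have gm[measurable]: "g \<in> borel_measurable borel" and fm[measurable]: "f \<in> borel_measurable borel"
    using tameD(3) f g by auto
  obtain C where C: "C > 0" "\<And>x. cmod (g x) \<le> C" using tame_bound[OF g] by blast
  define F where "F b s = (of_real ?K * cnj (g (?r *\<^sub>R (s + (1 / lam) *\<^sub>R b)))) * f s" for b s
  have tF: "tame (F b)" for b
    unfolding F_def
  proof (rule tame_mult[OF f])
    show "continuous_on UNIV (\<lambda>s. of_real ?K * cnj (g (?r *\<^sub>R (s + (1 / lam) *\<^sub>R b))))"
      by (intro continuous_intros continuous_on_compose2[OF tameD(1)[OF g]]) auto
    show "cmod (of_real ?K * cnj (g (?r *\<^sub>R (s + (1 / lam) *\<^sub>R b)))) \<le> ?K * C" for s
      using C by (auto simp: norm_mult intro!: mult_left_mono)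
  qed
  have inner: "l2_inner (l2_of f) (coherent_state g lam a b) = fourier (F b) a" for a b
    unfolding coherent_state_eq fourier_def
    by (subst l2_inner_of)
       (auto simp: tame_square_integrable f tame_coherent_fun g lam coherent_fun_def F_def cis_cnj
          inner_commute ac_simps intro!: Bochner_Integration.integral_cong)
  have meas: "(\<lambda>u. ennreal ((cmod (voice g lam (l2_of f) u))\<^sup>2)) \<in> borel_measurable (lborel \<Otimes>\<^sub>M lborel)"
    unfolding lborel_prod using borel_measurable_continuous_onI[OF continuous_voice[OF g lam]] by measurable
  have "(\<integral>\<^sup>+u. ennreal ((cmod (voice g lam (l2_of f) u))\<^sup>2) \<partial>lborel)
      = (\<integral>\<^sup>+b. (\<integral>\<^sup>+a. ennreal ((cmod (voice g lam (l2_of f) (a, b)))\<^sup>2) \<partial>lborel) \<partial>lborel)"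
    unfolding lborel_prod[symmetric] by (rule lborel_pair.nn_integral_snd[OF meas, symmetric])
  also have "\<dots> = (\<integral>\<^sup>+b. ennreal (\<bar>lam\<bar> powr (- ?n)) * (\<integral>\<^sup>+a. ennreal ((cmod (fourier (F b) a))\<^sup>2) \<partial>lborel) \<partial>lborel)"
  proof (intro nn_integral_cong)
    fix b :: "real ^ 'n"
    have [measurable]: "fourier (F b) \<in> borel_measurable borel"
      by (intro borel_measurable_continuous_onI continuous_fourier tameD(2) tF)
    have "(cmod (voice g lam (l2_of f) (a, b)))\<^sup>2 = \<bar>lam\<bar> powr (- ?n) * (cmod (fourier (F b) a))\<^sup>2" for a
      by (simp add: voice_def inner norm_mult power_mult_distrib) (simp add: power2_eq_square powr_add[symmetric])
    then show "(\<integral>\<^sup>+a. ennreal ((cmod (voice g lam (l2_of f) (a, b)))\<^sup>2) \<partial>lborel)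
        = ennreal (\<bar>lam\<bar> powr (- ?n)) * (\<integral>\<^sup>+a. ennreal ((cmod (fourier (F b) a))\<^sup>2) \<partial>lborel)"
      by (simp add: ennreal_mult' nn_integral_cmult)
  qed
  also have "\<dots> = (\<integral>\<^sup>+b. ennreal (\<bar>lam\<bar> powr (- ?n)) * (\<integral>\<^sup>+s. ennreal ((cmod (F b s))\<^sup>2) \<partial>lborel) \<partial>lborel)"
  proof -
    have "(\<integral>\<^sup>+a. ennreal ((cmod (fourier (F b) a))\<^sup>2) \<partial>lborel) = (\<integral>\<^sup>+s. ennreal ((cmod (F b s))\<^sup>2) \<partial>lborel)" for b
      using plancherel[OF tF, of b] square_integrable_power2[OF tame_square_integrable[OF tF[of b]]]
      by (subst (1 2) nn_integral_eq_integral) auto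
    then show ?thesis by simp
  qed
  also have "\<dots> = (\<integral>\<^sup>+b. (\<integral>\<^sup>+s. ennreal (\<bar>lam\<bar> powr (- ?n)) * ennreal ((cmod (F b s))\<^sup>2) \<partial>lborel) \<partial>lborel)"
    using tameD(3)[OF tF] by (simp add: nn_integral_cmult)
  also have "\<dots> = (\<integral>\<^sup>+s. (\<integral>\<^sup>+b. ennreal (\<bar>lam\<bar> powr (- ?n)) * ennreal ((cmod (F b s))\<^sup>2) \<partial>lborel) \<partial>lborel)"
    unfolding F_def by (rule lborel_pair.Fubini') measurable
  also have "\<dots> = (\<integral>\<^sup>+s. ennreal ((cmod (f s))\<^sup>2) * ennreal ((norm (l2_of g))\<^sup>2) \<partial>lborel)"
  proof (intro nn_integral_cong)
    fix s :: "real ^ 'n"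
    have F2: "ennreal (\<bar>lam\<bar> powr (- ?n)) * ennreal ((cmod (F b s))\<^sup>2)
        = ennreal ((cmod (f s))\<^sup>2) * (ennreal (\<bar>lam\<bar> powr (- ?n / 2)) * ennreal ((cmod (g (?r *\<^sub>R s + (?r / lam) *\<^sub>R b)))\<^sup>2))" for b
    proof -
      have "\<bar>lam\<bar> powr (- ?n) * (cmod (F b s))\<^sup>2
          = (\<bar>lam\<bar> powr (- ?n) * \<bar>lam\<bar> powr (?n / 2)) * ((cmod (f s))\<^sup>2 * (cmod (g (?r *\<^sub>R s + (?r / lam) *\<^sub>R b)))\<^sup>2)"
        unfolding F_def norm_mult power_mult_distrib
        by (simp add: powr_quarter_square[OF lam] scaleR_add_right ac_simps)
      also have "\<bar>lam\<bar> powr (- ?n) * \<bar>lam\<bar> powr (?n / 2) = \<bar>lam\<bar> powr (- ?n / 2)"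
        by (simp add: powr_add[symmetric])
      finally show ?thesis
        by (simp add: ennreal_mult'[symmetric] ac_simps)
    qed
    \<comment> \<open>As a function of \<open>b\<close> the argument of the window is affine with slope \<open>?r / lam\<close>.\<close>
    have c: "?r / lam \<noteq> 0" using lam by simp
    have pw: "\<bar>?r / lam\<bar> ^ DIM(real ^ 'n) = \<bar>lam\<bar> powr (- ?n / 2)"
    proof -
      have "\<bar>?r / lam\<bar> = \<bar>lam\<bar> powr (1 / 2) / \<bar>lam\<bar> powr 1"
        using lam by (simp add: abs_divide)
      also have "\<dots> = \<bar>lam\<bar> powr (1 / 2 - 1)" by (simp only: powr_diff)
      finally have "\<bar>?r / lam\<bar> = \<bar>lam\<bar> powr (- 1 / 2)" by simp
      then show ?thesis using lam by (simp add: powr_realpow[symmetric] powr_powr)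
    qed
    have "(\<integral>\<^sup>+b. ennreal (\<bar>lam\<bar> powr (- ?n)) * ennreal ((cmod (F b s))\<^sup>2) \<partial>lborel)
        = ennreal ((cmod (f s))\<^sup>2) * (ennreal (\<bar>?r / lam\<bar> ^ DIM(real ^ 'n)) * (\<integral>\<^sup>+b. ennreal ((cmod (g (?r *\<^sub>R s + (?r / lam) *\<^sub>R b)))\<^sup>2) \<partial>lborel))"
      unfolding F2 pw by (simp add: nn_integral_cmult)
    also have "ennreal (\<bar>?r / lam\<bar> ^ DIM(real ^ 'n)) * (\<integral>\<^sup>+b. ennreal ((cmod (g (?r *\<^sub>R s + (?r / lam) *\<^sub>R b)))\<^sup>2) \<partial>lborel)
        = (\<integral>\<^sup>+b. ennreal ((cmod (g b))\<^sup>2) \<partial>lborel)"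
      by (rule nn_integral_lborel_affine[OF c, symmetric]) measurable
    also have "\<dots> = ennreal ((norm (l2_of g))\<^sup>2)" by (rule norm_l2_of_nn[OF tame_square_integrable[OF g]])
    finally show "(\<integral>\<^sup>+b. ennreal (\<bar>lam\<bar> powr (- ?n)) * ennreal ((cmod (F b s))\<^sup>2) \<partial>lborel)
        = ennreal ((cmod (f s))\<^sup>2) * ennreal ((norm (l2_of g))\<^sup>2)" .
  qed
  also have "\<dots> = ennreal ((norm (l2_of f))\<^sup>2) * ennreal ((norm (l2_of g))\<^sup>2)"
    by (subst nn_integral_multc) (simp_all add: norm_l2_of_nn[OF tame_square_integrable[OF f]])
  also have "\<dots> = ennreal ((norm (l2_of g) * norm (l2_of f))\<^sup>2)"
    by (simp add: ennreal_mult'[symmetric] power_mult_distrib mult.commute)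
  finally show ?thesis .
qed

lemma tame_dense:
  fixes x :: "'a::euclidean_space l2"
  assumes e: "e > 0"
  shows "\<exists>f. tame f \<and> norm (x - l2_of f) < e"
proof -
  obtain h where h: "square_integrable h" "x = l2_of h" by (rule l2_cases)
  obtain f where f: "tame f" "(\<integral>x. (cmod (h x - f x))\<^sup>2 \<partial>lborel) < e\<^sup>2"
    using tame_dense_l2[OF h(1), of "e\<^sup>2"] e by auto
  note sf = tame_square_integrable[OF f(1)]
  have "(norm (x - l2_of f))\<^sup>2 < e\<^sup>2"
    using f(2) unfolding h(2) l2_of_diff[OF h(1) sf] norm_l2_of[OF square_integrable_diff[OF h(1) sf]] .
  then have "norm (x - l2_of f) < e" using e by (auto intro: power2_less_imp_less)
  with f(1) show ?thesis by blast
qed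

text \<open>
  For a general vector the bound follows from a sequence of tame approximants by Fatou. The
  approximants stay within \<open>e\<close> of \<open>x\<close>, which gives the sharp constant.
\<close>

lemma voice_bound:
  fixes g :: "real ^ 'n::finite \<Rightarrow> complex"
  assumes g: "tame g" and lam: "lam \<noteq> 0"
  shows "square_integrable (voice g lam x)" "norm (voice_l2 g lam x) \<le> norm (l2_of g) * norm x"
proof -
  have approx: "square_integrable (voice g lam x) \<and> norm (voice_l2 g lam x) \<le> norm (l2_of g) * (norm x + e)"
    if e: "e > 0" for e
  proof -
    have "\<forall>k. \<exists>f. tame f \<and> norm (x - l2_of f) < e * inverse (real (Suc k))"
      using e by (intro allI tame_dense) simp
    then obtain f where f: "\<And>k. tame (f k)" "\<And>k. norm (x - l2_of (f k)) < e * inverse (real (Suc k))" by metis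
    have m: "voice g lam y \<in> borel_measurable borel" for y
      by (rule borel_measurable_continuous_onI[OF continuous_voice[OF g lam]])
    have si: "square_integrable (voice g lam (l2_of (f k)))"
      and nr: "norm (l2_of (voice g lam (l2_of (f k)))) \<le> norm (l2_of g) * (norm x + e)" for k
    proof -
      have N: "(\<integral>\<^sup>+u. ennreal ((cmod (voice g lam (l2_of (f k)) u))\<^sup>2) \<partial>lborel)
          \<le> ennreal ((norm (l2_of g) * norm (l2_of (f k)))\<^sup>2)"
        by (simp add: moyal_tame[OF f(1) g lam])
      then show "square_integrable (voice g lam (l2_of (f k)))" by (intro norm_l2_of_nnD(1)[OF m _ N]) simp
      have "inverse (real (Suc k)) \<le> 1" by (simp add: inverse_le_1_iff)
      then have "e * inverse (real (Suc k)) \<le> e" using e by (simp add: mult_left_le)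
      then have "norm (l2_of (f k)) \<le> norm x + e"
        using f(2)[of k] norm_triangle_ineq4[of x "x - l2_of (f k)"] by simp
      then have "norm (l2_of g) * norm (l2_of (f k)) \<le> norm (l2_of g) * (norm x + e)"
        by (rule mult_left_mono) simp
      with norm_l2_of_nnD(2)[OF m _ N] show "norm (l2_of (voice g lam (l2_of (f k)))) \<le> norm (l2_of g) * (norm x + e)"
        by simp
    qed
    have "(\<lambda>k. l2_of (f k)) \<longlonglongrightarrow> x"
    proof (rule LIM_zero_cancel, rule Lim_null_comparison)
      show "\<forall>\<^sub>F k in sequentially. norm (l2_of (f k) - x) \<le> e * inverse (real (Suc k))"
        using f(2) by (intro always_eventually allI) (simp add: norm_minus_commute less_imp_le)
      show "(\<lambda>k. e * inverse (real (Suc k))) \<longlonglongrightarrow> 0"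
        using tendsto_mult_right_zero[OF LIMSEQ_inverse_real_of_nat] by blast
    qed
    then have "(\<lambda>k. voice g lam (l2_of (f k)) u) \<longlonglongrightarrow> voice g lam x u" for u
      unfolding voice_def
      by (intro tendsto_intros bounded_bilinear.tendsto[OF bounded_bilinear_l2_inner])
    then have lim: "AE u in lborel. (\<lambda>k. voice g lam (l2_of (f k)) u) \<longlonglongrightarrow> voice g lam x u" by simp
    show ?thesis
      using l2_fatou[OF si m lim nr] by (simp add: voice_l2_def)
  qed
  show "square_integrable (voice g lam x)" using approx[of 1] by simp
  show "norm (voice_l2 g lam x) \<le> norm (l2_of g) * norm x"
  proof (rule field_le_epsilon)
    fix e :: real assume e: "e > 0"
    have p: "norm (l2_of g) + 1 > 0" by (simp add: add_nonneg_pos)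
    have "norm (voice_l2 g lam x) \<le> norm (l2_of g) * (norm x + e / (norm (l2_of g) + 1))"
      using approx[of "e / (norm (l2_of g) + 1)"] e p by simp
    also have "\<dots> \<le> norm (l2_of g) * norm x + e"
      using e p by (simp add: distrib_left divide_le_eq mult.commute) 
    finally show "norm (voice_l2 g lam x) \<le> norm (l2_of g) * norm x + e" .
  qed
qed

context
  fixes g :: "real ^ 'n::finite \<Rightarrow> complex" and lam :: real
  assumes g: "tame g" and lam: "lam \<noteq> 0"
begin

lemma voice_l2_add: "voice_l2 g lam (x + y) = voice_l2 g lam x + voice_l2 g lam y"
proof -
  have "voice g lam (x + y) = (\<lambda>u. voice g lam x u + voice g lam y u)"
    by (simp add: fun_eq_iff voice_def l2_inner_add_left distrib_left)
  then show ?thesis by (simp add: voice_l2_def l2_of_add voice_bound[OF g lam])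
qed

lemma voice_l2_scaleC: "voice_l2 g lam (c *\<^sub>C x) = c *\<^sub>C voice_l2 g lam x"
proof -
  have "voice g lam (c *\<^sub>C x) = (\<lambda>u. c * voice g lam x u)"
    by (simp add: fun_eq_iff voice_def l2_inner_scaleC_left)
  then show ?thesis by (simp add: voice_l2_def l2_of_scaleC voice_bound[OF g lam])
qed

lemma voice_l2_diff: "voice_l2 g lam (x - y) = voice_l2 g lam x - voice_l2 g lam y"
  using voice_l2_add[of "x - y" y] by (simp add: eq_diff_eq)

text \<open>
  The Moyal identity. Given the bound, the set of vectors for which equality holds is closed, and it
  contains the tame functions.
\<close>

lemma norm_voice_l2: "norm (voice_l2 g lam x) = norm (l2_of g) * norm x"
proof (rule antisym[OF voice_bound(2)[OF g lam]])
  show "norm (l2_of g) * norm x \<le> norm (voice_l2 g lam x)"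
  proof (rule field_le_epsilon)
    fix e :: real assume e: "e > 0"
    define d where "d = e / (2 * (norm (l2_of g) + 1))"
    have p: "norm (l2_of g) + 1 > 0" by (simp add: add_nonneg_pos)
    then have d: "d > 0" using e by (simp add: d_def)
    have "2 * (norm (l2_of g) * d) \<le> 2 * ((norm (l2_of g) + 1) * d)" using d by simp
    also have "\<dots> = e"
    proof -
      have "2 * (p * (e / (2 * p))) = e" if "p > 0" for p :: real using that by simp
      from this[OF p] show ?thesis by (simp only: d_def)
    qed
    finally have de: "2 * (norm (l2_of g) * d) \<le> e" .
    obtain f where f: "tame f" "norm (x - l2_of f) < d" using tame_dense[OF d] by blast
    have "ennreal ((norm (voice_l2 g lam (l2_of f)))\<^sup>2) = ennreal ((norm (l2_of g) * norm (l2_of f))\<^sup>2)"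
      unfolding voice_l2_def norm_l2_of_nn[OF voice_bound(1)[OF g lam], symmetric] by (rule moyal_tame[OF f(1) g lam])
    then have "(norm (voice_l2 g lam (l2_of f)))\<^sup>2 = (norm (l2_of g) * norm (l2_of f))\<^sup>2" by simp
    then have 1: "norm (voice_l2 g lam (l2_of f)) = norm (l2_of g) * norm (l2_of f)" by simp
    have "norm (l2_of g) * norm (x - l2_of f) \<le> norm (l2_of g) * d"
      using f(2) by (intro mult_left_mono) auto
    moreover have "norm (voice_l2 g lam (x - l2_of f)) \<le> norm (l2_of g) * norm (x - l2_of f)"
      by (rule voice_bound(2)[OF g lam])
    moreover have "norm (voice_l2 g lam (l2_of f)) \<le> norm (voice_l2 g lam x) + norm (voice_l2 g lam (x - l2_of f))"
      unfolding voice_l2_diff by norm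
    moreover have "norm (l2_of g) * norm x \<le> norm (l2_of g) * (norm (l2_of f) + norm (x - l2_of f))"
      using norm_triangle_ineq[of "l2_of f" "x - l2_of f"] by (intro mult_left_mono) auto
    ultimately show "norm (l2_of g) * norm x \<le> norm (voice_l2 g lam x) + e"
      using 1 de by (simp add: distrib_left)
  qed
qed

lemma l2_inner_voice_l2: "l2_inner (voice_l2 g lam x) (voice_l2 g lam y) = of_real ((norm (l2_of g))\<^sup>2) * l2_inner x y"
proof -
  have re: "inner (voice_l2 g lam x) (voice_l2 g lam y) = (norm (l2_of g))\<^sup>2 * inner x y" for x y
    unfolding dot_norm voice_l2_add[symmetric] norm_voice_l2 by (simp add: power_mult_distrib algebra_simps)
  show ?thesis
    unfolding l2_inner_eq_inner voice_l2_scaleC[symmetric] re by (simp add: complex_eq_iff)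
qed

end

lemma voice_l2_window_diff:
  assumes "tame g" "tame h" "lam \<noteq> 0"
  shows "voice_l2 (\<lambda>s. g s - h s) lam x = voice_l2 g lam x - voice_l2 h lam x"
proof -
  have "voice (\<lambda>s. g s - h s) lam x = (\<lambda>u. voice g lam x u - voice h lam x u)"
    by (simp add: fun_eq_iff voice_def coherent_state_diff tame_square_integrable assms
        l2_inner_diff_right right_diff_distrib)
  then show ?thesis by (simp add: voice_l2_def l2_of_diff voice_bound assms)
qed

section \<open>Rank one operators and operator-valued integrals\<close>

lemma bounded_bilinear_scaleC:
  "bounded_bilinear (\<lambda>(c::complex) (x::'a::complex_normed_vector). c *\<^sub>C x)"
proof
  show "\<exists>K. \<forall>a (b::'a). norm (a *\<^sub>C b) \<le> norm a * norm b * K"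
    by (auto intro!: exI[of _ 1] simp: norm_scaleC)
  fix r :: real and a :: complex and b :: 'a
  show "(r *\<^sub>R a) *\<^sub>C b = r *\<^sub>R (a *\<^sub>C b)"
    by (simp add: scaleC_of_real[symmetric] scaleC_scaleC scaleR_conv_of_real)
  show "a *\<^sub>C (r *\<^sub>R b) = r *\<^sub>R (a *\<^sub>C b)"
    by (simp add: scaleC_of_real[symmetric] scaleC_scaleC mult.commute)
qed (simp_all add: scaleC_add_left scaleC_add_right)

lemma bounded_linear_rank_one: "bounded_linear (\<lambda>x. l2_inner x v *\<^sub>C (w :: 'b::complex_normed_vector))"
  by (rule bounded_linear_compose[OF
      bounded_bilinear.bounded_linear_left[OF bounded_bilinear_scaleC]
      bounded_bilinear.bounded_linear_left[OF bounded_bilinear_l2_inner]])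

definition rank_one :: "'a::euclidean_space l2 \<Rightarrow> 'a l2 \<Rightarrow> 'a l2 \<Rightarrow>\<^sub>L 'a l2" where
  "rank_one v w = Blinfun (\<lambda>x. l2_inner x v *\<^sub>C w)"

lemma rank_one_apply [simp]: "blinfun_apply (rank_one v w) x = l2_inner x v *\<^sub>C w"
  by (simp add: rank_one_def bounded_linear_Blinfun_apply bounded_linear_rank_one)

lemma bounded_bilinear_rank_one: "bounded_bilinear rank_one"
proof
  fix a a' b b' :: "'a l2" and r :: real
  show "rank_one (a + a') b = rank_one a b + rank_one a' b"
    by (rule blinfun_eqI) (simp add: blinfun.add_left l2_inner_add_right scaleC_add_left)
  show "rank_one a (b + b') = rank_one a b + rank_one a b'"
    by (rule blinfun_eqI) (simp add: blinfun.add_left scaleC_add_right)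
  show "rank_one (r *\<^sub>R a) b = r *\<^sub>R rank_one a b"
    by (rule blinfun_eqI)
       (simp add: blinfun.scaleR_left l2_inner_scaleR_right scaleC_scaleC[symmetric] scaleC_of_real)
  show "rank_one a (r *\<^sub>R b) = r *\<^sub>R rank_one a b"
    by (rule blinfun_eqI)
       (simp add: blinfun.scaleR_left, simp add: scaleC_of_real[symmetric] scaleC_scaleC mult.commute)
  show "\<exists>K. \<forall>a b. norm (rank_one a b :: 'a l2 \<Rightarrow>\<^sub>L 'a l2) \<le> norm a * norm b * K"
  proof (intro exI[of _ 1] allI)
    fix a b :: "'a l2"
    show "norm (rank_one a b) \<le> norm a * norm b * 1"
    proof (rule norm_blinfun_bound)
      fix x
      have "cmod (l2_inner x a) * norm b \<le> norm x * norm a * norm b"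
        by (intro mult_right_mono l2_cauchy_schwarz) simp
      then show "norm (blinfun_apply (rank_one a b) x) \<le> norm a * norm b * 1 * norm x"
        by (simp add: norm_scaleC ac_simps)
    qed simp
  qed
qed

lemma orthogonal_projection_line:
  fixes v :: "(real ^ 'n::finite) l2"
  assumes v: "norm v = 1"
  shows "orthogonal_projection (range (\<lambda>c. c *\<^sub>C v)) = rank_one v v"
  unfolding orthogonal_projection_def
proof (rule the_equality)
  have vv: "l2_inner v v = 1" using v by (simp add: l2_inner_self)
  show "\<forall>x. blinfun_apply (rank_one v v) x \<in> range (\<lambda>c. c *\<^sub>C v) \<and>
      (\<forall>y\<in>range (\<lambda>c. c *\<^sub>C v). l2_inner (x - blinfun_apply (rank_one v v) x) y = 0)"
    by (auto simp: l2_inner_diff_left l2_inner_scaleC_left l2_inner_scaleC_right vv)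
  fix P :: "'n l2_operator"
  assume P: "\<forall>x. blinfun_apply P x \<in> range (\<lambda>c. c *\<^sub>C v) \<and>
      (\<forall>y\<in>range (\<lambda>c. c *\<^sub>C v). l2_inner (x - blinfun_apply P x) y = 0)"
  show "P = rank_one v v"
  proof (rule blinfun_eqI)
    fix x
    obtain c where c: "blinfun_apply P x = c *\<^sub>C v" using P by blast
    have v1: "1 *\<^sub>C v = v" using scaleC_of_real[of 1 v] by simp
    then have "v \<in> range (\<lambda>c. c *\<^sub>C v)" by (metis rangeI)
    then have "l2_inner (x - c *\<^sub>C v) v = 0" using P c by metis
    then have "l2_inner x v = c" by (simp add: l2_inner_diff_left l2_inner_scaleC_left vv)
    then show "blinfun_apply P x = blinfun_apply (rank_one v v) x" by (simp add: c)
  qed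
qed

lemma integrable_on_UNIV_dominated:
  fixes f :: "'a::euclidean_space \<Rightarrow> 'b::banach"
  assumes "continuous_on UNIV f" "\<And>x. norm (f x) \<le> g x" "integrable lborel g"
  shows "f integrable_on UNIV"
proof (rule integrable_on_all_intervals_integrable_bound)
  show "(\<lambda>x. if x \<in> UNIV then f x else 0) integrable_on cbox a b" for a b
    using integrable_continuous[OF continuous_on_subset[OF assms(1)], of a b] by simp
  show "g integrable_on UNIV" using integrable_on_lborel[OF assms(3)] .
qed (use assms in auto)

text \<open>
  Riemann sums lie in the subspace and converge to the integral.
\<close>

lemma has_integral_in_closed_subspace:
  fixes f :: "'a::euclidean_space \<Rightarrow> 'b::real_normed_vector"
  assumes f: "(f has_integral y) UNIV" and S: "closed S" "subspace S" and fS: "\<And>x. f x \<in> S"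
  shows "y \<in> S"
proof -
  have box: "z \<in> S" if z: "(f has_integral z) (cbox a b)" for z a b
  proof -
    have "z \<in> closure S"
      unfolding closure_approachable
    proof (intro allI impI)
      fix e :: real assume "e > 0"
      with z have "\<exists>d. gauge d \<and> (\<forall>p. p tagged_division_of cbox a b \<and> d fine p \<longrightarrow>
          norm ((\<Sum>(x, k)\<in>p. measure lborel k *\<^sub>R f x) - z) < e)"
        unfolding has_integral by (elim allE impE)
      then obtain d where d: "gauge d" "\<forall>p. p tagged_division_of cbox a b \<and> d fine p \<longrightarrow>
          norm ((\<Sum>(x, k)\<in>p. measure lborel k *\<^sub>R f x) - z) < e" by (elim exE conjE)
      obtain p where p: "p tagged_division_of cbox a b" "d fine p"
        by (rule fine_division_exists[OF d(1)])
      have "(\<Sum>(x, k)\<in>p. measure lborel k *\<^sub>R f x) \<in> S"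
        using S(2) fS by (auto intro!: subspace_sum subspace_scale simp: case_prod_beta)
      moreover have "norm ((\<Sum>(x, k)\<in>p. measure lborel k *\<^sub>R f x) - z) < e"
        using d(2) p by simp
      ultimately show "\<exists>s\<in>S. dist s z < e" unfolding dist_norm by blast
    qed
    then show ?thesis using S(1) by simp
  qed
  have "y \<in> closure S"
    unfolding closure_approachable
  proof (intro allI impI)
    fix e :: real assume e: "e > 0"
    have "\<not> (\<exists>a b. (UNIV :: 'a set) = cbox a b)"
      by (metis not_bounded_UNIV bounded_cbox)
    then obtain B where B: "B > 0" "\<forall>a b. ball 0 B \<subseteq> cbox a b \<longrightarrow>
        (\<exists>z. ((\<lambda>x. if x \<in> UNIV then f x else 0) has_integral z) (cbox a b) \<and> norm (z - y) < e)"
      by (rule has_integral_altD[OF f _ e])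
    obtain a :: 'a where "ball 0 B \<subseteq> cbox (- a) a"
      using bounded_subset_cbox_symmetric[OF bounded_ball] by metis
    with B(2) obtain z where "(f has_integral z) (cbox (- a) a)" "norm (z - y) < e" by simp blast
    with box show "\<exists>s\<in>S. dist s y < e" by (auto simp: dist_norm)
  qed
  then show ?thesis using S(1) by simp
qed

section \<open>Multiplication operators\<close>

definition l2_mult :: "('a::euclidean_space \<Rightarrow> complex) \<Rightarrow> 'a l2 \<Rightarrow> 'a l2" where
  "l2_mult \<phi> F = l2_of (\<lambda>u. \<phi> u * rep_l2 F u)"

context
  fixes \<phi> :: "'a::euclidean_space \<Rightarrow> complex" and C :: real
  assumes \<phi>: "\<phi> \<in> borel_measurable borel" and C: "\<And>u. cmod (\<phi> u) \<le> C"
begin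

lemma square_integrable_mult:
  assumes f: "square_integrable f"
  shows "square_integrable (\<lambda>u. \<phi> u * f u)"
proof -
  note [measurable] = \<phi> square_integrable_measurable[OF f]
  have C0: "0 \<le> C" using order_trans[OF norm_ge_zero C] .
  have "integrable lborel (\<lambda>u. (cmod (\<phi> u * f u))\<^sup>2)"
  proof (rule Bochner_Integration.integrable_bound)
    show "integrable lborel (\<lambda>u. C\<^sup>2 * (cmod (f u))\<^sup>2)"
      by (intro integrable_mult_right square_integrable_power2 f)
    show "AE u in lborel. norm ((cmod (\<phi> u * f u))\<^sup>2) \<le> norm (C\<^sup>2 * (cmod (f u))\<^sup>2)"
      using C C0 by (auto simp: norm_mult power_mult_distrib intro!: AE_I2 mult_right_mono power_mono)
  qed simp
  then show ?thesis by (simp add: square_integrable_def)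
qed

lemma l2_mult_of:
  assumes f: "square_integrable f"
  shows "l2_mult \<phi> (l2_of f) = l2_of (\<lambda>u. \<phi> u * f u)"
  unfolding l2_mult_def
  by (rule l2_of_eqI) (use rep_l2_of[OF f] in \<open>auto intro: square_integrable_mult square_integrable_rep f\<close>)

lemma norm_l2_mult_le: "norm (l2_mult \<phi> F) \<le> C * norm F"
proof -
  obtain f where f: "square_integrable f" "F = l2_of f" by (rule l2_cases)
  have C0: "0 \<le> C" using order_trans[OF norm_ge_zero C] .
  have "(norm (l2_mult \<phi> F))\<^sup>2 = (\<integral>u. (cmod (\<phi> u * f u))\<^sup>2 \<partial>lborel)"
    by (simp only: f(2) l2_mult_of[OF f(1)] norm_l2_of[OF square_integrable_mult[OF f(1)]])
  also have "\<dots> \<le> (\<integral>u. C\<^sup>2 * (cmod (f u))\<^sup>2 \<partial>lborel)"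
    using C C0 by (intro integral_mono square_integrable_power2 square_integrable_mult integrable_mult_right f)
      (auto simp: norm_mult power_mult_distrib intro!: mult_right_mono power_mono)
  also have "\<dots> = (C * norm F)\<^sup>2"
    by (simp add: f(2) norm_l2_of[OF f(1)] power_mult_distrib)
  finally show ?thesis by (rule power2_le_imp_le) (use C0 in simp)
qed

lemma l2_mult_add: "l2_mult \<phi> (F + G) = l2_mult \<phi> F + l2_mult \<phi> G"
proof -
  obtain f g where f: "square_integrable f" "F = l2_of f" "square_integrable g" "G = l2_of g"
    by (metis l2_cases)
  then show ?thesis
    by (simp add: l2_of_add l2_mult_of square_integrable_add square_integrable_mult distrib_left)
qed

lemma l2_mult_scaleC: "l2_mult \<phi> (c *\<^sub>C F) = c *\<^sub>C l2_mult \<phi> F"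
proof -
  obtain f where f: "square_integrable f" "F = l2_of f" by (rule l2_cases)
  then show ?thesis
    by (simp add: l2_of_scaleC l2_mult_of square_integrable_scale square_integrable_mult ac_simps)
qed

end

lemma l2_mult_cnj:
  assumes "\<phi> \<in> borel_measurable borel" "\<And>u. cmod (\<phi> u) \<le> C"
  shows "l2_inner (l2_mult (\<lambda>u. cnj (\<phi> u)) F) G = l2_inner F (l2_mult \<phi> G)"
proof -
  obtain f g where f: "square_integrable f" "F = l2_of f" "square_integrable g" "G = l2_of g"
    by (metis l2_cases)
  have a: "(\<lambda>u. cnj (\<phi> u)) \<in> borel_measurable borel" "\<And>u. cmod (cnj (\<phi> u)) \<le> C" using assms by auto
  show ?thesis
    using f by (simp add: l2_mult_of[OF a] l2_mult_of[OF assms] l2_inner_of square_integrable_mult[OF a]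
      square_integrable_mult[OF assms]) (simp add: ac_simps)
qed

lemma l2_mult_diff_symbol:
  assumes "\<phi> \<in> borel_measurable borel" "\<And>u. cmod (\<phi> u) \<le> C"
    "\<psi> \<in> borel_measurable borel" "\<And>u. cmod (\<psi> u) \<le> D"
  shows "l2_mult (\<lambda>u. \<phi> u - \<psi> u) F = l2_mult \<phi> F - l2_mult \<psi> F"
proof -
  obtain f where f: "square_integrable f" "F = l2_of f" by (rule l2_cases)
  have s: "square_integrable (\<lambda>u. \<phi> u * f u)" "square_integrable (\<lambda>u. \<psi> u * f u)"
    using square_integrable_mult[OF assms(1,2) f(1)] square_integrable_mult[OF assms(3,4) f(1)] by auto
  have "l2_mult (\<lambda>u. \<phi> u - \<psi> u) F = l2_of (\<lambda>u. (\<phi> u - \<psi> u) * f u)"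
    unfolding f(2) using assms
    by (intro l2_mult_of[of _ "C + D"] f) (auto intro: order_trans[OF norm_triangle_ineq4] add_mono)
  also have "\<dots> = l2_mult \<phi> F - l2_mult \<psi> F"
    unfolding f(2) l2_mult_of[OF assms(1,2) f(1)] l2_mult_of[OF assms(3,4) f(1)] l2_of_diff[OF s]
    by (simp add: left_diff_distrib)
  finally show ?thesis .
qed

lemma l2_mult_mult:
  assumes "\<phi> \<in> borel_measurable borel" "\<And>u. cmod (\<phi> u) \<le> C"
    "\<psi> \<in> borel_measurable borel" "\<And>u. cmod (\<psi> u) \<le> D"
  shows "l2_mult (\<lambda>u. \<phi> u * \<psi> u) F = l2_mult \<phi> (l2_mult \<psi> F)"
proof -
  obtain f where f: "square_integrable f" "F = l2_of f" by (rule l2_cases)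
  have "l2_mult (\<lambda>u. \<phi> u * \<psi> u) F = l2_of (\<lambda>u. (\<phi> u * \<psi> u) * f u)"
    unfolding f(2) using assms order_trans[OF norm_ge_zero assms(2)]
    by (intro l2_mult_of[of _ "C * D"] f) (auto simp: norm_mult intro!: mult_mono)
  also have "\<dots> = l2_mult \<phi> (l2_mult \<psi> F)"
    unfolding f(2) l2_mult_of[OF assms(3,4) f(1)]
      l2_mult_of[OF assms(1,2) square_integrable_mult[OF assms(3,4) f(1)]]
    by (simp add: mult.assoc)
  finally show ?thesis .
qed

lemma gelfand_measurable [measurable]: "gelfand (h :: 'a::euclidean_space group_cstar) \<in> borel_measurable borel"
  by (rule borel_measurable_continuous_onI[OF continuous_gelfand])

section \<open>The operators as compressed multiplication operators\<close>

lemma schwartz_sequence: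
  fixes x :: "'a::euclidean_space group_cstar"
  shows "\<exists>f. (\<forall>k::nat. schwartz (f k)) \<and> (\<lambda>k. cstar_of_l1 (f k)) \<longlonglongrightarrow> x"
proof -
  have "\<forall>k. \<exists>f. schwartz f \<and> norm (x - cstar_of_l1 f) < inverse (real (Suc k))"
    by (intro allI schwartz_dense_cstar) simp
  then obtain f where f: "\<And>k. schwartz (f k)" "\<And>k. norm (x - cstar_of_l1 (f k)) < inverse (real (Suc k))" by metis
  have "(\<lambda>k. cstar_of_l1 (f k) - x) \<longlonglongrightarrow> 0"
  proof (rule Lim_null_comparison[OF _ LIMSEQ_inverse_real_of_nat])
    show "\<forall>\<^sub>F k in sequentially. norm (cstar_of_l1 (f k) - x) \<le> inverse (real (Suc k))"
      using f(2) by (intro always_eventually allI) (subst norm_minus_commute, rule less_imp_le)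
  qed
  then show ?thesis using f(1) by (auto simp: LIM_zero_iff)
qed

lemma continuous_extension_unique:
  fixes N N' :: "'a::euclidean_space group_cstar \<Rightarrow> 'b::real_normed_vector"
  assumes "continuous_on UNIV N" "continuous_on UNIV N'"
    and eq: "\<And>h. schwartz h \<Longrightarrow> N (cstar_of_l1 h) = N' (cstar_of_l1 h)"
  shows "N x = N' x"
proof -
  obtain f where f: "\<And>k. schwartz (f k)" and "(\<lambda>k. cstar_of_l1 (f k)) \<longlonglongrightarrow> x"
    using schwartz_sequence[of x] by blast
  then have "(\<lambda>k. N (cstar_of_l1 (f k))) \<longlonglongrightarrow> N x" "(\<lambda>k. N' (cstar_of_l1 (f k))) \<longlonglongrightarrow> N' x"
    using assms(1,2) by (auto intro: continuous_on_tendsto_compose[of UNIV])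
  then show ?thesis using LIMSEQ_unique by (simp add: eq[OF f])
qed

definition coherent_projection ::
    "(real ^ 'n::finite \<Rightarrow> complex) \<Rightarrow> real \<Rightarrow> (real ^ 'n) \<times> (real ^ 'n) \<Rightarrow> 'n l2_operator" where
  "coherent_projection \<eta> lam u = (1 / of_real (\<bar>lam\<bar> ^ CARD('n))) *\<^sub>C
    rank_one (coherent_state \<eta> lam (fst u) (snd u)) (coherent_state \<eta> lam (fst u) (snd u))"

definition nu_integral ::
    "(real ^ 'n::finite \<Rightarrow> complex) \<Rightarrow> real \<Rightarrow> ((real ^ 'n) \<times> (real ^ 'n) \<Rightarrow> complex) \<Rightarrow> 'n l2_operator" where
  "nu_integral \<eta> lam \<phi> = integral UNIV (\<lambda>u. \<phi> u *\<^sub>C coherent_projection \<eta> lam u)"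

text \<open>
  The weak form of \<open>T = V\<^sup>* M V\<close>, where \<open>V\<close> is the isometry \<open>voice_l2 \<eta> lam\<close> and \<open>M\<close> is multiplication by
  \<open>\<phi>\<close>. Such operators are known as localisation or Toeplitz operators with symbol \<open>\<phi>\<close>. The weak form
  also makes sense for bounded symbols that are not integrable, which an operator-valued integral does
  not reach.
\<close>

definition toeplitz ::
    "(real ^ 'n::finite \<Rightarrow> complex) \<Rightarrow> real \<Rightarrow> ((real ^ 'n) \<times> (real ^ 'n) \<Rightarrow> complex) \<Rightarrow> 'n l2_operator \<Rightarrow> bool" where
  "toeplitz \<eta> lam \<phi> T \<longleftrightarrow>
    (\<forall>x y. l2_inner (blinfun_apply T x) y = l2_inner (l2_mult \<phi> (voice_l2 \<eta> lam x)) (voice_l2 \<eta> lam y))"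

context
  fixes \<eta> :: "real ^ 'n::finite \<Rightarrow> complex"
  assumes \<eta>: "tame \<eta>" and \<eta>1: "norm (l2_of \<eta>) = 1"
begin

lemma norm_coherent_state: "lam \<noteq> 0 \<Longrightarrow> norm (coherent_state \<eta> lam a b) = 1"
  using coherent_fun_l2(2)[OF _ tame_square_integrable[OF \<eta>]] \<eta>1 by simp

lemma nu_schwartz_eq: "lam \<noteq> 0 \<Longrightarrow> nu_schwartz \<eta> lam h = nu_integral \<eta> lam (fourier h)"
  unfolding nu_schwartz_def nu_integral_def case_prod_beta
  by (simp add: orthogonal_projection_line norm_coherent_state coherent_projection_def scaleC_scaleC)

lemma norm_rank_one_coherent:
  assumes "lam \<noteq> 0"
  shows "norm (rank_one (coherent_state \<eta> lam a b) (coherent_state \<eta> lam a b)) \<le> 1"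
proof (rule norm_blinfun_bound)
  fix x
  show "norm (blinfun_apply (rank_one (coherent_state \<eta> lam a b) (coherent_state \<eta> lam a b)) x) \<le> 1 * norm x"
    using l2_cauchy_schwarz[of x "coherent_state \<eta> lam a b"]
    by (simp add: norm_scaleC norm_coherent_state[OF assms])
qed simp

lemma norm_coherent_projection: "lam \<noteq> 0 \<Longrightarrow> norm (coherent_projection \<eta> lam u) \<le> 1 / \<bar>lam\<bar> ^ CARD('n)"
  using norm_rank_one_coherent[of lam "fst u" "snd u"]
  by (simp add: coherent_projection_def norm_scaleC norm_divide norm_power divide_right_mono)

lemma continuous_coherent_projection:
  "continuous_on ({lam. lam \<noteq> 0} \<times> UNIV) (\<lambda>p. coherent_projection \<eta> (fst p) (snd p))"
proof -
  have c: "continuous_on ({lam. lam \<noteq> 0} \<times> UNIV) (\<lambda>p. coherent_state \<eta> (fst p) (fst (snd p)) (snd (snd p)))"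
    using continuous_coherent_state[OF \<eta>] by (simp add: case_prod_beta)
  show ?thesis
    unfolding coherent_projection_def
    by (intro bounded_bilinear.continuous_on[OF bounded_bilinear_scaleC]
        bounded_bilinear.continuous_on[OF bounded_bilinear_rank_one] c continuous_intros) auto
qed

lemma continuous_coherent_projection_phase:
  "lam \<noteq> 0 \<Longrightarrow> continuous_on UNIV (coherent_projection \<eta> lam)"
  using continuous_on_compose2[OF continuous_coherent_projection, of UNIV "\<lambda>u. (lam, u)"]
  by (auto simp: continuous_on_Pair continuous_on_id continuous_on_const)

lemma nu_integral_exists:
  assumes lam: "lam \<noteq> 0" and \<phi>: "continuous_on UNIV \<phi>" "integrable lborel \<phi>"
  shows "((\<lambda>u. \<phi> u *\<^sub>C coherent_projection \<eta> lam u) has_integral nu_integral \<eta> lam \<phi>) UNIV"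
  unfolding nu_integral_def
proof (rule integrable_integral, rule integrable_on_UNIV_dominated)
  show "integrable lborel (\<lambda>u. cmod (\<phi> u) * (1 / \<bar>lam\<bar> ^ CARD('n)))" using \<phi>(2) by simp
  show "continuous_on UNIV (\<lambda>u. \<phi> u *\<^sub>C coherent_projection \<eta> lam u)"
    by (intro bounded_bilinear.continuous_on[OF bounded_bilinear_scaleC] \<phi>(1)
        continuous_coherent_projection_phase lam)
  show "norm (\<phi> u *\<^sub>C coherent_projection \<eta> lam u) \<le> cmod (\<phi> u) * (1 / \<bar>lam\<bar> ^ CARD('n))" for u
    unfolding norm_scaleC by (intro mult_left_mono norm_coherent_projection lam) simp
qed

text \<open>
  Apply the functional \<open>T \<mapsto> l2_inner (T x) y\<close> to the operator-valued integral.
\<close>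

lemma toeplitz_nu_integral:
  assumes lam: "lam \<noteq> 0" and \<phi>: "continuous_on UNIV \<phi>" "integrable lborel \<phi>" and C: "\<And>u. cmod (\<phi> u) \<le> C"
  shows "toeplitz \<eta> lam \<phi> (nu_integral \<eta> lam \<phi>)"
  unfolding toeplitz_def
proof (intro allI)
  fix x y :: "(real ^ 'n) l2"
  let ?c = "\<lambda>u. coherent_state \<eta> lam (fst u) (snd u)"
  let ?v = "voice \<eta> lam"
  have m: "\<phi> \<in> borel_measurable borel" by (rule borel_measurable_continuous_onI[OF \<phi>(1)])
  have bl: "bounded_linear (\<lambda>T. l2_inner (blinfun_apply T x) y)"
    by (rule bounded_linear_compose[OF bounded_bilinear.bounded_linear_left[OF bounded_bilinear_l2_inner]
          blinfun.bounded_linear_left])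
  have n: "\<bar>lam\<bar> powr (- (real CARD('n) / 2)) * \<bar>lam\<bar> powr (- (real CARD('n) / 2)) = 1 / \<bar>lam\<bar> ^ CARD('n)"
    using lam by (simp add: powr_add[symmetric] powr_minus powr_realpow inverse_eq_divide)
  have eq: "l2_inner (blinfun_apply (\<phi> u *\<^sub>C coherent_projection \<eta> lam u) x) y
      = (\<phi> u * ?v x u) * cnj (?v y u)" for u
  proof -
    have "l2_inner (blinfun_apply (\<phi> u *\<^sub>C coherent_projection \<eta> lam u) x) y
        = \<phi> u * of_real (1 / \<bar>lam\<bar> ^ CARD('n)) * (l2_inner x (?c u) * cnj (l2_inner y (?c u)))"
      using l2_inner_commute[of "?c u" y]
      by (simp add: coherent_projection_def scaleC_blinfun.rep_eq l2_inner_scaleC_left)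
    also have "\<dots> = (\<phi> u * ?v x u) * cnj (?v y u)"
      unfolding n[symmetric] voice_def by (simp add: ac_simps)
    finally show ?thesis .
  qed
  have 1: "((\<lambda>u. (\<phi> u * ?v x u) * cnj (?v y u)) has_integral l2_inner (blinfun_apply (nu_integral \<eta> lam \<phi>) x) y) UNIV"
    using has_integral_linear[OF nu_integral_exists[OF lam \<phi>] bl] by (simp only: comp_def eq)
  note s = voice_bound(1)[OF \<eta> lam]
  have sm: "square_integrable (\<lambda>u. \<phi> u * ?v x u)" by (rule square_integrable_mult[OF m C s])
  have "((\<lambda>u. (\<phi> u * ?v x u) * cnj (?v y u)) has_integral (\<integral>u. (\<phi> u * ?v x u) * cnj (?v y u) \<partial>lborel)) UNIV"
    by (rule has_integral_integral_lborel[OF square_integrable_inner[OF sm s]])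
  with 1 have "l2_inner (blinfun_apply (nu_integral \<eta> lam \<phi>) x) y = (\<integral>u. (\<phi> u * ?v x u) * cnj (?v y u) \<partial>lborel)"
    by (rule has_integral_unique)
  also have "\<dots> = l2_inner (l2_mult \<phi> (voice_l2 \<eta> lam x)) (voice_l2 \<eta> lam y)"
    unfolding voice_l2_def l2_mult_of[OF m C s] l2_inner_of[OF sm s] ..
  finally show "l2_inner (blinfun_apply (nu_integral \<eta> lam \<phi>) x) y
      = l2_inner (l2_mult \<phi> (voice_l2 \<eta> lam x)) (voice_l2 \<eta> lam y)" .
qed

lemma norm_voice_eta: "lam \<noteq> 0 \<Longrightarrow> norm (voice_l2 \<eta> lam x) = norm x"
  using norm_voice_l2[OF \<eta>, of lam x] by (simp add: \<eta>1)

text \<open>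
  Compression by an isometry does not increase the norm of a multiplication operator, which is at most
  the supremum of the symbol.
\<close>

lemma toeplitz_norm_le:
  assumes lam: "lam \<noteq> 0" and T: "toeplitz \<eta> lam \<phi> T"
    and m: "\<phi> \<in> borel_measurable borel" "\<And>u. cmod (\<phi> u) \<le> C"
  shows "norm T \<le> C"
proof (rule norm_blinfun_bound)
  show C: "0 \<le> C" using order_trans[OF norm_ge_zero m(2)] .
  fix x
  show "norm (blinfun_apply T x) \<le> C * norm x"
  proof (rule norm_l2_leI)
    fix y
    have "cmod (l2_inner (blinfun_apply T x) y) \<le> norm (l2_mult \<phi> (voice_l2 \<eta> lam x)) * norm (voice_l2 \<eta> lam y)"
      using T l2_cauchy_schwarz unfolding toeplitz_def by metis
    also have "\<dots> \<le> (C * norm (voice_l2 \<eta> lam x)) * norm (voice_l2 \<eta> lam y)"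
      by (intro mult_right_mono norm_l2_mult_le m) simp
    finally show "cmod (l2_inner (blinfun_apply T x) y) \<le> C * norm x * norm y"
      by (simp add: norm_voice_eta[OF lam])
  qed (use C in simp)
qed

lemma toeplitz_unique: "toeplitz \<eta> lam \<phi> S \<Longrightarrow> toeplitz \<eta> lam \<phi> T \<Longrightarrow> S = T"
  unfolding toeplitz_def by (intro blinfun_eqI l2_eqI) simp

lemma toeplitz_diff:
  assumes "toeplitz \<eta> lam \<phi> S" "toeplitz \<eta> lam \<psi> T"
    "\<phi> \<in> borel_measurable borel" "\<And>u. cmod (\<phi> u) \<le> C"
    "\<psi> \<in> borel_measurable borel" "\<And>u. cmod (\<psi> u) \<le> D"
  shows "toeplitz \<eta> lam (\<lambda>u. \<phi> u - \<psi> u) (S - T)"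
  using assms(1,2) unfolding toeplitz_def l2_mult_diff_symbol[OF assms(3-6)]
  by (simp add: blinfun.diff_left l2_inner_diff_left)

text \<open>
  On the dense set of Schwartz functions the operators depend only on the symbol, and the norm of the
  difference of two of them is at most the supremum of the difference of the symbols. So the
  unique continuous extension in the definition of \<open>nu\<close> exists.
\<close>

lemma nu_characterisation:
  assumes lam: "lam \<noteq> 0"
  shows "continuous_on UNIV (nu \<eta> lam)"
    and "\<And>h. schwartz h \<Longrightarrow> nu \<eta> lam (cstar_of_l1 h) = nu_integral \<eta> lam (fourier h)"
proof -
  let ?S = "cstar_of_l1 ` {h :: (real ^ 'n) \<times> (real ^ 'n) \<Rightarrow> complex. schwartz h}"
  let ?f = "\<lambda>x. nu_integral \<eta> lam (gelfand x)"
  have gS: "gelfand (cstar_of_l1 h) = fourier h" if "schwartz h" for h :: "(real ^ 'n) \<times> (real ^ 'n) \<Rightarrow> complex"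
    by (intro gelfand_cstar_of_l1 tameD(2) schwartz_tame that)
  have T: "toeplitz \<eta> lam (gelfand x) (?f x)" if x: "x \<in> ?S" for x
  proof -
    obtain h where h: "schwartz h" "x = cstar_of_l1 h" using x by blast
    show ?thesis
      by (rule toeplitz_nu_integral[OF lam continuous_gelfand _ norm_gelfand_le])
         (simp add: h gS integrable_fourier_schwartz)
  qed
  have lip: "norm (?f x - ?f y) \<le> norm (x - y)" if "x \<in> ?S" "y \<in> ?S" for x y
  proof -
    have "toeplitz \<eta> lam (\<lambda>u. gelfand x u - gelfand y u) (?f x - ?f y)"
      by (rule toeplitz_diff[where C = "norm x" and D = "norm y"])
         (rule T that norm_gelfand_le gelfand_measurable)+
    then show ?thesis
      by (rule toeplitz_norm_le[OF lam]) (auto simp flip: gelfand_minus intro: norm_gelfand_le)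
  qed
  have "uniformly_continuous_on ?S ?f"
    unfolding uniformly_continuous_on_def dist_norm
    using lip le_less_trans by (intro allI impI exI conjI ballI) (assumption, blast)
  then obtain g where g: "uniformly_continuous_on (closure ?S) g" "\<And>x. x \<in> ?S \<Longrightarrow> ?f x = g x"
    by (rule uniformly_continuous_on_extension_on_closure) blast
  have "closure ?S = UNIV"
  proof -
    have "x \<in> closure ?S" for x
      unfolding closure_approachable
      using schwartz_dense_cstar[of _ x] by (force simp: dist_norm norm_minus_commute)
    then show ?thesis by auto
  qed
  with g have g: "continuous_on UNIV g" "\<And>h. schwartz h \<Longrightarrow> g (cstar_of_l1 h) = nu_integral \<eta> lam (fourier h)"
    using uniformly_continuous_imp_continuous by (auto simp: gS[symmetric])
  have "nu \<eta> lam = g"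
    unfolding nu_def
  proof (rule the_equality)
    show "continuous_on UNIV g \<and> (\<forall>h. schwartz h \<longrightarrow> g (cstar_of_l1 h) = nu_schwartz \<eta> lam h)"
      using g by (simp add: nu_schwartz_eq[OF lam])
    fix N assume "continuous_on UNIV N \<and> (\<forall>h. schwartz h \<longrightarrow> N (cstar_of_l1 h) = nu_schwartz \<eta> lam h)"
    then have N: "continuous_on UNIV N" "\<And>h. schwartz h \<Longrightarrow> N (cstar_of_l1 h) = nu_integral \<eta> lam (fourier h)"
      by (simp_all add: nu_schwartz_eq[OF lam])
    show "N = g"
      by (rule ext, rule continuous_extension_unique[OF N(1) g(1)]) (simp add: N(2) g(2))
  qed
  with g show "continuous_on UNIV (nu \<eta> lam)"
    "\<And>h. schwartz h \<Longrightarrow> nu \<eta> lam (cstar_of_l1 h) = nu_integral \<eta> lam (fourier h)" by auto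
qed

text \<open>
  Both sides are continuous in \<open>h\<close> and agree for Schwartz functions. Everything algebraic about \<open>nu\<close> is
  read off from this formula.
\<close>

lemma toeplitz_nu:
  assumes lam: "lam \<noteq> 0"
  shows "toeplitz \<eta> lam (gelfand h) (nu \<eta> lam h)"
  unfolding toeplitz_def
proof (intro allI)
  fix x y
  let ?V = "voice_l2 \<eta> lam"
  have "continuous_on UNIV (\<lambda>h. l2_inner (blinfun_apply (nu \<eta> lam h) x) y)"
    by (intro bounded_bilinear.continuous_on[OF bounded_bilinear_l2_inner] blinfun.continuous_on
        continuous_on_const nu_characterisation(1)[OF lam])
  moreover have "continuous_on UNIV (\<lambda>h. l2_inner (l2_mult (gelfand h) (?V x)) (?V y))"
  proof (rule continuous_onI)
    fix h and e :: real assume e: "e > 0"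
    define K where "K = norm (?V x) * norm (?V y) + 1"
    have K: "K > 0" by (simp add: K_def add_nonneg_pos)
    have "dist (l2_inner (l2_mult (gelfand k) (?V x)) (?V y)) (l2_inner (l2_mult (gelfand h) (?V x)) (?V y)) \<le> e"
      if "dist k h < e / K" for k
    proof -
      have b: "cmod (gelfand k u - gelfand h u) \<le> dist k h" for u
        unfolding dist_norm gelfand_minus[symmetric] by (rule norm_gelfand_le)
      have "cmod (l2_inner (l2_mult (gelfand k) (?V x)) (?V y) - l2_inner (l2_mult (gelfand h) (?V x)) (?V y))
          = cmod (l2_inner (l2_mult (\<lambda>u. gelfand k u - gelfand h u) (?V x)) (?V y))"
        by (simp only: l2_mult_diff_symbol[OF gelfand_measurable norm_gelfand_le gelfand_measurable norm_gelfand_le]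
          l2_inner_diff_left)
      also have "\<dots> \<le> (dist k h * norm (?V x)) * norm (?V y)"
        by (intro order_trans[OF l2_cauchy_schwarz] mult_right_mono norm_l2_mult_le b) auto
      also have "\<dots> \<le> dist k h * K" by (simp add: K_def mult.assoc mult_left_mono)
      also have "\<dots> \<le> e" using that K by (simp add: pos_less_divide_eq less_imp_le)
      finally show ?thesis by (simp add: dist_norm)
    qed
    then show "\<exists>d>0. \<forall>k\<in>UNIV. dist k h < d \<longrightarrow>
        dist (l2_inner (l2_mult (gelfand k) (?V x)) (?V y)) (l2_inner (l2_mult (gelfand h) (?V x)) (?V y)) \<le> e"
      using e K by (intro exI[of _ "e / K"]) auto
  qed
  ultimately show "l2_inner (blinfun_apply (nu \<eta> lam h) x) y = l2_inner (l2_mult (gelfand h) (?V x)) (?V y)"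
  proof (rule continuous_extension_unique)
    fix h :: "(real ^ 'n) \<times> (real ^ 'n) \<Rightarrow> complex" assume h: "schwartz h"
    have gS: "gelfand (cstar_of_l1 h) = fourier h"
      by (intro gelfand_cstar_of_l1 tameD(2) schwartz_tame h)
    have "toeplitz \<eta> lam (gelfand (cstar_of_l1 h)) (nu_integral \<eta> lam (gelfand (cstar_of_l1 h)))"
      by (rule toeplitz_nu_integral[OF lam continuous_gelfand _ norm_gelfand_le])
         (simp add: gS integrable_fourier_schwartz h)
    then show "l2_inner (blinfun_apply (nu \<eta> lam (cstar_of_l1 h)) x) y
        = l2_inner (l2_mult (gelfand (cstar_of_l1 h)) (?V x)) (?V y)"
      unfolding nu_characterisation(2)[OF lam h] by (simp only: toeplitz_def gS)
  qed
qed

lemma norm_nu_le: "lam \<noteq> 0 \<Longrightarrow> norm (nu \<eta> lam h) \<le> norm h"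
  by (rule toeplitz_norm_le[OF _ toeplitz_nu]) (auto intro: norm_gelfand_le)

lemma nu_diff:
  assumes "lam \<noteq> 0"
  shows "nu \<eta> lam (h - h') = nu \<eta> lam h - nu \<eta> lam h'"
proof (rule toeplitz_unique[OF toeplitz_nu[OF assms]])
  show "toeplitz \<eta> lam (gelfand (h - h')) (nu \<eta> lam h - nu \<eta> lam h')"
    unfolding gelfand_minus[abs_def]
    by (rule toeplitz_diff[where C = "norm h" and D = "norm h'"])
       (rule toeplitz_nu assms gelfand_measurable norm_gelfand_le)+
qed

lemma nu_add: "lam \<noteq> 0 \<Longrightarrow> nu \<eta> lam (h + h') = nu \<eta> lam h + nu \<eta> lam h'"
  using nu_diff[of lam "h + h'" h'] by simp

lemma nu_scaleC:
  assumes lam: "lam \<noteq> 0"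
  shows "nu \<eta> lam (c *\<^sub>C h) = c *\<^sub>C nu \<eta> lam h"
proof (intro blinfun_eqI l2_eqI)
  fix x y
  have c: "(\<lambda>_ :: (real ^ 'n) \<times> (real ^ 'n). c) \<in> borel_measurable borel" "\<And>u. cmod c \<le> cmod c" by auto
  have "l2_mult (gelfand (c *\<^sub>C h)) F = l2_mult (\<lambda>_. c) (l2_mult (gelfand h) F)" for F
    unfolding gelfand_scaleC by (rule l2_mult_mult[OF c gelfand_measurable norm_gelfand_le])
  also have "l2_mult (\<lambda>_. c) G = c *\<^sub>C G" for G :: "((real ^ 'n) \<times> (real ^ 'n)) l2"
  proof -
    obtain g where "square_integrable g" "G = l2_of g" by (rule l2_cases)
    then show ?thesis using l2_mult_of[OF c] by (simp add: l2_of_scaleC)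
  qed
  finally show "l2_inner (blinfun_apply (nu \<eta> lam (c *\<^sub>C h)) x) y = l2_inner (blinfun_apply (c *\<^sub>C nu \<eta> lam h) x) y"
    using toeplitz_nu[OF lam] by (simp add: toeplitz_def scaleC_blinfun.rep_eq l2_inner_scaleC_left)
qed

lemma nu_complex_linear:
  assumes lam: "lam \<noteq> 0"
  shows "complex_linear (blinfun_apply (nu \<eta> lam h))"
  unfolding complex_linear_def
proof (intro conjI allI l2_eqI)
  fix c x y
  show "l2_inner (blinfun_apply (nu \<eta> lam h) (c *\<^sub>C x)) y = l2_inner (c *\<^sub>C blinfun_apply (nu \<eta> lam h) x) y"
    using toeplitz_nu[OF lam, of h]
    by (simp add: toeplitz_def l2_inner_scaleC_left voice_l2_scaleC[OF \<eta> lam]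
        l2_mult_scaleC[OF gelfand_measurable norm_gelfand_le])
qed (simp add: blinfun.add_right)

text \<open>
  The adjoint of \<open>V\<^sup>* M V\<close> is \<open>V\<^sup>* M' V\<close> for the conjugate symbol. So the involution is preserved
  exactly for every \<open>lam\<close>, and in the limit nothing is left to prove.
\<close>

lemma nu_involution:
  assumes lam: "lam \<noteq> 0"
  shows "l2_adjoint (nu \<eta> lam h) = nu \<eta> lam (involution h)"
  unfolding l2_adjoint_def
proof (rule the_equality)
  have adj: "l2_inner (blinfun_apply (nu \<eta> lam h) x) y = l2_inner x (blinfun_apply (nu \<eta> lam (involution h)) y)" for x y
  proof -
    have "l2_inner x (blinfun_apply (nu \<eta> lam (involution h)) y)
        = cnj (l2_inner (l2_mult (\<lambda>u. cnj (gelfand h u)) (voice_l2 \<eta> lam y)) (voice_l2 \<eta> lam x))"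
      using toeplitz_nu[OF lam, of "involution h"]
      by (subst l2_inner_commute) (simp add: toeplitz_def gelfand_involution)
    also have "\<dots> = l2_inner (l2_mult (gelfand h) (voice_l2 \<eta> lam x)) (voice_l2 \<eta> lam y)"
      unfolding l2_mult_cnj[OF gelfand_measurable norm_gelfand_le] by (rule l2_inner_commute[symmetric])
    finally show ?thesis using toeplitz_nu[OF lam, of h] by (simp add: toeplitz_def)
  qed
  then show "\<forall>x y. l2_inner (blinfun_apply (nu \<eta> lam h) x) y = l2_inner x (blinfun_apply (nu \<eta> lam (involution h)) y)"
    by blast
  fix S assume S: "\<forall>x y. l2_inner (blinfun_apply (nu \<eta> lam h) x) y = l2_inner x (blinfun_apply S y)"
  show "S = nu \<eta> lam (involution h)"
  proof (intro blinfun_eqI l2_eqI)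
    fix x y
    show "l2_inner (blinfun_apply S x) y = l2_inner (blinfun_apply (nu \<eta> lam (involution h)) x) y"
      using S adj by (metis l2_inner_commute)
  qed
qed

end

section \<open>Compactness, continuity and decay\<close>

definition compact_image :: "('a::real_normed_vector \<Rightarrow>\<^sub>L 'b::real_normed_vector) \<Rightarrow> bool" where
  "compact_image T \<longleftrightarrow> compact (closure (blinfun_apply T ` cball 0 1))"

lemma compact_closure_subset:
  fixes K :: "'a::metric_space set"
  assumes "A \<subseteq> K" "compact K"
  shows "compact (closure A)"
proof -
  have "closure A \<subseteq> K" using assms by (intro closure_minimal compact_imp_closed)
  then have "closure A = K \<inter> closure A" by auto
  then show ?thesis using compact_Int_closed[OF assms(2) closed_closure[of A]] by simp
qed

lemma subspace_compact_image: "subspace {T :: 'a::real_normed_vector \<Rightarrow>\<^sub>L 'b::real_normed_vector. compact_image T}"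
  unfolding subspace_def mem_Collect_eq
proof (intro conjI ballI allI)
  show "compact_image (0 :: 'a \<Rightarrow>\<^sub>L 'b)"
    unfolding compact_image_def by (rule compact_closure_subset[of _ "{0}"]) auto
  fix S T :: "'a \<Rightarrow>\<^sub>L 'b" and c :: real
  assume "S \<in> {T. compact_image T}"
  then have S: "compact (closure (blinfun_apply S ` cball 0 1))" by (simp add: compact_image_def)
  show "compact_image (c *\<^sub>R S)"
    unfolding compact_image_def
  proof (rule compact_closure_subset)
    show "blinfun_apply (c *\<^sub>R S) ` cball 0 1 \<subseteq> (\<lambda>x. c *\<^sub>R x) ` closure (blinfun_apply S ` cball 0 1)"
      using closure_subset[of "blinfun_apply S ` cball 0 1"] by (auto simp: blinfun.scaleR_left)
    show "compact ((\<lambda>x. c *\<^sub>R x) ` closure (blinfun_apply S ` cball 0 1))"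
      by (rule compact_scaling[OF S])
  qed
  assume "T \<in> {T. compact_image T}"
  then have T: "compact (closure (blinfun_apply T ` cball 0 1))" by (simp add: compact_image_def)
  show "compact_image (S + T)"
    unfolding compact_image_def
  proof (rule compact_closure_subset)
    show "blinfun_apply (S + T) ` cball 0 1 \<subseteq> {x + y | x y.
        x \<in> closure (blinfun_apply S ` cball 0 1) \<and> y \<in> closure (blinfun_apply T ` cball 0 1)}"
    proof
      fix z assume "z \<in> blinfun_apply (S + T) ` cball 0 1"
      then obtain x where x: "x \<in> cball 0 1" "z = blinfun_apply S x + blinfun_apply T x"
        by (auto simp: blinfun.add_left)
      then show "z \<in> {x + y | x y.
          x \<in> closure (blinfun_apply S ` cball 0 1) \<and> y \<in> closure (blinfun_apply T ` cball 0 1)}"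
        using closure_subset by blast
    qed
    show "compact {x + y | x y.
        x \<in> closure (blinfun_apply S ` cball 0 1) \<and> y \<in> closure (blinfun_apply T ` cball 0 1)}"
      by (rule compact_sums[OF S T])
  qed
qed

text \<open>
  If \<open>S\<close> is close to \<open>T\<close>, then slightly larger balls around a finite net for the image under \<open>S\<close> cover
  the image under \<open>T\<close>. So the image under \<open>T\<close> is totally bounded.
\<close>

lemma closed_compact_image:
  "closed {T :: 'a::real_normed_vector \<Rightarrow>\<^sub>L 'b::banach. compact_image T}"
proof -
  have "compact_image T" if T: "T \<in> closure {T. compact_image T}" for T :: "'a \<Rightarrow>\<^sub>L 'b"
    unfolding compact_image_def compact_eq_totally_bounded
  proof (intro conjI allI impI)
    let ?A = "blinfun_apply T ` cball 0 1"
    show "complete (closure ?A)" by (simp add: complete_eq_closed)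
    fix e :: real assume e: "e > 0"
    then have e4: "e / 4 > 0" by simp
    then obtain S where S: "compact_image S" "norm (S - T) < e / 4"
      using T unfolding closure_approachable dist_norm by blast
    have tb: "\<forall>e>0. \<exists>k. finite k \<and> closure (blinfun_apply S ` cball 0 1) \<subseteq> (\<Union>y\<in>k. ball y e)"
      using S(1) unfolding compact_image_def compact_eq_totally_bounded by (rule conjunct2)
    from tb[rule_format, OF e4]
    obtain k where k: "finite k" "closure (blinfun_apply S ` cball 0 1) \<subseteq> (\<Union>y\<in>k. ball y (e / 4))"
      by (elim exE conjE)
    have "?A \<subseteq> (\<Union>y\<in>k. cball y (e / 2))"
    proof (intro image_subsetI)
      fix x :: 'a assume x: "x \<in> cball 0 1"
      then have "blinfun_apply S x \<in> (\<Union>y\<in>k. ball y (e / 4))"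
        using k(2) closure_subset[of "blinfun_apply S ` cball 0 1"] by blast
      then obtain y where y: "y \<in> k" "dist y (blinfun_apply S x) < e / 4" by auto
      have "norm (blinfun_apply (S - T) x) \<le> norm (S - T) * norm x" by (rule norm_blinfun)
      also have "\<dots> \<le> norm (S - T) * 1" using x by (intro mult_left_mono) auto
      finally have "dist (blinfun_apply S x) (blinfun_apply T x) < e / 4"
        using S(2) by (simp add: dist_norm blinfun.diff_left)
      then have "dist y (blinfun_apply T x) \<le> e / 2"
        using y(2) dist_triangle[of y "blinfun_apply T x" "blinfun_apply S x"] by linarith
      then show "blinfun_apply T x \<in> (\<Union>y\<in>k. cball y (e / 2))" using y(1) by auto
    qed
    then have "closure ?A \<subseteq> (\<Union>y\<in>k. cball y (e / 2))"
      using k(1) by (intro closure_minimal closed_UN) auto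
    also have "\<dots> \<subseteq> (\<Union>y\<in>k. ball y e)" using e by force
    finally show "\<exists>k. finite k \<and> closure ?A \<subseteq> (\<Union>x\<in>k. ball x e)" using k(1) by blast
  qed
  then have "closure {T :: 'a \<Rightarrow>\<^sub>L 'b. compact_image T} \<subseteq> {T. compact_image T}" by blast
  then show "closed {T :: 'a \<Rightarrow>\<^sub>L 'b. compact_image T}"
    by (metis closure_subset closed_closure subset_antisym)
qed

lemma compact_image_rank_one:
  fixes v w :: "'a::euclidean_space l2"
  shows "compact_image (c *\<^sub>C rank_one v w)"
  unfolding compact_image_def
proof (rule compact_closure_subset)
  show "blinfun_apply (c *\<^sub>C rank_one v w) ` cball 0 1 \<subseteq> (\<lambda>z. z *\<^sub>C w) ` cball 0 (cmod c * norm v)"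
  proof (intro image_subsetI image_eqI)
    fix x :: "'a l2" assume "x \<in> cball 0 1"
    then have "cmod (l2_inner x v) \<le> 1 * norm v"
      by (intro order_trans[OF l2_cauchy_schwarz] mult_right_mono) auto
    then show "c * l2_inner x v \<in> cball 0 (cmod c * norm v)"
      by (simp add: norm_mult mult_left_mono)
    show "blinfun_apply (c *\<^sub>C rank_one v w) x = (c * l2_inner x v) *\<^sub>C w"
      by (simp add: scaleC_blinfun.rep_eq scaleC_scaleC)
  qed
  show "compact ((\<lambda>z. z *\<^sub>C w) ` cball 0 (cmod c * norm v))"
    by (intro compact_continuous_image compact_cball
        bounded_bilinear.continuous_on[OF bounded_bilinear_scaleC] continuous_intros)
qed

context
  fixes \<eta> :: "real ^ 'n::finite \<Rightarrow> complex"
  assumes \<eta>: "tame \<eta>" and \<eta>1: "norm (l2_of \<eta>) = 1"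
begin

lemma nu_tendsto:
  assumes "lam \<noteq> 0" "X \<longlonglongrightarrow> h"
  shows "(\<lambda>k. nu \<eta> lam (X k)) \<longlonglongrightarrow> nu \<eta> lam h"
  using nu_characterisation(1)[OF \<eta> \<eta>1 assms(1)] assms(2)
  by (auto intro: continuous_on_tendsto_compose[of UNIV])

text \<open>
  For Schwartz functions the operator is an integral of operators of rank one; in general it is a norm
  limit of such integrals.
\<close>

lemma compact_operator_nu:
  assumes lam: "lam \<noteq> 0"
  shows "compact_operator (nu \<eta> lam h)"
proof -
  obtain f where f: "\<And>k. schwartz (f k)" and lim: "(\<lambda>k. cstar_of_l1 (f k)) \<longlonglongrightarrow> h"
    using schwartz_sequence[of h] by blast
  have "compact_image (nu \<eta> lam (cstar_of_l1 (f k)))" for k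
  proof -
    have c: "continuous_on UNIV (fourier (f k))" "integrable lborel (fourier (f k))"
      using f by (auto intro: continuous_fourier tameD(2) schwartz_tame integrable_fourier_schwartz)
    have "nu_integral \<eta> lam (fourier (f k)) \<in> {T. compact_image T}"
      by (rule has_integral_in_closed_subspace[OF nu_integral_exists[OF \<eta> \<eta>1 lam c]
            closed_compact_image subspace_compact_image]) (simp add: coherent_projection_def scaleC_scaleC compact_image_rank_one)
    then show ?thesis by (simp add: nu_characterisation(2)[OF \<eta> \<eta>1 lam f])
  qed
  then have "nu \<eta> lam h \<in> {T. compact_image T}"
    by (intro closed_sequentially[OF closed_compact_image _ nu_tendsto[OF lam lim]]) auto
  then show ?thesis
    using nu_complex_linear[OF \<eta> \<eta>1 lam] by (simp add: compact_operator_def compact_image_def)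
qed

lemma norm_nu_schwartz_le:
  assumes lam: "lam \<noteq> 0" and h: "schwartz h"
  shows "norm (nu \<eta> lam (cstar_of_l1 h)) \<le> (\<integral>u. cmod (fourier h u) \<partial>lborel) / \<bar>lam\<bar> ^ CARD('n)"
proof -
  have c: "continuous_on UNIV (fourier h)" "integrable lborel (fourier h)"
    using h by (auto intro: continuous_fourier tameD(2) schwartz_tame integrable_fourier_schwartz)
  note hi = nu_integral_exists[OF \<eta> \<eta>1 lam c]
  have gi: "integrable lborel (\<lambda>u. cmod (fourier h u) / \<bar>lam\<bar> ^ CARD('n))" using c(2) by simp
  have "norm (integral UNIV (\<lambda>u. fourier h u *\<^sub>C coherent_projection \<eta> lam u))
      \<le> integral UNIV (\<lambda>u. cmod (fourier h u) / \<bar>lam\<bar> ^ CARD('n))"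
  proof (rule Henstock_Kurzweil_Integration.integral_norm_bound_integral)
    show "norm (fourier h u *\<^sub>C coherent_projection \<eta> lam u) \<le> cmod (fourier h u) / \<bar>lam\<bar> ^ CARD('n)" for u
      using mult_left_mono[OF norm_coherent_projection[OF \<eta> \<eta>1 lam, of u], of "cmod (fourier h u)"]
      by (simp add: norm_scaleC)
  qed (use hi gi in \<open>auto intro: integrable_on_lborel\<close>)
  also have "\<dots> = (\<integral>u. cmod (fourier h u) / \<bar>lam\<bar> ^ CARD('n) \<partial>lborel)"
    by (rule integral_lborel[OF gi])
  finally show ?thesis
    using integral_unique[OF hi] by (simp add: nu_characterisation(2)[OF \<eta> \<eta>1 lam h])
qed

text \<open>
  For Schwartz functions the factor \<open>1 / \<bar>lam\<bar>\<^sup>n\<close> of the measure makes the norm small; the approximation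
  of general elements is uniform in \<open>lam\<close>.
\<close>

lemma nu_vanishes_at_infinity: "((\<lambda>lam. norm (nu \<eta> lam h)) \<longlongrightarrow> 0) at_infinity"
proof (rule tendstoI)
  fix e :: real assume e: "e > 0"
  obtain f where f: "schwartz f" "norm (h - cstar_of_l1 f) < e / 2"
    using schwartz_dense_cstar[of "e / 2" h] e by auto
  define I where "I = (\<integral>u. cmod (fourier f u) \<partial>lborel)"
  have I: "I \<ge> 0" unfolding I_def by simp
  show "\<forall>\<^sub>F lam in at_infinity. dist (norm (nu \<eta> lam h)) 0 < e"
    unfolding eventually_at_infinity
  proof (intro exI[of _ "max 1 (2 * I / e + 1)"] allI impI)
    fix lam :: real assume "max 1 (2 * I / e + 1) \<le> norm lam"
    then have l: "1 \<le> \<bar>lam\<bar>" "2 * I / e < \<bar>lam\<bar>" by auto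
    then have lam: "lam \<noteq> 0" by auto
    have "\<bar>lam\<bar> ^ 1 \<le> \<bar>lam\<bar> ^ CARD('n)" using l(1) by (intro power_increasing) (auto simp: Suc_leI)
    then have "I / \<bar>lam\<bar> ^ CARD('n) \<le> I / \<bar>lam\<bar>" using I l(1) by (intro divide_left_mono) auto
    also have "\<dots> < e / 2" using l e by (simp add: field_simps)
    finally have "norm (nu \<eta> lam (cstar_of_l1 f)) < e / 2"
      using norm_nu_schwartz_le[OF lam f(1), folded I_def] by linarith
    moreover have "norm (nu \<eta> lam h - nu \<eta> lam (cstar_of_l1 f)) < e / 2"
      using norm_nu_le[OF \<eta> \<eta>1 lam, of "h - cstar_of_l1 f"] f(2)
      by (simp add: nu_diff[OF \<eta> \<eta>1 lam])
    ultimately have "norm (nu \<eta> lam h) < e"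
      using norm_triangle_sub[of "nu \<eta> lam h" "nu \<eta> lam (cstar_of_l1 f)"] by linarith
    then show "dist (norm (nu \<eta> lam h)) 0 < e" by simp
  qed
qed

text \<open>
  The integrands converge in norm at every point of phase space, and dominated convergence applies to
  the norms of their differences.
\<close>

lemma continuous_nu_schwartz:
  assumes h: "schwartz h"
  shows "continuous_on (- {0}) (\<lambda>lam. nu \<eta> lam (cstar_of_l1 h))"
  unfolding continuous_on_sequentially
proof (intro allI ballI impI)
  fix L :: "nat \<Rightarrow> real" and lam assume "lam \<in> - {0}" "(\<forall>n. L n \<in> - {0}) \<and> L \<longlonglongrightarrow> lam"
  then have l0: "lam \<noteq> 0" "\<And>k. L k \<noteq> 0" and lim: "L \<longlonglongrightarrow> lam" by auto
  let ?\<phi> = "fourier h" and ?Q = "coherent_projection \<eta>"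
  have c: "continuous_on UNIV ?\<phi>" "integrable lborel ?\<phi>"
    using h by (auto intro: continuous_fourier tameD(2) schwartz_tame integrable_fourier_schwartz)
  note hi = nu_integral_exists[OF \<eta> \<eta>1 _ c]
  let ?n = "CARD('n)"
  have "(\<lambda>k. 1 / \<bar>L k\<bar> ^ ?n + 1 / \<bar>lam\<bar> ^ ?n) \<longlonglongrightarrow> 1 / \<bar>lam\<bar> ^ ?n + 1 / \<bar>lam\<bar> ^ ?n"
    by (intro tendsto_intros lim) (use l0 in auto)
  then have "Bseq (\<lambda>k. 1 / \<bar>L k\<bar> ^ ?n + 1 / \<bar>lam\<bar> ^ ?n)"
    by (intro convergent_imp_Bseq convergentI)
  then obtain M where M: "\<And>k. norm (1 / \<bar>L k\<bar> ^ ?n + 1 / \<bar>lam\<bar> ^ ?n) \<le> M"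
    unfolding Bseq_def by blast
  note cQ = continuous_coherent_projection_phase[OF \<eta> \<eta>1]
  let ?g = "\<lambda>k u. cmod (?\<phi> u) * norm (?Q (L k) u - ?Q lam u)"
  have Qb: "norm (?Q (L k) u - ?Q lam u) \<le> M" for k u
    using norm_triangle_ineq4[of "?Q (L k) u" "?Q lam u"] norm_coherent_projection[OF \<eta> \<eta>1 l0(1), of u]
      norm_coherent_projection[OF \<eta> \<eta>1 l0(2)[of k], of u] M[of k] by (simp add: abs_le_iff)
  have gm: "?g k \<in> borel_measurable borel" for k
    by (intro borel_measurable_continuous_onI continuous_intros c cQ l0)
  have wi: "integrable lborel (\<lambda>u. cmod (?\<phi> u) * M)" using c(2) by simp
  have gb: "norm (?g k u) \<le> cmod (?\<phi> u) * M" for k u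
    using mult_left_mono[OF Qb, of "cmod (?\<phi> u)" k u] by (simp add: abs_mult)
  have gi: "integrable lborel (?g k)" for k
  proof (rule Bochner_Integration.integrable_bound[OF wi])
    show "AE u in lborel. norm (?g k u) \<le> norm (cmod (?\<phi> u) * M)"
      using gb by (intro AE_I2) (metis abs_ge_self order_trans real_norm_def)
  qed (use gm in simp)
  have "(\<lambda>k. \<integral>u. ?g k u \<partial>lborel) \<longlonglongrightarrow> (\<integral>u. 0 \<partial>(lborel :: ((real ^ 'n) \<times> (real ^ 'n)) measure))"
  proof (rule integral_dominated_convergence[OF _ _ wi])
    show "AE u in lborel. (\<lambda>k. ?g k u) \<longlonglongrightarrow> 0"
    proof (rule AE_I2)
      fix u :: "(real ^ 'n) \<times> (real ^ 'n)"
      have "(\<lambda>k. ?Q (fst (L k, u)) (snd (L k, u))) \<longlonglongrightarrow> ?Q (fst (lam, u)) (snd (lam, u))"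
        by (rule continuous_on_tendsto_compose[OF continuous_coherent_projection[OF \<eta> \<eta>1]])
           (use l0 lim in \<open>auto intro!: tendsto_intros\<close>)
      then have "(\<lambda>k. ?g k u) \<longlonglongrightarrow> cmod (?\<phi> u) * norm (?Q lam u - ?Q lam u)"
        by (intro tendsto_intros) simp
      then show "(\<lambda>k. ?g k u) \<longlonglongrightarrow> 0" by simp
    qed
    show "AE u in lborel. norm (?g k u) \<le> cmod (?\<phi> u) * M" for k
      using gb by (intro AE_I2)
  qed (use gm in simp_all)
  then have lim0: "(\<lambda>k. \<integral>u. ?g k u \<partial>lborel) \<longlonglongrightarrow> 0" by simp
  have "norm (nu \<eta> (L k) (cstar_of_l1 h) - nu \<eta> lam (cstar_of_l1 h)) \<le> (\<integral>u. ?g k u \<partial>lborel)" for k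
  proof -
    have d: "((\<lambda>u. ?\<phi> u *\<^sub>C ?Q (L k) u - ?\<phi> u *\<^sub>C ?Q lam u) has_integral
        (nu_integral \<eta> (L k) ?\<phi> - nu_integral \<eta> lam ?\<phi>)) UNIV"
      by (intro has_integral_diff hi l0)
    have "norm (integral UNIV (\<lambda>u. ?\<phi> u *\<^sub>C ?Q (L k) u - ?\<phi> u *\<^sub>C ?Q lam u)) \<le> integral UNIV (?g k)"
    proof (rule Henstock_Kurzweil_Integration.integral_norm_bound_integral)
      fix u
      have "?\<phi> u *\<^sub>C (?Q (L k) u - ?Q lam u) = ?\<phi> u *\<^sub>C ?Q (L k) u - ?\<phi> u *\<^sub>C ?Q lam u"
        by (rule bounded_bilinear.diff_right[OF bounded_bilinear_scaleC])
      then show "norm (?\<phi> u *\<^sub>C ?Q (L k) u - ?\<phi> u *\<^sub>C ?Q lam u) \<le> ?g k u"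
        by (metis norm_scaleC order_refl)
    qed (use d gi in \<open>auto intro: integrable_on_lborel\<close>)
    then show ?thesis
      using integral_unique[OF d] integral_lborel[OF gi]
      by (simp add: nu_characterisation(2)[OF \<eta> \<eta>1 _ h] l0)
  qed
  then have "(\<lambda>k. nu \<eta> (L k) (cstar_of_l1 h) - nu \<eta> lam (cstar_of_l1 h)) \<longlonglongrightarrow> 0"
    by (intro Lim_null_comparison[OF _ lim0] always_eventually allI)
  then show "((\<lambda>lam. nu \<eta> lam (cstar_of_l1 h)) \<circ> L) \<longlonglongrightarrow> nu \<eta> lam (cstar_of_l1 h)"
    by (simp add: comp_def LIM_zero_iff)
qed

text \<open>
  Approximation by Schwartz functions is uniform in \<open>lam\<close>, since all the maps \<open>nu \<eta> lam\<close> are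
  contractions.
\<close>

lemma continuous_nu: "continuous_on (- {0}) (\<lambda>lam. nu \<eta> lam h)"
proof -
  obtain f where f: "\<And>k. schwartz (f k)" and lim: "(\<lambda>k. cstar_of_l1 (f k)) \<longlonglongrightarrow> h"
    using schwartz_sequence[of h] by blast
  have "uniform_limit (- {0}) (\<lambda>k lam. nu \<eta> lam (cstar_of_l1 (f k))) (\<lambda>lam. nu \<eta> lam h) sequentially"
  proof (rule uniform_limitI)
    fix e :: real assume "e > 0"
    with lim have "\<forall>\<^sub>F k in sequentially. dist (cstar_of_l1 (f k)) h < e" by (rule tendstoD)
    then show "\<forall>\<^sub>F k in sequentially. \<forall>lam\<in>- {0}. dist (nu \<eta> lam (cstar_of_l1 (f k))) (nu \<eta> lam h) < e"
    proof eventually_elim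
      case (elim k)
      show ?case
      proof
        fix lam :: real assume "lam \<in> - {0}"
        then have lam: "lam \<noteq> 0" by simp
        have "dist (nu \<eta> lam (cstar_of_l1 (f k))) (nu \<eta> lam h) \<le> dist (cstar_of_l1 (f k)) h"
          unfolding dist_norm nu_diff[OF \<eta> \<eta>1 lam, symmetric] by (rule norm_nu_le[OF \<eta> \<eta>1 lam])
        with elim show "dist (nu \<eta> lam (cstar_of_l1 (f k))) (nu \<eta> lam h) < e" by simp
      qed
    qed
  qed
  then show ?thesis
    by (rule uniform_limit_theorem[rotated]) (auto intro!: always_eventually continuous_nu_schwartz f)
qed

end

section \<open>Characters on phase space\<close>

definition modulate_translate :: "('a::euclidean_space \<Rightarrow> complex) \<Rightarrow> 'a \<Rightarrow> 'a \<Rightarrow> 'a \<Rightarrow> complex" where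
  "modulate_translate g \<alpha> \<beta> r = cis (- 2 * pi * (\<alpha> \<bullet> r)) * g (r + \<beta>)"

lemma tame_modulate_translate:
  assumes "tame g" shows "tame (modulate_translate g \<alpha> \<beta>)"
proof -
  have "tame (\<lambda>r. g (\<beta> + 1 *\<^sub>R r))" by (rule tame_affine[OF assms]) simp
  then have "tame (\<lambda>r. cis (- 2 * pi * (\<alpha> \<bullet> r)) * g (\<beta> + 1 *\<^sub>R r))"
    by (rule tame_mult[where C = 1]) (auto intro!: continuous_intros)
  then show ?thesis by (simp add: modulate_translate_def[abs_def] add.commute)
qed

lemma modulate_translate_l2:
  assumes g: "square_integrable g"
  shows "square_integrable (modulate_translate g \<alpha> \<beta>)"
    and "norm (l2_of (modulate_translate g \<alpha> \<beta>)) = norm (l2_of g)"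
proof -
  have [measurable]: "g \<in> borel_measurable borel" using g by (rule square_integrable_measurable)
  have [measurable]: "(\<lambda>r. cis (- 2 * pi * (\<alpha> \<bullet> r))) \<in> borel_measurable borel"
    by (intro borel_measurable_continuous_onI continuous_intros)
  have m: "modulate_translate g \<alpha> \<beta> \<in> borel_measurable borel"
    unfolding modulate_translate_def by measurable
  have n: "(cmod (modulate_translate g \<alpha> \<beta> r))\<^sup>2 = (cmod (g (r + \<beta>)))\<^sup>2" for r
    by (simp add: modulate_translate_def norm_mult)
  show s: "square_integrable (modulate_translate g \<alpha> \<beta>)"
    using m integral_lborel_shift(1)[OF square_integrable_power2[OF g], of \<beta>]
    by (simp add: square_integrable_def n)
  have "(norm (l2_of (modulate_translate g \<alpha> \<beta>)))\<^sup>2 = (norm (l2_of g))\<^sup>2"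
    unfolding norm_l2_of[OF s] norm_l2_of[OF g] n
    by (rule integral_lborel_shift(2)[OF square_integrable_power2[OF g]])
  then show "norm (l2_of (modulate_translate g \<alpha> \<beta>)) = norm (l2_of g)" by simp
qed

text \<open>
  Modulated translates of one window have equal norm, so pointwise convergence is enough.
\<close>

lemma continuous_modulate_translate:
  assumes g: "tame g"
  shows "continuous_on UNIV (\<lambda>p. l2_of (modulate_translate g (fst p) (snd p)))"
  unfolding continuous_on_sequentially
proof (intro allI ballI impI)
  fix X :: "nat \<Rightarrow> 'a \<times> 'a" and p assume "(\<forall>n. X n \<in> UNIV) \<and> X \<longlonglongrightarrow> p"
  then have X: "(\<lambda>k. fst (X k)) \<longlonglongrightarrow> fst p" "(\<lambda>k. snd (X k)) \<longlonglongrightarrow> snd p"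
    by (auto intro: tendsto_fst tendsto_snd)
  note sg = tame_square_integrable[OF g]
  note t = tame_modulate_translate[OF g]
  obtain C where C: "C > 0" "\<And>x. cmod (g x) \<le> C" using tame_bound[OF g] by blast
  have "(\<lambda>k. norm (l2_of (modulate_translate g (fst (X k)) (snd (X k))) - l2_of (modulate_translate g (fst p) (snd p)))) \<longlonglongrightarrow> 0"
  proof (rule l2_convergence)
    fix x
    have "isCont g (x + snd p)" using tameD(1)[OF g] by (simp add: continuous_on_eq_continuous_at)
    then have "(\<lambda>k. g (x + snd (X k))) \<longlonglongrightarrow> g (x + snd p)"
      by (rule isCont_tendsto_compose) (intro tendsto_intros X)
    then show "(\<lambda>k. modulate_translate g (fst (X k)) (snd (X k)) x) \<longlonglongrightarrow> modulate_translate g (fst p) (snd p) x"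
      unfolding modulate_translate_def by (intro tendsto_intros X)
    show "cmod (modulate_translate g (fst (X k)) (snd (X k)) x) \<le> C" for k
      using C by (simp add: modulate_translate_def norm_mult)
  qed (use modulate_translate_l2[OF sg] tameD(2)[OF t] in auto)
  then have "(\<lambda>k. l2_of (modulate_translate g (fst (X k)) (snd (X k))) - l2_of (modulate_translate g (fst p) (snd p))) \<longlonglongrightarrow> 0"
    by (rule tendsto_norm_zero_cancel)
  then show "((\<lambda>p. l2_of (modulate_translate g (fst p) (snd p))) \<circ> X) \<longlonglongrightarrow> l2_of (modulate_translate g (fst p) (snd p))"
    by (simp add: comp_def LIM_zero_iff)
qed

lemma norm_add_diff_le: "x = y + (a - b) \<Longrightarrow> norm x \<le> norm y + (norm a + norm b)"
  using norm_triangle_ineq[of y "a - b"] norm_triangle_ineq4[of a b] by simp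

definition character :: "'a::euclidean_space \<Rightarrow> 'a \<Rightarrow> complex" where
  "character w u = cis (2 * pi * (w \<bullet> u))"

lemma character_measurable [measurable]: "character w \<in> borel_measurable borel"
  unfolding character_def[abs_def] by (intro borel_measurable_continuous_onI continuous_intros)

lemma norm_character: "cmod (character w u) \<le> 1"
  by (simp add: character_def)

lemma fourier_measurable: "integrable lborel h \<Longrightarrow> fourier h \<in> borel_measurable borel"
  by (intro borel_measurable_continuous_onI continuous_fourier)

text \<open>
  A Fourier transform is a superposition of characters, and so is multiplication by it.
\<close>

lemma l2_mult_fourier:
  fixes h :: "'a::euclidean_space \<Rightarrow> complex"
  assumes h: "integrable lborel h"
  shows "integrable lborel (\<lambda>w. h w * l2_inner (l2_mult (character (- w)) F) G)"
    and "l2_inner (l2_mult (fourier h) F) G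
      = (\<integral>w. h w * l2_inner (l2_mult (character (- w)) F) G \<partial>lborel)"
proof -
  obtain f g where f: "square_integrable f" "F = l2_of f" and g: "square_integrable g" "G = l2_of g"
    by (metis l2_cases)
  define k where "k u = f u * cnj (g u)" for u
  have k: "integrable lborel k" unfolding k_def by (rule square_integrable_inner[OF f(1) g(1)])
  note m = fourier_measurable[OF h] norm_fourier_le[OF h]
  note c = character_measurable norm_character
  have fk: "fourier k w = l2_inner (l2_mult (character (- w)) F) G" for w
    unfolding f(2) g(2) l2_mult_of[OF c f(1)] l2_inner_of[OF square_integrable_mult[OF c f(1)] g(1)]
    by (auto simp: fourier_def k_def character_def inner_commute ac_simps intro!: Bochner_Integration.integral_cong)
  have "l2_inner (l2_mult (fourier h) F) G = (\<integral>u. fourier h u * k u \<partial>lborel)"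
    unfolding f(2) g(2) l2_mult_of[OF m f(1)] l2_inner_of[OF square_integrable_mult[OF m f(1)] g(1)]
    by (simp add: k_def mult.assoc)
  also have "\<dots> = (\<integral>w. h w * fourier k w \<partial>lborel)" by (rule integral_fourier_swap[OF h k])
  finally show "l2_inner (l2_mult (fourier h) F) G
      = (\<integral>w. h w * l2_inner (l2_mult (character (- w)) F) G \<partial>lborel)"
    by (simp only: fk)
  have "integrable lborel (\<lambda>w. h w * fourier k w)"
  proof (rule Bochner_Integration.integrable_bound)
    have [measurable]: "h \<in> borel_measurable borel" "fourier k \<in> borel_measurable borel"
      using h fourier_measurable[OF k] by auto
    show "(\<lambda>w. h w * fourier k w) \<in> borel_measurable lborel" by measurable
    show "integrable lborel (\<lambda>w. h w * of_real (\<integral>u. cmod (k u) \<partial>lborel))" using h by simp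
    show "AE w in lborel. norm (h w * fourier k w) \<le> norm (h w * of_real (\<integral>u. cmod (k u) \<partial>lborel))"
      using norm_fourier_le[OF k] by (auto simp: norm_mult intro!: AE_I2 mult_left_mono)
  qed
  then show "integrable lborel (\<lambda>w. h w * l2_inner (l2_mult (character (- w)) F) G)"
    by (simp only: fk)
qed

text \<open>
  The unitary translation of \<open>L\<^sup>2\<close> that belongs to the phase space vector \<open>w = (q, p)\<close>: up to a phase, it
  moves a coherent state at \<open>(a, b)\<close> by \<open>lam\<close> times \<open>(- p, q)\<close>. What matters is that its effect can
  also be described at the unmoved point, by a character and a change of window.
\<close>

definition weyl :: "real \<Rightarrow> 'a \<times> 'a \<Rightarrow> ('a::euclidean_space \<Rightarrow> complex) \<Rightarrow> 'a \<Rightarrow> complex" where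
  "weyl lam w f = modulate_translate f (lam *\<^sub>R snd w) (fst w)"

text \<open>
  Seen at the scale of the coherent states, the translation by \<open>w\<close> shifts the window by an amount of
  the order of the square root of \<open>\<bar>lam\<bar>\<close> in position and in frequency.
\<close>

definition perturbed_window :: "real \<Rightarrow> 'a \<times> 'a \<Rightarrow> ('a::euclidean_space \<Rightarrow> complex) \<Rightarrow> 'a \<Rightarrow> complex" where
  "perturbed_window lam w g =
    modulate_translate g ((sgn lam * \<bar>lam\<bar> powr (1 / 2)) *\<^sub>R snd w) ((\<bar>lam\<bar> powr (1 / 2)) *\<^sub>R fst w)"

text \<open>
  The phase \<open>- 2 * pi * lam * (p \<bullet> s)\<close> of the translation, written in the window's own variable
  \<open>sqrt \<bar>lam\<bar> * (s + b / lam)\<close>, splits into a modulation of the window and the constant \<open>2 * pi * (p \<bullet> b)\<close>.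
  The latter and the phase \<open>2 * pi * (q \<bullet> a)\<close> from the shift of \<open>s\<close> form the character.
\<close>

lemma weyl_coherent_fun:
  fixes g :: "real ^ 'n::finite \<Rightarrow> complex"
  assumes lam: "lam \<noteq> 0"
  shows "weyl lam w (coherent_fun g lam a b)
    = (\<lambda>s. character w (a, b) * coherent_fun (perturbed_window lam w g) lam a b s)"
proof
  fix s
  let ?r = "\<bar>lam\<bar> powr (1 / 2)" and ?q = "fst w" and ?p = "snd w"
  have rr: "sgn lam * ?r * ?r = lam"
    using lam by (simp add: mult.assoc powr_add[symmetric] sgn_mult_abs)
  have arg: "?r *\<^sub>R (s + ?q + (1 / lam) *\<^sub>R b) = ?r *\<^sub>R (s + (1 / lam) *\<^sub>R b) + ?r *\<^sub>R ?q"
    by (simp add: algebra_simps)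
  have ph: "((sgn lam * ?r) *\<^sub>R ?p) \<bullet> (?r *\<^sub>R (s + (1 / lam) *\<^sub>R b)) = lam * (?p \<bullet> s) + ?p \<bullet> b"
  proof -
    have "((sgn lam * ?r) *\<^sub>R ?p) \<bullet> (?r *\<^sub>R (s + (1 / lam) *\<^sub>R b)) = (sgn lam * ?r * ?r) * (?p \<bullet> s + (?p \<bullet> b) / lam)"
      by (simp add: inner_add_right algebra_simps)
    then show ?thesis unfolding rr using lam by (simp add: distrib_left)
  qed
  have cis: "cis (- 2 * pi * ((lam *\<^sub>R ?p) \<bullet> s)) * cis (2 * pi * (a \<bullet> (s + ?q)))
      = character w (a, b) * (cis (2 * pi * (a \<bullet> s)) * cis (- 2 * pi * (lam * (?p \<bullet> s) + ?p \<bullet> b)))"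
    unfolding character_def cis_mult
    by (rule arg_cong[where f = cis]) (cases w, simp add: inner_add_right inner_commute algebra_simps)
  have "weyl lam w (coherent_fun g lam a b) s
      = of_real (\<bar>lam\<bar> powr (real CARD('n) / 4)) *
        (cis (- 2 * pi * ((lam *\<^sub>R ?p) \<bullet> s)) * cis (2 * pi * (a \<bullet> (s + ?q)))) *
        g (?r *\<^sub>R (s + ?q + (1 / lam) *\<^sub>R b))"
    by (simp add: weyl_def modulate_translate_def coherent_fun_def ac_simps)
  also have "\<dots> = character w (a, b) * coherent_fun (perturbed_window lam w g) lam a b s"
    unfolding cis arg coherent_fun_def perturbed_window_def modulate_translate_def ph by (simp add: ac_simps)
  finally show "weyl lam w (coherent_fun g lam a b) s
      = character w (a, b) * coherent_fun (perturbed_window lam w g) lam a b s" .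
qed

lemma weyl_unitary:
  assumes f: "square_integrable f" and g: "square_integrable g"
  shows "square_integrable (weyl lam w f)" "norm (l2_of (weyl lam w f)) = norm (l2_of f)"
    "l2_inner (l2_of (weyl lam w f)) (l2_of (weyl lam w g)) = l2_inner (l2_of f) (l2_of g)"
proof -
  show s: "square_integrable (weyl lam w f)" "norm (l2_of (weyl lam w f)) = norm (l2_of f)"
    unfolding weyl_def by (rule modulate_translate_l2[OF f])+
  have s': "square_integrable (weyl lam w g)"
    unfolding weyl_def by (rule modulate_translate_l2[OF g])
  have c: "cis t * z * cnj (cis t * z') = z * cnj z'" for t z z'
    by (simp add: cis_cnj cis_mult mult.left_commute mult.assoc)
  show "l2_inner (l2_of (weyl lam w f)) (l2_of (weyl lam w g)) = l2_inner (l2_of f) (l2_of g)"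
    unfolding l2_inner_of[OF s(1) s'] l2_inner_of[OF f g]
    unfolding weyl_def modulate_translate_def c
    by (rule integral_lborel_shift(2)[OF square_integrable_inner[OF f g]])
qed

section \<open>Behaviour as the parameter tends to zero\<close>

definition window_error :: "(real ^ 'n::finite \<Rightarrow> complex) \<Rightarrow> real \<Rightarrow> (real ^ 'n) \<times> (real ^ 'n) \<Rightarrow> real" where
  "window_error \<eta> lam w = norm (l2_of (perturbed_window lam w \<eta>) - l2_of \<eta>)"

definition averaged_error ::
    "(real ^ 'n::finite \<Rightarrow> complex) \<Rightarrow> ((real ^ 'n) \<times> (real ^ 'n) \<Rightarrow> complex) \<Rightarrow> real \<Rightarrow> real" where
  "averaged_error \<eta> h lam = (\<integral>w. cmod (h w) * window_error \<eta> lam (- w) \<partial>lborel)"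

context
  fixes \<eta> :: "real ^ 'n::finite \<Rightarrow> complex"
  assumes \<eta>: "tame \<eta>" and \<eta>1: "norm (l2_of \<eta>) = 1"
begin

lemma tame_perturbed: "tame (perturbed_window lam w \<eta>)"
  unfolding perturbed_window_def by (rule tame_modulate_translate[OF \<eta>])

lemma norm_perturbed: "norm (l2_of (perturbed_window lam w \<eta>)) = 1"
  unfolding perturbed_window_def using modulate_translate_l2(2)[OF tame_square_integrable[OF \<eta>]] \<eta>1 by simp

lemma window_error_eq: "norm (l2_of (\<lambda>r. perturbed_window lam w \<eta> r - \<eta> r)) = window_error \<eta> lam w"
  unfolding window_error_def
  by (simp add: l2_of_diff tame_square_integrable tame_perturbed \<eta>)

lemma window_error_bounds: "0 \<le> window_error \<eta> lam w" "window_error \<eta> lam w \<le> 2"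
  unfolding window_error_def
  using norm_triangle_ineq4[of "l2_of (perturbed_window lam w \<eta>)" "l2_of \<eta>"] norm_perturbed[of lam w] \<eta>1 by auto

lemma window_error_continuous: "continuous_on UNIV (window_error \<eta> lam)"
proof -
  have "continuous_on UNIV (\<lambda>w :: (real ^ 'n) \<times> (real ^ 'n).
      ((sgn lam * \<bar>lam\<bar> powr (1 / 2)) *\<^sub>R snd w, (\<bar>lam\<bar> powr (1 / 2)) *\<^sub>R fst w))"
    by (intro continuous_intros)
  from continuous_on_compose2[OF continuous_modulate_translate[OF \<eta>] this]
  have "continuous_on UNIV (\<lambda>w. l2_of (perturbed_window lam w \<eta>))"
    by (simp add: perturbed_window_def)
  then show ?thesis
    unfolding window_error_def[abs_def] by (intro continuous_on_norm continuous_on_diff continuous_on_const)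
qed

lemma window_error_tendsto: "((\<lambda>lam. window_error \<eta> lam w) \<longlongrightarrow> 0) (at 0)"
proof -
  have r: "((\<lambda>lam::real. \<bar>lam\<bar> powr (1 / 2)) \<longlongrightarrow> 0) (at 0)"
  proof -
    have "((\<lambda>lam::real. sqrt \<bar>lam\<bar>) \<longlongrightarrow> sqrt \<bar>0\<bar>) (at 0)" by (intro tendsto_intros)
    then show ?thesis by (simp add: powr_half_sqrt)
  qed
  have s: "((\<lambda>lam::real. sgn lam * \<bar>lam\<bar> powr (1 / 2)) \<longlongrightarrow> 0) (at 0)"
  proof (rule Lim_null_comparison[OF _ r])
    show "\<forall>\<^sub>F lam in at 0. norm (sgn lam * \<bar>lam\<bar> powr (1 / 2)) \<le> \<bar>lam\<bar> powr (1 / 2)" for lam :: real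
      by (intro always_eventually allI) (simp add: abs_mult sgn_real_def)
  qed
  have "((\<lambda>lam. ((sgn lam * \<bar>lam\<bar> powr (1 / 2)) *\<^sub>R snd w, (\<bar>lam\<bar> powr (1 / 2)) *\<^sub>R fst w))
      \<longlongrightarrow> (0 *\<^sub>R snd w, 0 *\<^sub>R fst w)) (at 0)"
    by (intro tendsto_intros r s)
  from continuous_on_tendsto_compose[OF continuous_modulate_translate[OF \<eta>] this]
  have "((\<lambda>lam. l2_of (perturbed_window lam w \<eta>)) \<longlongrightarrow> l2_of (modulate_translate \<eta> 0 0)) (at 0)"
    by (simp add: perturbed_window_def)
  moreover have "modulate_translate \<eta> 0 0 = \<eta>"
    by (simp add: modulate_translate_def fun_eq_iff)
  ultimately have "((\<lambda>lam. l2_of (perturbed_window lam w \<eta>)) \<longlongrightarrow> l2_of \<eta>) (at 0)" by simp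
  then have "((\<lambda>lam. norm (l2_of (perturbed_window lam w \<eta>) - l2_of \<eta>)) \<longlongrightarrow> norm (l2_of \<eta> - l2_of \<eta>)) (at 0)"
    by (intro tendsto_norm tendsto_diff tendsto_const)
  then show ?thesis by (simp add: window_error_def)
qed

text \<open>
  Multiplication by a character on phase space is a unitary operator on vectors followed by the
  transform for a changed window. Unitarity of the translation moves its action on the coherent states
  over to the vector.
\<close>

lemma character_voice:
  assumes lam: "lam \<noteq> 0" and f: "square_integrable f"
  shows "l2_mult (character w) (voice_l2 \<eta> lam (l2_of f))
    = voice_l2 (perturbed_window lam w \<eta>) lam (l2_of (weyl lam w f))"
proof -
  note s = voice_bound(1)[OF \<eta> lam]
  have eq: "character w u * voice \<eta> lam (l2_of f) u = voice (perturbed_window lam w \<eta>) lam (l2_of (weyl lam w f)) u" for u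
  proof -
    let ?c = "coherent_fun \<eta> lam (fst u) (snd u)"
    let ?c' = "coherent_state (perturbed_window lam w \<eta>) lam (fst u) (snd u)"
    have sc: "square_integrable ?c" by (intro coherent_fun_l2 lam tame_square_integrable \<eta>)
    have sc': "square_integrable (coherent_fun (perturbed_window lam w \<eta>) lam (fst u) (snd u))"
      by (intro coherent_fun_l2 lam tame_square_integrable tame_perturbed)
    have "l2_inner (l2_of f) (coherent_state \<eta> lam (fst u) (snd u)) = l2_inner (l2_of (weyl lam w f)) (l2_of (weyl lam w ?c))"
      by (simp add: weyl_unitary(3)[OF f sc] coherent_state_eq)
    also have "l2_of (weyl lam w ?c) = character w u *\<^sub>C ?c'"
      unfolding weyl_coherent_fun[OF lam] coherent_state_eq l2_of_scaleC[OF sc'] by simp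
    finally have "character w u * l2_inner (l2_of f) (coherent_state \<eta> lam (fst u) (snd u))
        = (character w u * cnj (character w u)) * l2_inner (l2_of (weyl lam w f)) ?c'"
      by (simp add: l2_inner_scaleC_right)
    also have "character w u * cnj (character w u) = 1"
      by (simp add: character_def cis_cnj cis_mult)
    finally show ?thesis by (simp add: voice_def ac_simps)
  qed
  show ?thesis
    unfolding voice_l2_def l2_mult_of[OF character_measurable norm_character s] eq ..
qed

lemma norm_voice_window_error:
  assumes lam: "lam \<noteq> 0"
  shows "norm (voice_l2 (perturbed_window lam w \<eta>) lam x - voice_l2 \<eta> lam x) = window_error \<eta> lam w * norm x"
  unfolding voice_l2_window_diff[OF tame_perturbed \<eta> lam, symmetric]
    norm_voice_l2[OF tame_diff[OF tame_perturbed \<eta>] lam] window_error_eq ..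

text \<open>
  The change of window costs only \<open>window_error\<close> because the Moyal identity holds for the difference of
  the two windows as well.
\<close>

lemma character_voice_near_range:
  assumes lam: "lam \<noteq> 0"
  shows "\<exists>y. norm (l2_mult (character w) (voice_l2 \<eta> lam x) - voice_l2 \<eta> lam y) \<le> window_error \<eta> lam w * norm x"
proof -
  obtain f where f: "square_integrable f" "x = l2_of f" by (rule l2_cases)
  have "norm (l2_mult (character w) (voice_l2 \<eta> lam x) - voice_l2 \<eta> lam (l2_of (weyl lam w f)))
      = window_error \<eta> lam w * norm (l2_of (weyl lam w f))"
    unfolding f(2) character_voice[OF lam f(1)] by (rule norm_voice_window_error[OF lam])
  also have "norm (l2_of (weyl lam w f)) = norm x" unfolding f(2) by (rule weyl_unitary(2)[OF f(1) f(1)])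
  finally show ?thesis by (intro exI[of _ "l2_of (weyl lam w f)"]) simp
qed

lemma character_voice_coherent:
  assumes lam: "lam \<noteq> 0"
  shows "norm (l2_mult (character w) (voice_l2 \<eta> lam (coherent_state \<eta> lam a b))
      - character w (a, b) *\<^sub>C voice_l2 \<eta> lam (coherent_state \<eta> lam a b)) \<le> 2 * window_error \<eta> lam w"
proof -
  let ?c = "coherent_state \<eta> lam a b" and ?g = "perturbed_window lam w \<eta>"
  let ?c' = "coherent_state ?g lam a b"
  note sg = tame_square_integrable[OF \<eta>] and sg' = tame_square_integrable[OF tame_perturbed]
  have W: "l2_of (weyl lam w (coherent_fun \<eta> lam a b)) = character w (a, b) *\<^sub>C ?c'"
    unfolding weyl_coherent_fun[OF lam] coherent_state_eq by (simp add: l2_of_scaleC coherent_fun_l2 lam sg')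
  have "l2_mult (character w) (voice_l2 \<eta> lam ?c) - character w (a, b) *\<^sub>C voice_l2 \<eta> lam ?c
      = character w (a, b) *\<^sub>C (voice_l2 ?g lam ?c' - voice_l2 \<eta> lam ?c)"
    unfolding coherent_state_eq[of \<eta>] character_voice[OF lam coherent_fun_l2(1)[OF lam sg]] W
    by (simp add: voice_l2_scaleC[OF tame_perturbed lam] bounded_bilinear.diff_right[OF bounded_bilinear_scaleC])
  also have "norm \<dots> = norm (voice_l2 ?g lam ?c' - voice_l2 \<eta> lam ?c)"
    by (simp add: norm_scaleC character_def)
  also have "\<dots> = norm ((voice_l2 ?g lam ?c' - voice_l2 \<eta> lam ?c') + voice_l2 \<eta> lam (?c' - ?c))"
    by (simp add: voice_l2_diff[OF \<eta> lam])
  also have "\<dots> \<le> norm (voice_l2 ?g lam ?c' - voice_l2 \<eta> lam ?c') + norm (voice_l2 \<eta> lam (?c' - ?c))"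
    by (rule norm_triangle_ineq)
  also have "norm (voice_l2 ?g lam ?c' - voice_l2 \<eta> lam ?c') = window_error \<eta> lam w"
    by (simp add: norm_voice_window_error[OF lam] coherent_fun_l2(2)[OF lam sg'] norm_perturbed)
  also have "norm (voice_l2 \<eta> lam (?c' - ?c)) = window_error \<eta> lam w"
    unfolding norm_voice_eta[OF \<eta> \<eta>1 lam] coherent_state_diff[OF sg' sg lam, symmetric] window_error_eq[symmetric]
    by (intro coherent_fun_l2 lam tame_square_integrable tame_diff tame_perturbed \<eta>)
  finally show ?thesis by simp
qed

lemma averaged_error_nonneg: "0 \<le> averaged_error \<eta> h lam"
  unfolding averaged_error_def
  by (intro Bochner_Integration.integral_nonneg) (simp add: window_error_bounds)

lemma averaged_error_integrable:
  assumes h: "integrable lborel h"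
  shows "integrable lborel (\<lambda>w. cmod (h w) * window_error \<eta> lam (- w))"
proof (rule Bochner_Integration.integrable_bound)
  have [measurable]: "h \<in> borel_measurable borel" using h by auto
  have [measurable]: "(\<lambda>w. window_error \<eta> lam (- w)) \<in> borel_measurable borel"
    by (intro borel_measurable_continuous_onI continuous_on_compose2[OF window_error_continuous])
       (auto intro!: continuous_intros)
  show "(\<lambda>w. cmod (h w) * window_error \<eta> lam (- w)) \<in> borel_measurable lborel" by measurable
  show "integrable lborel (\<lambda>w. cmod (h w) * 2)" using h by simp
  show "AE w in lborel. norm (cmod (h w) * window_error \<eta> lam (- w)) \<le> norm (cmod (h w) * 2)"
    using window_error_bounds by (intro AE_I2) (auto simp: abs_mult intro!: mult_left_mono)
qed

lemma averaged_error_tendsto: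
  assumes h: "integrable lborel h"
  shows "(averaged_error \<eta> h \<longlongrightarrow> 0) (at 0)"
  unfolding tendsto_at_iff_sequentially
proof (intro allI impI)
  fix X :: "nat \<Rightarrow> real" assume X: "\<forall>i. X i \<in> UNIV - {0}" "X \<longlonglongrightarrow> 0"
  have "(\<lambda>k. \<integral>w. cmod (h w) * window_error \<eta> (X k) (- w) \<partial>lborel) \<longlonglongrightarrow> (\<integral>w. 0 \<partial>(lborel :: ((real ^ 'n) \<times> (real ^ 'n)) measure))"
  proof (rule integral_dominated_convergence[where w = "\<lambda>w. cmod (h w) * 2"])
    show "AE w in lborel. (\<lambda>k. cmod (h w) * window_error \<eta> (X k) (- w)) \<longlonglongrightarrow> 0"
    proof (rule AE_I2)
      fix w
      have "((\<lambda>lam. window_error \<eta> lam (- w)) \<circ> X) \<longlonglongrightarrow> 0"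
        using window_error_tendsto[of "- w"] X unfolding tendsto_at_iff_sequentially by blast
      then show "(\<lambda>k. cmod (h w) * window_error \<eta> (X k) (- w)) \<longlonglongrightarrow> 0"
        by (intro tendsto_mult_right_zero) (simp add: comp_def)
    qed
    show "AE w in lborel. norm (cmod (h w) * window_error \<eta> (X k) (- w)) \<le> cmod (h w) * 2" for k
      using window_error_bounds by (intro AE_I2) (auto simp: abs_mult intro!: mult_left_mono)
  qed (use h averaged_error_integrable[OF h] in auto)
  then show "(averaged_error \<eta> h \<circ> X) \<longlonglongrightarrow> 0"
    by (simp add: comp_def averaged_error_def)
qed

text \<open>
  The main estimate. The vector \<open>V (T x)\<close> is the orthogonal projection of \<open>M (V x)\<close> to the range of the
  isometry \<open>V\<close>. The distance of \<open>M (V x)\<close> from that range is bounded by an average over characters, each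
  of which contributes at most its window error.
\<close>

lemma symbol_intertwining:
  assumes lam: "lam \<noteq> 0" and h: "integrable lborel h"
  shows "norm (l2_mult (fourier h) (voice_l2 \<eta> lam x) - voice_l2 \<eta> lam (blinfun_apply (nu \<eta> lam (cstar_of_l1 h)) x))
    \<le> averaged_error \<eta> h lam * norm x"
proof -
  let ?V = "voice_l2 \<eta> lam" and ?T = "nu \<eta> lam (cstar_of_l1 h)"
  define r where "r = l2_mult (fourier h) (?V x) - ?V (blinfun_apply ?T x)"
  have gh: "gelfand (cstar_of_l1 h) = fourier h" by (rule gelfand_cstar_of_l1[OF h])
  have iso: "l2_inner (?V x) (?V y) = l2_inner x y" for x y
    using l2_inner_voice_l2[OF \<eta> lam] \<eta>1 by simp
  \<comment> \<open>By the weak formula for \<open>?T\<close> and since \<open>?V\<close> preserves inner products.\<close>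
  have orth: "l2_inner r (?V y) = 0" for y
    using toeplitz_nu[OF \<eta> \<eta>1 lam, of "cstar_of_l1 h"]
    by (simp add: r_def l2_inner_diff_left iso gh toeplitz_def)
  have orth': "l2_inner (?V y) r = 0" for y using orth[of y] l2_inner_commute[of "?V y" r] by simp
  have "of_real ((norm r)\<^sup>2) = l2_inner (l2_mult (fourier h) (?V x)) r"
    unfolding l2_inner_self[symmetric] by (subst (1) r_def) (simp add: l2_inner_diff_left orth')
  also have "\<dots> = (\<integral>w. h w * l2_inner (l2_mult (character (- w)) (?V x)) r \<partial>lborel)"
    by (rule l2_mult_fourier(2)[OF h])
  finally have "(norm r)\<^sup>2 = cmod (\<integral>w. h w * l2_inner (l2_mult (character (- w)) (?V x)) r \<partial>lborel)"
    by (metis norm_of_real abs_power2)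
  also have "\<dots> \<le> (\<integral>w. cmod (h w * l2_inner (l2_mult (character (- w)) (?V x)) r) \<partial>lborel)"
    by (rule integral_norm_bound)
  also have "\<dots> \<le> (\<integral>w. (cmod (h w) * window_error \<eta> lam (- w)) * (norm x * norm r) \<partial>lborel)"
  proof (rule integral_mono')
    show "integrable lborel (\<lambda>w. (cmod (h w) * window_error \<eta> lam (- w)) * (norm x * norm r))"
      by (intro integrable_mult_left averaged_error_integrable h)
    fix w
    obtain y where y: "norm (l2_mult (character (- w)) (?V x) - ?V y) \<le> window_error \<eta> lam (- w) * norm x"
      using character_voice_near_range[OF lam] by blast
    \<comment> \<open>A vector in the range may be subtracted because \<open>r\<close> is orthogonal to the range.\<close>
    have "cmod (l2_inner (l2_mult (character (- w)) (?V x)) r)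
        = cmod (l2_inner (l2_mult (character (- w)) (?V x) - ?V y) r)"
      by (simp add: l2_inner_diff_left orth')
    also have "\<dots> \<le> window_error \<eta> lam (- w) * norm x * norm r"
      by (intro order_trans[OF l2_cauchy_schwarz] mult_right_mono y) simp
    finally show "cmod (h w * l2_inner (l2_mult (character (- w)) (?V x)) r)
        \<le> (cmod (h w) * window_error \<eta> lam (- w)) * (norm x * norm r)"
      unfolding norm_mult mult.assoc by (intro mult_left_mono) auto
    show "0 \<le> (cmod (h w) * window_error \<eta> lam (- w)) * (norm x * norm r)"
      using window_error_bounds(1) by simp
  qed
  also have "\<dots> = averaged_error \<eta> h lam * norm x * norm r"
    by (simp add: averaged_error_def)
  finally have sq: "norm r * norm r \<le> averaged_error \<eta> h lam * norm x * norm r"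
    by (simp add: power2_eq_square)
  have "0 \<le> averaged_error \<eta> h lam"
    by (rule averaged_error_nonneg)
  with sq have "norm r \<le> averaged_error \<eta> h lam * norm x"
    by (cases "norm r = 0") (auto simp: mult_le_cancel_right)
  then show ?thesis by (simp add: r_def)
qed

text \<open>
  If the second factor comes from \<open>L\<^sup>1\<close>, the difference is the compression of multiplication by
  \<open>gelfand h\<close> applied to the error in \<open>symbol_intertwining\<close>. General second factors are approximated by
  such elements, uniformly in \<open>lam\<close>.
\<close>

lemma nu_asymptotically_multiplicative:
  "((\<lambda>lam. norm (nu \<eta> lam (h * h') - (nu \<eta> lam h o\<^sub>L nu \<eta> lam h'))) \<longlongrightarrow> 0) (at 0)"
proof (rule tendstoI)
  fix e :: real assume e: "e > 0"
  define d where "d = e / (4 * (norm h + 1))"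
  have hp: "norm h + 1 > 0" by (simp add: add_nonneg_pos)
  then have d: "d > 0" using e by (simp add: d_def)
  have hd: "norm h * d \<le> e / 4"
  proof -
    have "p * (e / (4 * p)) = e / 4" if "p > 0" for p :: real using that by simp
    from this[OF hp] have "(norm h + 1) * d = e / 4" by (simp only: d_def)
    then show ?thesis using d by (simp add: distrib_right)
  qed
  obtain k where k: "integrable lborel k" "norm (h' - cstar_of_l1 k) < d"
    using l1_dense_cstar[OF d] by blast
  let ?k = "cstar_of_l1 k"
  have gk: "gelfand ?k = fourier k" by (rule gelfand_cstar_of_l1[OF k(1)])
  note mh = gelfand_measurable norm_gelfand_le[of h]
  have fk: "fourier k \<in> borel_measurable borel" "\<And>u. cmod (fourier k u) \<le> (\<integral>x. cmod (k x) \<partial>lborel)"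
    by (rule fourier_measurable[OF k(1)] norm_fourier_le[OF k(1)])+
  have main: "norm (nu \<eta> lam (h * ?k) - (nu \<eta> lam h o\<^sub>L nu \<eta> lam ?k)) \<le> norm h * averaged_error \<eta> k lam"
    if lam: "lam \<noteq> 0" for lam
  proof (rule norm_blinfun_bound)
    have ae: "0 \<le> averaged_error \<eta> k lam"
      by (rule averaged_error_nonneg)
    then show "0 \<le> norm h * averaged_error \<eta> k lam" by simp
    fix x
    let ?V = "voice_l2 \<eta> lam"
    let ?r = "l2_mult (fourier k) (?V x) - ?V (blinfun_apply (nu \<eta> lam ?k) x)"
    show "norm (blinfun_apply (nu \<eta> lam (h * ?k) - (nu \<eta> lam h o\<^sub>L nu \<eta> lam ?k)) x)
        \<le> norm h * averaged_error \<eta> k lam * norm x"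
    proof (rule norm_l2_leI)
      show "0 \<le> norm h * averaged_error \<eta> k lam * norm x" using ae by simp
      fix y
      have "l2_inner (blinfun_apply (nu \<eta> lam (h * ?k) - (nu \<eta> lam h o\<^sub>L nu \<eta> lam ?k)) x) y
          = l2_inner (l2_mult (gelfand h) (l2_mult (fourier k) (?V x))) (?V y)
            - l2_inner (l2_mult (gelfand h) (?V (blinfun_apply (nu \<eta> lam ?k) x))) (?V y)"
        using toeplitz_nu[OF \<eta> \<eta>1 lam]
        by (simp add: blinfun.diff_left l2_inner_diff_left toeplitz_def gelfand_mult gk
            l2_mult_mult[OF mh fk])
      also have "\<dots> = l2_inner (l2_mult (gelfand h) ?r) (?V y)"
        using l2_mult_add[OF mh, of ?r "?V (blinfun_apply (nu \<eta> lam ?k) x)"]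
        by (simp add: l2_inner_add_left)
      finally have "cmod (l2_inner (blinfun_apply (nu \<eta> lam (h * ?k) - (nu \<eta> lam h o\<^sub>L nu \<eta> lam ?k)) x) y)
          \<le> norm (l2_mult (gelfand h) ?r) * norm (?V y)" by (simp add: l2_cauchy_schwarz)
      also have "\<dots> \<le> (norm h * (averaged_error \<eta> k lam * norm x)) * norm (?V y)"
        by (intro mult_right_mono order_trans[OF norm_l2_mult_le[OF mh]] mult_left_mono
            symbol_intertwining[OF lam k(1)]) auto
      finally show "cmod (l2_inner (blinfun_apply (nu \<eta> lam (h * ?k) - (nu \<eta> lam h o\<^sub>L nu \<eta> lam ?k)) x) y)
          \<le> norm h * averaged_error \<eta> k lam * norm x * norm y"
        by (simp add: norm_voice_eta[OF \<eta> \<eta>1 lam] ac_simps)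
    qed
  qed
  have "((\<lambda>lam. norm h * averaged_error \<eta> k lam) \<longlongrightarrow> 0) (at 0)"
    using tendsto_mult_right_zero[OF averaged_error_tendsto[OF k(1)]] by blast
  then have "\<forall>\<^sub>F lam in at 0. norm h * averaged_error \<eta> k lam < e / 2"
    by (rule order_tendstoD(2)) (use e in simp)
  moreover have "\<forall>\<^sub>F lam in at 0. lam \<noteq> (0::real)" by (simp add: eventually_at_filter)
  ultimately show "\<forall>\<^sub>F lam in at 0. dist (norm (nu \<eta> lam (h * h') - (nu \<eta> lam h o\<^sub>L nu \<eta> lam h'))) 0 < e"
  proof eventually_elim
    case (elim lam)
    then have lam: "lam \<noteq> 0" by simp
    note nd = nu_diff[OF \<eta> \<eta>1 lam] and nle = norm_nu_le[OF \<eta> \<eta>1 lam]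
    have "nu \<eta> lam (h * h') - (nu \<eta> lam h o\<^sub>L nu \<eta> lam h')
        = (nu \<eta> lam (h * ?k) - (nu \<eta> lam h o\<^sub>L nu \<eta> lam ?k))
          + (nu \<eta> lam (h * (h' - ?k)) - (nu \<eta> lam h o\<^sub>L nu \<eta> lam (h' - ?k)))"
      by (rule blinfun_eqI) (simp add: right_diff_distrib nd blinfun.diff_left blinfun.add_left blinfun.diff_right)
    then have "norm (nu \<eta> lam (h * h') - (nu \<eta> lam h o\<^sub>L nu \<eta> lam h'))
        \<le> norm (nu \<eta> lam (h * ?k) - (nu \<eta> lam h o\<^sub>L nu \<eta> lam ?k))
          + (norm (nu \<eta> lam (h * (h' - ?k))) + norm (nu \<eta> lam h o\<^sub>L nu \<eta> lam (h' - ?k)))"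
      by (rule norm_add_diff_le)
    also have "\<dots> \<le> norm h * averaged_error \<eta> k lam + (norm h * norm (h' - ?k) + norm h * norm (h' - ?k))"
      by (intro add_mono main[OF lam] order_trans[OF nle norm_mult_ineq]
          order_trans[OF norm_blinfun_compose] mult_mono nle) auto
    also have "\<dots> \<le> norm h * averaged_error \<eta> k lam + (norm h * d + norm h * d)"
      using k(2) by (intro add_mono mult_left_mono) auto
    also have "\<dots> < e" using elim hd by linarith
    finally show ?case by simp
  qed
qed

text \<open>
  A character acts on the transform of a coherent state at \<open>(a, b)\<close> almost as the scalar
  \<open>character w (a, b)\<close>, and superposing these scalars gives back the value of the symbol at \<open>(a, b)\<close>.
\<close>

lemma nu_coherent_state_eigenvector:
  "((\<lambda>lam. norm (blinfun_apply (nu \<eta> lam h) (coherent_state \<eta> lam a b)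
      - gelfand h (a, b) *\<^sub>C coherent_state \<eta> lam a b)) \<longlongrightarrow> 0) (at 0)"
proof (rule tendstoI)
  fix e :: real assume e: "e > 0"
  obtain k where k: "integrable lborel k" "norm (h - cstar_of_l1 k) < e / 4"
    using l1_dense_cstar[of "e / 4"] e by auto
  let ?k = "cstar_of_l1 k"
  have gk: "gelfand ?k = fourier k" by (rule gelfand_cstar_of_l1[OF k(1)])
  have main: "norm (blinfun_apply (nu \<eta> lam ?k) (coherent_state \<eta> lam a b)
      - fourier k (a, b) *\<^sub>C coherent_state \<eta> lam a b) \<le> 2 * averaged_error \<eta> k lam"
    if lam: "lam \<noteq> 0" for lam
  proof (rule norm_l2_leI)
    show "0 \<le> 2 * averaged_error \<eta> k lam"
      using averaged_error_nonneg[of k lam] by simp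
    fix y
    let ?V = "voice_l2 \<eta> lam" and ?c = "coherent_state \<eta> lam a b"
    have iso: "l2_inner (?V x) (?V y) = l2_inner x y" for x y
      using l2_inner_voice_l2[OF \<eta> lam] \<eta>1 by simp
    define I where "I w = l2_inner (l2_mult (character (- w)) (?V ?c)) (?V y)" for w
    have I1: "l2_inner (blinfun_apply (nu \<eta> lam ?k) ?c) y = (\<integral>w. k w * I w \<partial>lborel)"
      using toeplitz_nu[OF \<eta> \<eta>1 lam, of ?k] l2_mult_fourier(2)[OF k(1)]
      by (simp add: toeplitz_def gk I_def)
    have I2: "l2_inner (fourier k (a, b) *\<^sub>C ?c) y = (\<integral>w. k w * (character (- w) (a, b) * l2_inner ?c y) \<partial>lborel)"
      unfolding l2_inner_scaleC_left fourier_def integral_mult_left_zero[symmetric]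
      by (simp add: character_def mult.assoc)
    have i2: "integrable lborel (\<lambda>w. k w * (character (- w) (a, b) * l2_inner ?c y))"
      using integrable_mult_left[OF integrable_fourier_kernel[OF k(1), of "(a, b)"], of "l2_inner ?c y"]
      by (simp add: character_def mult.assoc)
    have i1: "integrable lborel (\<lambda>w. k w * I w)"
      unfolding I_def by (rule l2_mult_fourier(1)[OF k(1)])
    have "l2_inner (blinfun_apply (nu \<eta> lam ?k) ?c - fourier k (a, b) *\<^sub>C ?c) y
        = (\<integral>w. k w * I w - k w * (character (- w) (a, b) * l2_inner ?c y) \<partial>lborel)"
      unfolding l2_inner_diff_left I1 I2 by (rule Bochner_Integration.integral_diff[OF i1 i2, symmetric])
    then have "cmod (l2_inner (blinfun_apply (nu \<eta> lam ?k) ?c - fourier k (a, b) *\<^sub>C ?c) y)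
        \<le> (\<integral>w. cmod (k w * I w - k w * (character (- w) (a, b) * l2_inner ?c y)) \<partial>lborel)"
      by (simp only: integral_norm_bound)
    also have "\<dots> \<le> (\<integral>w. (cmod (k w) * window_error \<eta> lam (- w)) * (2 * norm y) \<partial>lborel)"
    proof (rule integral_mono')
      show "integrable lborel (\<lambda>w. (cmod (k w) * window_error \<eta> lam (- w)) * (2 * norm y))"
        by (intro integrable_mult_left averaged_error_integrable k)
      fix w
      have "I w - character (- w) (a, b) * l2_inner ?c y
          = l2_inner (l2_mult (character (- w)) (?V ?c) - character (- w) (a, b) *\<^sub>C ?V ?c) (?V y)"
        by (simp add: I_def l2_inner_diff_left l2_inner_scaleC_left iso)
      also have "cmod \<dots> \<le> (2 * window_error \<eta> lam (- w)) * norm (?V y)"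
        by (intro order_trans[OF l2_cauchy_schwarz] mult_right_mono character_voice_coherent lam) simp
      finally have "cmod (k w) * cmod (I w - character (- w) (a, b) * l2_inner ?c y)
          \<le> cmod (k w) * ((2 * window_error \<eta> lam (- w)) * norm y)"
        unfolding norm_voice_eta[OF \<eta> \<eta>1 lam] by (intro mult_left_mono) auto
      then show "cmod (k w * I w - k w * (character (- w) (a, b) * l2_inner ?c y))
          \<le> (cmod (k w) * window_error \<eta> lam (- w)) * (2 * norm y)"
        unfolding right_diff_distrib[symmetric] norm_mult by (simp add: ac_simps)
      show "0 \<le> (cmod (k w) * window_error \<eta> lam (- w)) * (2 * norm y)"
        using window_error_bounds(1) by simp
    qed
    also have "\<dots> = 2 * averaged_error \<eta> k lam * norm y"
      by (simp add: averaged_error_def)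
    finally show "cmod (l2_inner (blinfun_apply (nu \<eta> lam ?k) ?c - fourier k (a, b) *\<^sub>C ?c) y)
        \<le> 2 * averaged_error \<eta> k lam * norm y" .
  qed
  have "((\<lambda>lam. 2 * averaged_error \<eta> k lam) \<longlongrightarrow> 0) (at 0)"
    using tendsto_mult_right_zero[OF averaged_error_tendsto[OF k(1)]] by blast
  then have "\<forall>\<^sub>F lam in at 0. 2 * averaged_error \<eta> k lam < e / 2"
    by (rule order_tendstoD(2)) (use e in simp)
  moreover have "\<forall>\<^sub>F lam in at 0. lam \<noteq> (0::real)" by (simp add: eventually_at_filter)
  ultimately show "\<forall>\<^sub>F lam in at 0. dist (norm (blinfun_apply (nu \<eta> lam h) (coherent_state \<eta> lam a b)
      - gelfand h (a, b) *\<^sub>C coherent_state \<eta> lam a b)) 0 < e"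
  proof eventually_elim
    case (elim lam)
    then have lam: "lam \<noteq> 0" by simp
    let ?c = "coherent_state \<eta> lam a b"
    have c1: "norm ?c = 1" by (rule norm_coherent_state[OF \<eta> \<eta>1 lam])
    have A: "norm (blinfun_apply (nu \<eta> lam (h - ?k)) ?c) \<le> norm (h - ?k)"
      using norm_blinfun[of "nu \<eta> lam (h - ?k)" ?c] norm_nu_le[OF \<eta> \<eta>1 lam, of "h - ?k"] by (simp add: c1)
    have B: "norm (gelfand (h - ?k) (a, b) *\<^sub>C ?c) \<le> norm (h - ?k)"
      using norm_gelfand_le by (simp add: norm_scaleC c1)
    have "blinfun_apply (nu \<eta> lam h) ?c - gelfand h (a, b) *\<^sub>C ?c
        = (blinfun_apply (nu \<eta> lam ?k) ?c - fourier k (a, b) *\<^sub>C ?c)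
          + (blinfun_apply (nu \<eta> lam (h - ?k)) ?c - gelfand (h - ?k) (a, b) *\<^sub>C ?c)"
      by (simp add: nu_diff[OF \<eta> \<eta>1 lam] blinfun.diff_left gelfand_minus gk
          bounded_bilinear.diff_left[OF bounded_bilinear_scaleC])
    then have "norm (blinfun_apply (nu \<eta> lam h) ?c - gelfand h (a, b) *\<^sub>C ?c)
        \<le> norm (blinfun_apply (nu \<eta> lam ?k) ?c - fourier k (a, b) *\<^sub>C ?c)
          + (norm (blinfun_apply (nu \<eta> lam (h - ?k)) ?c) + norm (gelfand (h - ?k) (a, b) *\<^sub>C ?c))"
      by (rule norm_add_diff_le)
    also have "\<dots> < e" using A B main[OF lam] elim k(2) by linarith
    finally show ?case by simp
  qed
qed

text \<open>
  The upper bound holds for every \<open>lam\<close>; approximate eigenvectors for values of the symbol near its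
  supremum give the lower bound.
\<close>

lemma norm_nu_tendsto:
  "((\<lambda>lam. norm (nu \<eta> lam h)) \<longlongrightarrow> norm h) (at 0)"
proof (rule tendstoI)
  fix e :: real assume e: "e > 0"
  have "norm h - e / 2 < (SUP u. cmod (gelfand h u))"
    using e by (simp add: norm_group_cstar)
  then obtain u where u: "norm h - e / 2 < cmod (gelfand h u)"
    by (subst (asm) less_cSUP_iff) (auto simp: bdd_above_gelfand)
  obtain a b where ab: "u = (a, b)" by (cases u)
  have "\<forall>\<^sub>F lam in at 0. norm (blinfun_apply (nu \<eta> lam h) (coherent_state \<eta> lam a b)
      - gelfand h (a, b) *\<^sub>C coherent_state \<eta> lam a b) < e / 2"
    by (rule order_tendstoD(2)[OF nu_coherent_state_eigenvector]) (use e in simp)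
  moreover have "\<forall>\<^sub>F lam in at 0. lam \<noteq> (0::real)" by (simp add: eventually_at_filter)
  ultimately show "\<forall>\<^sub>F lam in at 0. dist (norm (nu \<eta> lam h)) (norm h) < e"
  proof eventually_elim
    case (elim lam)
    then have lam: "lam \<noteq> 0" by simp
    let ?c = "coherent_state \<eta> lam a b"
    have c1: "norm ?c = 1" by (rule norm_coherent_state[OF \<eta> \<eta>1 lam])
    have "cmod (gelfand h u) = norm (gelfand h (a, b) *\<^sub>C ?c)" by (simp add: ab norm_scaleC c1)
    also have "\<dots> \<le> norm (blinfun_apply (nu \<eta> lam h) ?c) + norm (blinfun_apply (nu \<eta> lam h) ?c - gelfand h (a, b) *\<^sub>C ?c)"
      using norm_triangle_sub[of "gelfand h (a, b) *\<^sub>C ?c" "blinfun_apply (nu \<eta> lam h) ?c"]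
      by (simp add: norm_minus_commute)
    also have "norm (blinfun_apply (nu \<eta> lam h) ?c) \<le> norm (nu \<eta> lam h)"
      using norm_blinfun[of "nu \<eta> lam h" ?c] by (simp add: c1)
    finally show ?case
      using elim u norm_nu_le[OF \<eta> \<eta>1 lam, of h] by (simp add: dist_real_def abs_if)
  qed
qed

section \<open>The operator field of an element of the group algebra\<close>

lemma field_norm_nu_field: "field_norm (nu_field \<eta> h) = norm h"
proof -
  have "(SUP lam\<in>- {0}. norm (fiber (nu_field \<eta> h) lam)) \<le> norm h"
  proof (rule cSUP_least)
    show "- {0::real} \<noteq> {}" by (metis ComplI empty_iff singletonD zero_neq_one)
  qed (simp add: nu_field_def norm_nu_le[OF \<eta> \<eta>1])
  then show ?thesis by (simp add: field_norm_def nu_field_def)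
qed

lemma nu_field_in_operator_fields: "nu_field \<eta> h \<in> operator_fields"
proof -
  have "continuous_on (- {0}) (\<lambda>lam. if lam = 0 then 0 else nu \<eta> lam h)"
    using continuous_nu[OF \<eta> \<eta>1] by (subst continuous_on_cong[OF refl]) auto
  moreover have "((\<lambda>lam. norm (if lam = 0 then 0 else nu \<eta> lam h)) \<longlongrightarrow> 0) at_infinity"
  proof (rule Lim_transform_eventually[OF nu_vanishes_at_infinity[OF \<eta> \<eta>1]])
    show "\<forall>\<^sub>F lam in at_infinity. norm (nu \<eta> lam h) = norm (if lam = 0 then 0 else nu \<eta> lam h)"
      unfolding eventually_at_infinity by (intro exI[of _ 1]) auto
  qed
  moreover have "bdd_above ((\<lambda>lam. norm (if lam = 0 then 0 else nu \<eta> lam h)) ` (- {0}))"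
    by (rule bdd_aboveI2[where M = "norm h"]) (simp add: norm_nu_le[OF \<eta> \<eta>1])
  ultimately show ?thesis
    by (simp add: operator_fields_def nu_field_def compact_operator_nu[OF \<eta> \<eta>1])
qed

end

theorem proposition2p14:
  fixes \<eta> :: "real ^ 'n \<Rightarrow> complex"
  assumes "schwartz \<eta>" and "norm (l2_of \<eta>) = 1"
  shows
    "(\<forall>h. nu_field \<eta> h \<in> operator_fields) \<and>
     (\<forall>h h'. nu_field \<eta> (h + h') = field_add (nu_field \<eta> h) (nu_field \<eta> h')) \<and>
     (\<forall>c h. nu_field \<eta> (c *\<^sub>C h) = field_scale c (nu_field \<eta> h)) \<and>
     (bdd_above ((\<lambda>h. field_norm (nu_field \<eta> h)) ` cball 0 1) \<and>
      (SUP h\<in>cball 0 1. field_norm (nu_field \<eta> h)) = 1) \<and>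
     (\<forall>h h'. ((\<lambda>lam. norm (nu \<eta> lam (h * h') - (nu \<eta> lam h o\<^sub>L nu \<eta> lam h'))) \<longlongrightarrow> 0) (at 0)) \<and>
     (\<forall>h. ((\<lambda>lam. norm (nu \<eta> lam (involution h) - l2_adjoint (nu \<eta> lam h))) \<longlongrightarrow> 0) (at 0)) \<and>
     (\<forall>a b h. ((\<lambda>lam. norm (blinfun_apply (fiber (nu_field \<eta> h) lam) (coherent_state \<eta> lam a b)
        - gelfand h (a, b) *\<^sub>C coherent_state \<eta> lam a b)) \<longlongrightarrow> 0) (at 0)) \<and>
     (\<forall>h. ((\<lambda>lam. norm (fiber (nu_field \<eta> h) lam)) \<longlongrightarrow> (SUP u. cmod (gelfand h u))) (at 0))"
proof -
  have \<eta>: "tame \<eta>" by (rule schwartz_tame[OF assms(1)])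
  note \<eta>1 = assms(2)
  have nz: "\<forall>\<^sub>F lam in at 0. lam \<noteq> (0::real)" by (simp add: eventually_at_filter)
  have fib: "fiber (nu_field \<eta> h) lam = nu \<eta> lam h" if "lam \<noteq> 0" for lam h
    using that by (simp add: nu_field_def)
  have add: "nu_field \<eta> (h + h') = field_add (nu_field \<eta> h) (nu_field \<eta> h')" for h h'
    by (auto simp: nu_field_def field_add_def fun_eq_iff nu_add[OF \<eta> \<eta>1])
  have scale: "nu_field \<eta> (c *\<^sub>C h) = field_scale c (nu_field \<eta> h)" for c h
    by (auto simp: nu_field_def field_scale_def fun_eq_iff nu_scaleC[OF \<eta> \<eta>1]
        bounded_bilinear.zero_right[OF bounded_bilinear_scaleC])
  have norm: "bdd_above ((\<lambda>h. field_norm (nu_field \<eta> h)) ` cball 0 1)"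
    "(SUP h\<in>cball 0 1. field_norm (nu_field \<eta> h)) = 1"
  proof -
    show "bdd_above ((\<lambda>h. field_norm (nu_field \<eta> h)) ` cball 0 1)"
      by (rule bdd_aboveI2[where M = 1]) (simp add: field_norm_nu_field[OF \<eta> \<eta>1])
    obtain x :: "((real ^ 'n) \<times> (real ^ 'n)) group_cstar" where "norm x = 1"
      using exists_norm_one_cstar by blast
    then show "(SUP h\<in>cball 0 1. field_norm (nu_field \<eta> h)) = 1"
      unfolding field_norm_nu_field[OF \<eta> \<eta>1]
      by (intro cSup_eq_maximum) (auto intro!: image_eqI[of _ _ x])
  qed
  have invol: "((\<lambda>lam. norm (nu \<eta> lam (involution h) - l2_adjoint (nu \<eta> lam h))) \<longlongrightarrow> 0) (at 0)" for h
  proof (rule tendsto_eventually)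
    show "\<forall>\<^sub>F lam in at 0. norm (nu \<eta> lam (involution h) - l2_adjoint (nu \<eta> lam h)) = 0"
      using nz by eventually_elim (simp add: nu_involution[OF \<eta> \<eta>1])
  qed
  have eigen: "((\<lambda>lam. norm (blinfun_apply (fiber (nu_field \<eta> h) lam) (coherent_state \<eta> lam a b)
        - gelfand h (a, b) *\<^sub>C coherent_state \<eta> lam a b)) \<longlongrightarrow> 0) (at 0)" for a b h
    by (rule Lim_transform_eventually[OF nu_coherent_state_eigenvector[OF \<eta> \<eta>1]])
       (use nz in eventually_elim, simp add: fib)
  have lim: "((\<lambda>lam. norm (fiber (nu_field \<eta> h) lam)) \<longlongrightarrow> (SUP u. cmod (gelfand h u))) (at 0)" for h
    unfolding norm_group_cstar[symmetric]
    by (rule Lim_transform_eventually[OF norm_nu_tendsto[OF \<eta> \<eta>1]])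
       (use nz in eventually_elim, simp add: fib)
  show ?thesis
    by (intro conjI allI nu_field_in_operator_fields[OF \<eta> \<eta>1] add scale norm
      nu_asymptotically_multiplicative[OF \<eta> \<eta>1] invol eigen lim)
qed

end
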